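(* Let $\mathcal D\subset T\operatorname{Diff}S^1$ be the left-invariant subbundle generated by $\mathfrak d=\ker\eta_0\cap\ker\eta_1\subset\operatorname{Vect}S^1$, with the left-invariant sub-Riemannian metric whose value on $\mathfrak d$ is $(x,y)_{-1,1}=\langle L_{-1,1}Jx',y\rangle$ (the lift of the Weil–Petersson metric on $\operatorname{Diff}S^1/\text{Möb}$). Let $\gamma\colon[0,1]\to\operatorname{Diff}S^1$ be a smooth $\mathcal D$-horizontal curve with left logarithmic derivative $u=\kappa^\ell(\dot\gamma)$. Then $\gamma$ is a normal sub-Riemannian geodesic if and only if there is a curve $t\mapsto\lambda(t)$ in $\mathfrak m$ (the Lie algebra of $\text{Möb}$) such that $$L_{-1,1}J\dot u'+\dot\lambda=\operatorname{ad}_u^\top\big(L_{-1,1}Ju'+\lambda\big).$$ Moreover, writing $\lambda=\lambda_0+we^{i\theta}+\overline we^{-i\theta}$ with $\lambda_0(t)\in\mathbb R$, $w(t)\in\mathbb C$, and $u=\sum_{n=2}^\infty(c_ne^{in\theta}+\overline c_ne^{-in\theta})$, one obtains from this equation $$\dot\lambda_0=0,\qquad \dot w=3i\,\overline w\,c_2,$$ and $u$ must solve the equation $$\dot v'''+\dot v'=uv''''+uv''+2u'v'''+2u'v'+2\lambda u'+u\lambda'-3i\left(\overline wc_2e^{i\theta}-w\overline c_2e^{-i\theta}\right),\qquad v=Ju.$$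
   Context: $\operatorname{Diff}S^1$ is the Fréchet–Lie group of orientation-preserving $C^\infty$ diffeomorphisms of $S^1=\mathbb R/2\pi\mathbb Z$. Its Lie algebra is $\operatorname{Vect}S^1$, the smooth real vector fields $x\,\partial_\theta$, identified with functions $x\in C^\infty(S^1,\mathbb R)$, with bracket equal to the negative of the usual commutator: $[x,y]=x'y-xy'$. Dot denotes the derivative in $t$, prime the derivative in $\theta$. The left Maurer–Cartan form is $\kappa^\ell(v)=d\ell_{\varphi^{-1}}v$ for $v\in T_\varphi\operatorname{Diff}S^1$, where $\ell_\varphi$ is left multiplication; for a curve $\gamma$, $\kappa^\ell(\dot\gamma)=\dot\gamma/\gamma'$. $\eta_0(x)=\frac1{2\pi}\int_0^{2\pi}x\,d\theta$ and $\eta_1(x)=\frac1{2\pi}\int_0^{2\pi}x(\theta)e^{-i\theta}\,d\theta$. $\text{Möb}\subset\operatorname{Diff}S^1$ is the group of Möbius automorphisms of the unit disk restricted to $S^1$; its Lie algebra is $\mathfrak m=\{\lambda_0+we^{i\theta}+\overline we^{-i\theta}:\lambda_0\in\mathbb R,\ w\in\mathbb C\}$, and $\operatorname{Vect}S^1=\mathfrak d\oplus\mathfrak m$. $\langle x,y\rangle=\frac1{2\pi}\int_0^{2\pi}xy\,d\theta$; $L_{\alpha\beta}=\beta\partial_\theta^2-\alpha$, so $L_{-1,1}=\partial_\theta^2+1$; $J$ is the Hilbert transform $Jx(\theta)=\frac1{2\pi}\,\text{p.v.}\int_0^{2\pi}\frac{x(t)}{\tan((t-\theta)/2)}\,dt$;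 and $\operatorname{ad}_x^\top(y)=xy'+2x'y$ (the adjoint of $\operatorname{ad}_x$ with respect to $\langle\cdot,\cdot\rangle$). The inner product $(\cdot,\cdot)$ on $\operatorname{Vect}S^1$ used below equals $(\cdot,\cdot)_{-1,1}$ on $\mathfrak d$, equals $\langle\cdot,\cdot\rangle$ on $\mathfrak m$, and makes $\mathfrak d$ and $\mathfrak m$ orthogonal. $\mathcal D$ consists of all $v\in T\operatorname{Diff}S^1$ with $\kappa^\ell(v)\in\mathfrak d$; $\gamma$ is horizontal if $\dot\gamma(t)\in\mathcal D_{\gamma(t)}$ for all $t$. With $I=[0,1]$ and $u=\kappa^\ell(\dot\gamma)$, let $\tau_ux=\dot x+[u,x]$ for $x\in C^\infty(I,\operatorname{Vect}S^1)$, $\mathfrak A=\{x\in C^\infty(I,\operatorname{Vect}S^1):x(0)=x(1)=0\}$, and $\mathfrak A_{\mathcal D}=\{x\in\mathfrak A:\tau_ux\in C^\infty(I,\mathfrak d)\}$. A horizontal curve $\gamma$ is a normal sub-Riemannian geodesic if $\int_0^1(u,\tau_ux)\,dt=0$ for all $x\in\mathfrak A_{\mathcal D}$. *)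

theory Defs
  imports "HOL-Analysis.Analysis"
begin

section \<open>Smooth functions\<close>

text \<open>Functions on the circle of length \<open>2\<pi>\<close> are \<open>2\<pi>\<close>-periodic functions on the real line.
  The circle itself, on which diffeomorphisms act, is the unit circle in the complex plane,
  with angle coordinate \<open>\<theta> \<mapsto> cis \<theta>\<close>.\<close>

definition smooth :: "(real \<Rightarrow> 'a::real_normed_vector) \<Rightarrow> bool" where
  "smooth f \<longleftrightarrow> (\<exists>D :: nat \<Rightarrow> real \<Rightarrow> 'a. D 0 = f \<and>
     (\<forall>k \<theta>. (D k has_vector_derivative D (Suc k) \<theta>) (at \<theta>)))"

text \<open>Smoothness of \<open>(t, \<theta>) \<mapsto> f t \<theta>\<close> on \<open>[0,1] \<times> \<real>\<close>, one-sidedly in \<open>t\<close> at the endpoints: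
  all mixed partial derivatives \<open>D i j = \<partial>\<^sub>t\<^sup>i \<partial>\<^sub>\<theta>\<^sup>j f\<close> exist and are jointly continuous. For periodic
  \<open>f t\<close> this is smoothness of \<open>t \<mapsto> f t\<close> as a curve in the Frechet space of smooth functions.
  Values of \<open>f t\<close> for \<open>t\<close> outside \<open>[0,1]\<close> are irrelevant.\<close>

definition smooth_family :: "(real \<Rightarrow> real \<Rightarrow> 'a::real_normed_vector) \<Rightarrow> bool" where
  "smooth_family f \<longleftrightarrow> (\<exists>D :: nat \<Rightarrow> nat \<Rightarrow> real \<Rightarrow> real \<Rightarrow> 'a.
     (\<forall>t\<in>{0..1}. D 0 0 t = f t) \<and>
     (\<forall>i j. continuous_on ({0..1} \<times> UNIV) (\<lambda>(t, \<theta>). D i j t \<theta>) \<and>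
        (\<forall>t\<in>{0..1}. \<forall>\<theta>.
           ((\<lambda>s. D i j s \<theta>) has_vector_derivative D (Suc i) j t \<theta>) (at t within {0..1}) \<and>
           (D i j t has_vector_derivative D i (Suc j) t \<theta>) (at \<theta>))))"

definition time_deriv :: "(real \<Rightarrow> real \<Rightarrow> 'a::real_normed_vector) \<Rightarrow> real \<Rightarrow> real \<Rightarrow> 'a" where
  "time_deriv f t \<theta> = vector_derivative (\<lambda>s. f s \<theta>) (at t within {0..1})"

section \<open>Vector fields on the circle\<close>

definition Vect :: "(real \<Rightarrow> real) set" where
  "Vect = {x. smooth x \<and> (\<forall>\<theta>. x (\<theta> + 2 * pi) = x \<theta>)}"

definition bracket :: "(real \<Rightarrow> real) \<Rightarrow> (real \<Rightarrow> real) \<Rightarrow> real \<Rightarrow> real" where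
  "bracket x y = (\<lambda>\<theta>. deriv x \<theta> * y \<theta> - x \<theta> * deriv y \<theta>)"

definition eta0 :: "(real \<Rightarrow> real) \<Rightarrow> real" where
  "eta0 x = 1 / (2 * pi) * integral {0..2 * pi} x"

definition fourier_coeff :: "nat \<Rightarrow> (real \<Rightarrow> real) \<Rightarrow> complex" where
  "fourier_coeff n x =
     1 / (2 * complex_of_real pi) *
       integral {0..2 * pi} (\<lambda>\<theta>. complex_of_real (x \<theta>) * cis (- (real n * \<theta>)))"

abbreviation eta1 :: "(real \<Rightarrow> real) \<Rightarrow> complex" where
  "eta1 \<equiv> fourier_coeff 1"

definition ker_eta :: "(real \<Rightarrow> real) set" ("\<dd>") where
  "\<dd> = {x \<in> Vect. eta0 x = 0 \<and> eta1 x = 0}"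

definition mob_algebra :: "(real \<Rightarrow> real) set" ("\<mm>") where
  "\<mm> = {x. \<exists>(a::real) (w::complex). \<forall>\<theta>.
          complex_of_real (x \<theta>) = complex_of_real a + w * cis \<theta> + cnj w * cis (- \<theta>)}"

text \<open>Smooth curves \<open>C\<^sup>\<infinity>([0,1], V)\<close> in a subspace \<open>V\<close> of the vector fields.\<close>

definition curves :: "(real \<Rightarrow> real) set \<Rightarrow> (real \<Rightarrow> real \<Rightarrow> real) set" where
  "curves V = {x. smooth_family x \<and> (\<forall>t\<in>{0..1}. x t \<in> V)}"

section \<open>Inner products and operators\<close>

definition L2 :: "(real \<Rightarrow> real) \<Rightarrow> (real \<Rightarrow> real) \<Rightarrow> real" where
  "L2 x y = 1 / (2 * pi) * integral {0..2 * pi} (\<lambda>\<theta>. x \<theta> * y \<theta>)"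

definition L :: "real \<Rightarrow> real \<Rightarrow> (real \<Rightarrow> real) \<Rightarrow> real \<Rightarrow> real" where
  "L \<alpha> \<beta> x = (\<lambda>\<theta>. \<beta> * deriv (deriv x) \<theta> - \<alpha> * x \<theta>)"

text \<open>The integrand of the principal value integral is \<open>2\<pi>\<close>-periodic in \<open>t\<close>, with its only singularity
  on the circle at \<open>t = \<theta>\<close>; \<open>[\<theta> + \<epsilon>, \<theta> + 2\<pi> - \<epsilon>]\<close> is the complement of the \<open>\<epsilon>\<close>-arc
  around \<open>\<theta>\<close>.\<close>

definition hilbert :: "(real \<Rightarrow> real) \<Rightarrow> real \<Rightarrow> real" where
  "hilbert x \<theta> = 1 / (2 * pi) *
     Lim (at_right 0) (\<lambda>\<epsilon>. integral {\<theta> + \<epsilon>..\<theta> + 2 * pi - \<epsilon>} (\<lambda>t. x t / tan ((t - \<theta>) / 2)))"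

definition ad_transpose :: "(real \<Rightarrow> real) \<Rightarrow> (real \<Rightarrow> real) \<Rightarrow> real \<Rightarrow> real" where
  "ad_transpose x y = (\<lambda>\<theta>. x \<theta> * deriv y \<theta> + 2 * deriv x \<theta> * y \<theta>)"

definition weil_petersson :: "(real \<Rightarrow> real) \<Rightarrow> (real \<Rightarrow> real) \<Rightarrow> real" where
  "weil_petersson x y = L2 (L (-1) 1 (hilbert (deriv x))) y"

text \<open>The components of a vector field in the decomposition \<open>Vect = \<dd> \<oplus> \<mm>\<close>.\<close>

definition proj_m :: "(real \<Rightarrow> real) \<Rightarrow> real \<Rightarrow> real" where
  "proj_m x = (THE y. y \<in> \<mm> \<and> (\<lambda>\<theta>. x \<theta> - y \<theta>) \<in> \<dd>)"

definition proj_d :: "(real \<Rightarrow> real) \<Rightarrow> real \<Rightarrow> real" where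
  "proj_d x = (\<lambda>\<theta>. x \<theta> - proj_m x \<theta>)"

definition vect_inner :: "(real \<Rightarrow> real) \<Rightarrow> (real \<Rightarrow> real) \<Rightarrow> real" where
  "vect_inner x y = weil_petersson (proj_d x) (proj_d y) + L2 (proj_m x) (proj_m y)"

section \<open>The diffeomorphism group and the distribution\<close>

text \<open>The angular derivative of a map from the circle into the complex plane.\<close>

definition angle_deriv :: "(complex \<Rightarrow> complex) \<Rightarrow> real \<Rightarrow> complex" where
  "angle_deriv \<phi> \<theta> = vector_derivative (\<lambda>s. \<phi> (cis s)) (at \<theta>)"

text \<open>If \<open>\<phi> (cis \<theta>) = cis (f \<theta>)\<close> for a local angle function \<open>f\<close>, then
  \<open>cnj (\<phi> (cis \<theta>)) * angle_deriv \<phi> \<theta> = \<i> f'(\<theta>)\<close>, so the last condition says that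
  \<open>\<phi>\<close> preserves orientation. Values of \<open>\<phi>\<close> off the circle are irrelevant.\<close>

definition Diff :: "(complex \<Rightarrow> complex) set" where
  "Diff = {\<phi>. bij_betw \<phi> (sphere 0 1) (sphere 0 1) \<and>
     smooth (\<lambda>\<theta>. \<phi> (cis \<theta>)) \<and> smooth (\<lambda>\<theta>. inv_into (sphere 0 1) \<phi> (cis \<theta>)) \<and>
     (\<forall>\<theta>. Im (cnj (\<phi> (cis \<theta>)) * angle_deriv \<phi> \<theta>) > 0)}"

text \<open>A tangent vector at \<open>\<phi>\<close> is a vector field along \<open>\<phi>\<close>: \<open>v \<theta>\<close> is tangent to the unit circle
  at \<open>\<phi> (cis \<theta>)\<close>.\<close>

definition TDiff :: "((complex \<Rightarrow> complex) \<times> (real \<Rightarrow> complex)) set" where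
  "TDiff = {(\<phi>, v). \<phi> \<in> Diff \<and> smooth v \<and> (\<forall>\<theta>. v (\<theta> + 2 * pi) = v \<theta>) \<and>
     (\<forall>\<theta>. v \<theta> \<bullet> \<phi> (cis \<theta>) = 0)}"

text \<open>The left Maurer-Cartan form \<open>v \<mapsto> v / \<phi>'\<close>, the differential of left composition with the
  inverse of \<open>\<phi>\<close>. Both \<open>v \<theta>\<close> and \<open>\<phi>'(\<theta>)\<close> lie on the tangent
  line at \<open>\<phi> (cis \<theta>)\<close>, so the complex quotient is real.\<close>

definition maurer_cartan :: "(complex \<Rightarrow> complex) \<Rightarrow> (real \<Rightarrow> complex) \<Rightarrow> real \<Rightarrow> real" where
  "maurer_cartan \<phi> v = (\<lambda>\<theta>. Re (v \<theta> / angle_deriv \<phi> \<theta>))"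

definition distribution :: "((complex \<Rightarrow> complex) \<times> (real \<Rightarrow> complex)) set" where
  "distribution = {(\<phi>, v) \<in> TDiff. maurer_cartan \<phi> v \<in> \<dd>}"

definition smooth_diff_curve :: "(real \<Rightarrow> complex \<Rightarrow> complex) \<Rightarrow> bool" where
  "smooth_diff_curve \<gamma> \<longleftrightarrow>
     (\<forall>t\<in>{0..1}. \<gamma> t \<in> Diff) \<and> smooth_family (\<lambda>t \<theta>. \<gamma> t (cis \<theta>))"

definition velocity :: "(real \<Rightarrow> complex \<Rightarrow> complex) \<Rightarrow> real \<Rightarrow> real \<Rightarrow> complex" where
  "velocity \<gamma> = time_deriv (\<lambda>t \<theta>. \<gamma> t (cis \<theta>))"

definition horizontal :: "(real \<Rightarrow> complex \<Rightarrow> complex) \<Rightarrow> bool" where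
  "horizontal \<gamma> \<longleftrightarrow> (\<forall>t\<in>{0..1}. (\<gamma> t, velocity \<gamma> t) \<in> distribution)"

definition left_log_deriv :: "(real \<Rightarrow> complex \<Rightarrow> complex) \<Rightarrow> real \<Rightarrow> real \<Rightarrow> real" where
  "left_log_deriv \<gamma> t = maurer_cartan (\<gamma> t) (velocity \<gamma> t)"

section \<open>Normal sub-Riemannian geodesics\<close>

definition tau :: "(real \<Rightarrow> real \<Rightarrow> real) \<Rightarrow> (real \<Rightarrow> real \<Rightarrow> real) \<Rightarrow> real \<Rightarrow> real \<Rightarrow> real" where
  "tau u x = (\<lambda>t \<theta>. time_deriv x t \<theta> + bracket (u t) (x t) \<theta>)"

definition variations :: "(real \<Rightarrow> real \<Rightarrow> real) set" where
  "variations = {x \<in> curves Vect. \<forall>\<theta>. x 0 \<theta> = 0 \<and> x 1 \<theta> = 0}"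

definition horizontal_variations ::
    "(real \<Rightarrow> real \<Rightarrow> real) \<Rightarrow> (real \<Rightarrow> real \<Rightarrow> real) set" where
  "horizontal_variations u = {x \<in> variations. tau u x \<in> curves \<dd>}"

definition normal_geodesic :: "(real \<Rightarrow> complex \<Rightarrow> complex) \<Rightarrow> bool" where
  "normal_geodesic \<gamma> \<longleftrightarrow> smooth_diff_curve \<gamma> \<and> horizontal \<gamma> \<and>
     (let u = left_log_deriv \<gamma> in
      \<forall>x \<in> horizontal_variations u. integral {0..1} (\<lambda>t. vect_inner (u t) (tau u x t)) = 0)"

definition geodesic_equation ::
    "(real \<Rightarrow> real \<Rightarrow> real) \<Rightarrow> (real \<Rightarrow> real \<Rightarrow> real) \<Rightarrow> bool" where
  "geodesic_equation u lam \<longleftrightarrow> (\<forall>t\<in>{0..1}. \<forall>\<theta>.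
     L (-1) 1 (hilbert (deriv (time_deriv u t))) \<theta> + time_deriv lam t \<theta> =
     ad_transpose (u t) (\<lambda>\<theta>. L (-1) 1 (hilbert (deriv (u t))) \<theta> + lam t \<theta>) \<theta>)"

end

theory Submission
  imports Defs
begin

text \<open>
  Everything rests on integration by parts. The momentum \<open>m = L\<^bsub>-1,1\<^esub> J u' = (\<partial>\<^sup>3 + \<partial>) J u\<close> represents the
  energy, and for a variation \<open>x\<close> that vanishes at the end points
  \<open>\<integral> (u, \<tau>\<^sub>u x) dt = \<integral> \<langle>m, x' + [u, x]\<rangle> dt = \<integral> \<langle>ad\<^sup>T\<^sub>u m - m', x\<rangle> dt\<close>, the prime in \<open>x'\<close> and \<open>m'\<close> being the
  time derivative (\<open>first_variation\<close>). The same computation with a curve \<open>\<lambda>\<close> in the Moebius algebra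
  in place of \<open>m\<close> gives zero as soon as \<open>\<tau>\<^sub>u x\<close> lies in \<open>\<dd>\<close>, because \<open>\<dd>\<close> and \<open>\<mm>\<close> are
  orthogonal. The geodesic equation says that the residuals \<open>ad\<^sup>T\<^sub>u m - m'\<close> and \<open>ad\<^sup>T\<^sub>u \<lambda> - \<lambda>'\<close> add up
  to zero, so it implies that \<open>u\<close> is critical.

  Conversely, the admissible variations form a constrained space, and \<open>\<lambda>\<close> is the Lagrange
  multiplier of the end point condition. Given any curve \<open>y\<close> in \<open>\<dd>\<close>, the condition that
  \<open>\<tau>\<^sub>u (y + \<xi>)\<close> lies in \<open>\<dd>\<close> is a linear differential equation for \<open>\<xi>\<close> in the three-dimensional
  algebra \<open>\<mm>\<close> (\<open>horizontal_completion\<close>). Its solution with \<open>\<xi> = 0\<close> at time zero need not return to zero,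
  and whether it does is decided by three linear conditions on \<open>y\<close>, namely orthogonality to the residuals of
  three independent solutions \<open>\<lambda>\<close> of the dual equation, those with residual in \<open>\<dd>\<close>
  (\<open>multipliers_separate\<close>, \<open>multiplier_pairing\<close>). The residual of the momentum also lies in \<open>\<dd>\<close>,
  by invariance of the Weil-Petersson form under the Moebius algebra
  (\<open>ad_transpose_momentum_ker\<close>). Subtracting its projection onto the span of the three
  residuals leaves a \<open>g\<close> for which \<open>y = t (1 - t) g\<close> is an allowed choice, and
  criticality forces \<open>g = 0\<close> (\<open>critical_imp_geodesic_equation\<close>).

  The equations for \<open>\<lambda>\<^sub>0\<close> and \<open>w\<close> are the components of the geodesic equation under \<open>\<eta>\<^sub>0\<close> and \<open>\<eta>\<^sub>1\<close>. Only the
  component of \<open>ad\<^sup>T\<^sub>u \<lambda>\<close> contributes, and in it only the mode of order two of \<open>u\<close>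
  (\<open>L2_ad_transpose_mob\<close>). Substituting them back gives the equation for \<open>v\<close>.

  Two analytic tools support this. Smoothness of a family is proved by coinduction
  (\<open>smooth_family_coinduct\<close>): a class of continuous families closed under both partial derivatives consists
  of smooth families. The principal value integral is rewritten as an integral of rotates of \<open>x'\<close>
  against a continuous kernel (\<open>hilbert_integral\<close>), from which smoothness of \<open>J u\<close>, the skew symmetry of \<open>J\<close> and
  its commutation with derivatives follow. The Fourier expansion of \<open>u\<close> is obtained by Chernoff's
  telescoping argument (\<open>fourier_series_ker\<close>).
\<close>

section \<open>Calculus of smooth families\<close>

definition t_partial :: "(real \<Rightarrow> real \<Rightarrow> 'a::real_normed_vector) \<Rightarrow> (real \<Rightarrow> real \<Rightarrow> 'a) \<Rightarrow> bool" where
  "t_partial f g \<longleftrightarrow> (\<forall>t\<in>{0..1}. \<forall>\<theta>.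
     ((\<lambda>s. f s \<theta>) has_vector_derivative g t \<theta>) (at t within {0..1}))"

definition angle_partial :: "(real \<Rightarrow> real \<Rightarrow> 'a::real_normed_vector) \<Rightarrow> (real \<Rightarrow> real \<Rightarrow> 'a) \<Rightarrow> bool" where
  "angle_partial f g \<longleftrightarrow> (\<forall>t\<in>{0..1}. \<forall>\<theta>. (f t has_vector_derivative g t \<theta>) (at \<theta>))"

definition jointly_cont :: "(real \<Rightarrow> real \<Rightarrow> 'a::real_normed_vector) \<Rightarrow> bool" where
  "jointly_cont f \<longleftrightarrow> continuous_on ({0..1} \<times> UNIV) (\<lambda>(t, \<theta>). f t \<theta>)"

lemma t_partialD:
  "t_partial f g \<Longrightarrow> t \<in> {0..1} \<Longrightarrow> ((\<lambda>s. f s \<theta>) has_vector_derivative g t \<theta>) (at t within {0..1})"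
  by (simp add: t_partial_def)

lemma angle_partialD:
  "angle_partial f g \<Longrightarrow> t \<in> {0..1} \<Longrightarrow> (f t has_vector_derivative g t \<theta>) (at \<theta>)"
  by (simp add: angle_partial_def)

lemma within_unit_neq_bot: "t \<in> {0..1::real} \<Longrightarrow> at t within {0..1} \<noteq> bot"
  by (simp add: trivial_limit_within islimpt_Icc)

lemma unit_deriv_unique:
  assumes "(f has_vector_derivative a) (at t within {0..1::real})"
    and "(f has_vector_derivative b) (at t within {0..1})" and "t \<in> {0..1}"
  shows "a = b"
  using vector_derivative_unique_within[OF within_unit_neq_bot[OF assms(3)] assms(1,2)] .

lemma jointly_cont_compose:
  assumes "jointly_cont f" "continuous_on S a" "continuous_on S b" "\<And>p. p \<in> S \<Longrightarrow> a p \<in> {0..1}"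
  shows "continuous_on S (\<lambda>p. f (a p) (b p))"
proof -
  have "continuous_on S (\<lambda>p. (a p, b p))"
    using assms by (intro continuous_intros)
  from continuous_on_compose2[OF assms(1)[unfolded jointly_cont_def] this] assms(4)
  show ?thesis by (simp add: image_subset_iff)
qed

text \<open>A form of the theorem of Clairaut and Schwarz: writing \<open>g\<close> as the integral of its angular
  derivative \<open>h\<close> and differentiating in \<open>t\<close> under the integral exhibits \<open>g'\<close> as an integral of
  \<open>h'\<close>.\<close>

lemma clairaut:
  fixes g :: "real \<Rightarrow> real \<Rightarrow> 'a::banach"
  assumes gh: "angle_partial g h" and g': "t_partial g g'" and h': "t_partial h h'"
    and cont: "jointly_cont h" "jointly_cont h'"
  shows "angle_partial g' h'"
  unfolding angle_partial_def
proof (intro ballI allI)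
  fix t \<theta> :: real assume t: "t \<in> {0..1}"
  define a b where "a = \<theta> - 1" and "b = \<theta> + 1"
  have eq: "g s \<phi> = g s a + integral (cbox a \<phi>) (h s)" if "s \<in> {0..1}" "\<phi> \<in> {a..b}" for s \<phi>
  proof -
    have "(h s has_integral g s \<phi> - g s a) {a..\<phi>}"
      using that by (intro fundamental_theorem_of_calculus
          has_vector_derivative_at_within[OF angle_partialD[OF gh]]) auto
    then show ?thesis by (simp add: integral_unique)
  qed
  have eq': "g' t \<phi> = g' t a + integral (cbox a \<phi>) (h' t)" if "\<phi> \<in> {a..b}" for \<phi>
  proof -
    have 1: "((\<lambda>s. integral (cbox a \<phi>) (h s)) has_vector_derivative integral (cbox a \<phi>) (h' t))
      (at t within {0..1})"
    proof (rule leibniz_rule_vector_derivative)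
      show "\<And>x \<theta>. x \<in> {0..1} \<Longrightarrow> \<theta> \<in> cbox a \<phi> \<Longrightarrow>
          ((\<lambda>s. h s \<theta>) has_vector_derivative h' x \<theta>) (at x within {0..1})"
        using h' by (auto intro: t_partialD)
      show "\<And>x. x \<in> {0..1} \<Longrightarrow> h x integrable_on cbox a \<phi>"
        by (intro integrable_continuous jointly_cont_compose[OF cont(1)] continuous_intros) auto
      show "continuous_on ({0..1} \<times> cbox a \<phi>) (\<lambda>(x, t). h' x t)"
        using cont(2) unfolding jointly_cont_def by (rule continuous_on_subset) auto
    qed (use t in auto)
    have 2: "((\<lambda>s. g s \<phi> - g s a) has_vector_derivative g' t \<phi> - g' t a) (at t within {0..1})"
      using t by (intro derivative_intros t_partialD[OF g'])
    have 3: "((\<lambda>s. integral (cbox a \<phi>) (h s)) has_vector_derivative g' t \<phi> - g' t a)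
        (at t within {0..1})"
      using t by (rule has_vector_derivative_transform[OF _ _ 2]) (use eq[OF _ that] in \<open>metis add_diff_cancel_left'\<close>)
    show ?thesis using unit_deriv_unique[OF 1 3 t] by simp
  qed
  have "((\<lambda>\<phi>. integral {a..\<phi>} (h' t)) has_vector_derivative h' t \<theta>) (at \<theta> within {a..b})"
    using t by (intro integral_has_vector_derivative jointly_cont_compose[OF cont(2)] continuous_intros)
      (auto simp: a_def b_def)
  then have "((\<lambda>\<phi>. g' t a + integral {a..\<phi>} (h' t)) has_vector_derivative h' t \<theta>) (at \<theta> within {a..b})"
    by (auto intro!: derivative_eq_intros)
  then have "(g' t has_vector_derivative h' t \<theta>) (at \<theta> within {a..b})"
    by (rule has_vector_derivative_transform[rotated 2])
      (simp add: a_def b_def, use eq' in \<open>unfold cbox_interval\<close>)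
  then show "(g' t has_vector_derivative h' t \<theta>) (at \<theta>)"
    using at_within_Icc_at[of a \<theta> b] by (simp add: a_def b_def)
qed

text \<open>Smoothness is established by coinduction: it suffices to place the family in a class that
  is closed under taking both partial derivatives. Clairaut's theorem makes the iterated
  derivatives independent of the order, so that they fit into a doubly indexed array.\<close>

lemma smooth_family_coinduct:
  fixes f :: "real \<Rightarrow> real \<Rightarrow> 'a::banach"
  assumes f: "f \<in> X" and cont: "\<And>g. g \<in> X \<Longrightarrow> jointly_cont g"
    and t: "\<And>g. g \<in> X \<Longrightarrow> \<exists>h\<in>X. t_partial g h" and a: "\<And>g. g \<in> X \<Longrightarrow> \<exists>h\<in>X. angle_partial g h"
  shows "smooth_family f"
proof -
  obtain T where T: "\<And>g. g \<in> X \<Longrightarrow> T g \<in> X \<and> t_partial g (T g)" using t by metis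
  obtain A where A: "\<And>g. g \<in> X \<Longrightarrow> A g \<in> X \<and> angle_partial g (A g)" using a by metis
  define D where "D i j = (T ^^ i) ((A ^^ j) f)" for i j
  have XA: "(A ^^ j) f \<in> X" for j by (induction j) (use f A in auto)
  have X: "D i j \<in> X" for i j unfolding D_def by (induction i) (use XA T in auto)
  have Dt: "t_partial (D i j) (D (Suc i) j)" for i j
    using T[OF X[of i j]] by (simp add: D_def)
  have Da: "angle_partial (D i j) (D i (Suc j))" for i j
  proof (induction i)
    case 0 show ?case using A[OF XA[of j]] by (simp add: D_def)
  next
    case (Suc i)
    show ?case by (rule clairaut[OF Suc Dt Dt]) (intro cont X)+
  qed
  show ?thesis unfolding smooth_family_def
  proof (intro exI[of _ D] conjI ballI allI)
    show "D 0 0 t = f t" for t by (simp add: D_def)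
    show "continuous_on ({0..1} \<times> UNIV) (\<lambda>(t, \<theta>). D i j t \<theta>)" for i j
      using cont[OF X] by (simp add: jointly_cont_def)
  qed (auto intro: t_partialD[OF Dt] angle_partialD[OF Da])
qed

lemma smooth_family_jointly_cont:
  assumes "smooth_family f" shows "jointly_cont f"
proof -
  obtain D where D: "\<forall>t\<in>{0..1}. D 0 0 t = f t"
    "continuous_on ({0..1} \<times> UNIV) (\<lambda>(t, \<theta>). D 0 0 t \<theta>)"
    using assms unfolding smooth_family_def by meson
  from D(2) show ?thesis unfolding jointly_cont_def
    by (rule continuous_on_eq) (use D(1) in auto)
qed

lemma smooth_family_cong:
  assumes "smooth_family f" "\<And>t. t \<in> {0..1} \<Longrightarrow> f t = g t" shows "smooth_family g"
  using assms unfolding smooth_family_def by metis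

lemma smooth_family_partials:
  assumes "smooth_family f"
  obtains h k where "smooth_family h" "t_partial f h" "smooth_family k" "angle_partial f k"
proof -
  obtain D where D: "\<forall>t\<in>{0..1}. D 0 0 t = f t"
    "\<And>i j. continuous_on ({0..1} \<times> UNIV) (\<lambda>(t, \<theta>). D i j t \<theta>)"
    "\<And>i j t \<theta>. t \<in> {0..1} \<Longrightarrow> ((\<lambda>s. D i j s \<theta>) has_vector_derivative D (Suc i) j t \<theta>) (at t within {0..1})"
    "\<And>i j t \<theta>. t \<in> {0..1} \<Longrightarrow> (D i j t has_vector_derivative D i (Suc j) t \<theta>) (at \<theta>)"
    using assms unfolding smooth_family_def by blast
  show ?thesis
  proof (rule that)
    show "smooth_family (D 1 0)" unfolding smooth_family_def
      by (rule exI[of _ "\<lambda>i. D (Suc i)"]) (auto intro: D)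
    show "smooth_family (D 0 1)" unfolding smooth_family_def
      by (rule exI[of _ "\<lambda>i j. D i (Suc j)"]) (auto intro: D)
    show "t_partial f (D 1 0)" unfolding t_partial_def
    proof (intro ballI allI)
      fix t \<theta> :: real assume t: "t \<in> {0..1}"
      show "((\<lambda>s. f s \<theta>) has_vector_derivative D 1 0 t \<theta>) (at t within {0..1})"
        using has_vector_derivative_transform[OF t _ D(3)[OF t, of 0 0 \<theta>], of "\<lambda>s. f s \<theta>"] D(1)
        by simp
    qed
    show "angle_partial f (D 0 1)" unfolding angle_partial_def
      using D(4)[of _ 0 0] D(1) by (metis One_nat_def)
  qed
qed

lemma smooth_family_t_partial:
  assumes f: "smooth_family f" and t: "t_partial f h" shows "smooth_family h"
proof -
  from smooth_family_partials[OF f] obtain k where k: "smooth_family k" "t_partial f k" by blast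
  show ?thesis
  proof (rule smooth_family_cong[OF k(1)])
    fix s :: real assume "s \<in> {0..1}"
    then show "k s = h s" using unit_deriv_unique t_partialD[OF t] t_partialD[OF k(2)] by blast
  qed
qed

lemma t_partial_time_deriv:
  assumes "smooth_family f" shows "t_partial f (time_deriv f)"
proof -
  from smooth_family_partials[OF assms] obtain k where k: "t_partial f k" by blast
  then show ?thesis unfolding t_partial_def time_deriv_def
    by (metis vector_derivative_works differentiableI_vector)
qed

lemma smooth_family_time_deriv: "smooth_family f \<Longrightarrow> smooth_family (time_deriv f)"
  using smooth_family_t_partial t_partial_time_deriv by blast

lemma smooth_family_angle_partial:
  assumes f: "smooth_family f" and t: "angle_partial f h" shows "smooth_family h"
proof -
  from smooth_family_partials[OF f] obtain k where k: "smooth_family k" "angle_partial f k" by blast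
  show ?thesis
  proof (rule smooth_family_cong[OF k(1)])
    fix s :: real assume "s \<in> {0..1}"
    then show "k s = h s" using vector_derivative_unique_at angle_partialD[OF t] angle_partialD[OF k(2)] by blast
  qed
qed

lemma angle_partial_vector_derivative:
  assumes "smooth_family f" shows "angle_partial f (\<lambda>t \<theta>. vector_derivative (f t) (at \<theta>))"
proof -
  from smooth_family_partials[OF assms] obtain k where k: "angle_partial f k" by blast
  then show ?thesis unfolding angle_partial_def
    by (metis vector_derivative_works differentiableI_vector)
qed

lemma smooth_family_bounded_linear:
  assumes f: "smooth_family f" and h: "bounded_linear h"
  shows "smooth_family (\<lambda>t \<theta>. h (f t \<theta>))"
proof -
  obtain D where D: "\<forall>t\<in>{0..1}. D 0 0 t = f t"
    "\<And>i j. continuous_on ({0..1} \<times> UNIV) (\<lambda>(t, \<theta>). D i j t \<theta>)"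
    "\<And>i j t \<theta>. t \<in> {0..1} \<Longrightarrow> ((\<lambda>s. D i j s \<theta>) has_vector_derivative D (Suc i) j t \<theta>) (at t within {0..1})"
    "\<And>i j t \<theta>. t \<in> {0..1} \<Longrightarrow> (D i j t has_vector_derivative D i (Suc j) t \<theta>) (at \<theta>)"
    using f unfolding smooth_family_def by blast
  show ?thesis unfolding smooth_family_def
  proof (intro exI[of _ "\<lambda>i j t \<theta>. h (D i j t \<theta>)"] conjI ballI allI)
    show "continuous_on ({0..1} \<times> UNIV) (\<lambda>(t, \<theta>). h (D i j t \<theta>))" for i j
      using bounded_linear.continuous_on[OF h D(2)] by (simp add: case_prod_unfold)
  qed (use D in \<open>auto intro!: bounded_linear.has_vector_derivative[OF h]\<close>)
qed

lemma smooth_slice: "smooth_family f \<Longrightarrow> t \<in> {0..1} \<Longrightarrow> smooth (f t)"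
proof -
  assume "smooth_family f" and t: "t \<in> {0..1}"
  then obtain D where D: "D 0 0 t = f t"
    "\<And>i j \<theta>. (D i j t has_vector_derivative D i (Suc j) t \<theta>) (at \<theta>)"
    unfolding smooth_family_def by meson
  then show "smooth (f t)" unfolding smooth_def by (intro exI[of _ "\<lambda>k. D 0 k t"]) auto
qed

text \<open>Through constant families, closure properties of single functions become special cases of those
  of families.\<close>

lemma smooth_iff_constant_family:
  fixes x :: "real \<Rightarrow> 'a::real_normed_vector"
  shows "smooth x \<longleftrightarrow> smooth_family (\<lambda>t. x)"
proof
  assume "smooth x"
  then obtain D where D: "D 0 = x" "\<And>k \<theta>. (D k has_vector_derivative D (Suc k) \<theta>) (at \<theta>)"
    unfolding smooth_def by blast
  have "continuous_on UNIV (D j)" for j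
    using D(2) by (meson continuous_at_imp_continuous_on has_vector_derivative_continuous)
  then have c: "continuous_on A (\<lambda>p. D j (snd p))" for A :: "(real \<times> real) set" and j
    by (rule continuous_on_compose2) (auto intro: continuous_intros)
  show "smooth_family (\<lambda>t. x)" unfolding smooth_family_def
  proof (intro exI[of _ "\<lambda>i j t. if i = 0 then D j else (\<lambda>_. 0)"] conjI ballI allI)
    show "continuous_on ({0..1} \<times> UNIV) (\<lambda>(t :: real, \<theta>). (if i = 0 then D j else (\<lambda>_. 0)) \<theta>)" for i j
      by (cases "i = 0") (simp_all add: case_prod_unfold c)
  qed (use D in auto)
next
  assume "smooth_family (\<lambda>t. x)"
  from smooth_slice[OF this, of 0] show "smooth x" by simp
qed

text \<open>The families obtained from a given class by sums and products. If the class itself is closed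
  under partial derivatives up to sums and products, all its members are smooth; this one
  principle yields products, reciprocals and solutions of linear differential equations.\<close>

inductive_set family_algebra ::
    "(real \<Rightarrow> real \<Rightarrow> 'a::real_normed_algebra) set \<Rightarrow> (real \<Rightarrow> real \<Rightarrow> 'a) set"
  for B where
  base: "f \<in> B \<Longrightarrow> f \<in> family_algebra B"
| add: "f \<in> family_algebra B \<Longrightarrow> g \<in> family_algebra B \<Longrightarrow> (\<lambda>t \<theta>. f t \<theta> + g t \<theta>) \<in> family_algebra B"
| mult: "f \<in> family_algebra B \<Longrightarrow> g \<in> family_algebra B \<Longrightarrow> (\<lambda>t \<theta>. f t \<theta> * g t \<theta>) \<in> family_algebra B"

lemma smooth_family_algebra:
  fixes B :: "(real \<Rightarrow> real \<Rightarrow> 'a::{real_normed_algebra,banach}) set"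
  assumes f: "f \<in> family_algebra B"
    and cont: "\<And>g. g \<in> B \<Longrightarrow> jointly_cont g"
    and t: "\<And>g. g \<in> B \<Longrightarrow> \<exists>h\<in>family_algebra B. t_partial g h"
    and a: "\<And>g. g \<in> B \<Longrightarrow> \<exists>h\<in>family_algebra B. angle_partial g h"
  shows "smooth_family f"
proof (rule smooth_family_coinduct[OF f])
  fix g assume "g \<in> family_algebra B"
  then show "jointly_cont g"
    by induction (use cont in \<open>auto simp: jointly_cont_def case_prod_unfold intro: continuous_intros\<close>)
next
  fix g assume "g \<in> family_algebra B"
  then show "\<exists>h\<in>family_algebra B. t_partial g h"
  proof induction
    case (add f g)
    then obtain f' g' where *: "f' \<in> family_algebra B" "g' \<in> family_algebra B" "t_partial f f'" "t_partial g g'"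
      by blast
    from *(3,4) have "t_partial (\<lambda>t \<theta>. f t \<theta> + g t \<theta>) (\<lambda>t \<theta>. f' t \<theta> + g' t \<theta>)"
      unfolding t_partial_def by (auto intro: derivative_intros)
    then show ?case using family_algebra.add[OF *(1,2)] by blast
  next
    case (mult f g)
    then obtain f' g' where *: "f' \<in> family_algebra B" "g' \<in> family_algebra B" "t_partial f f'" "t_partial g g'"
      by blast
    from *(3,4) have "t_partial (\<lambda>t \<theta>. f t \<theta> * g t \<theta>) (\<lambda>t \<theta>. f t \<theta> * g' t \<theta> + f' t \<theta> * g t \<theta>)"
      unfolding t_partial_def by (auto intro: has_vector_derivative_mult)
    then show ?case
      by (rule bexI[OF _ family_algebra.add[OF family_algebra.mult[OF mult.hyps(1) *(2)]
              family_algebra.mult[OF *(1) mult.hyps(2)]]])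
  qed (rule t)
next
  fix g assume "g \<in> family_algebra B"
  then show "\<exists>h\<in>family_algebra B. angle_partial g h"
  proof induction
    case (add f g)
    then obtain f' g' where *: "f' \<in> family_algebra B" "g' \<in> family_algebra B" "angle_partial f f'" "angle_partial g g'"
      by blast
    from *(3,4) have "angle_partial (\<lambda>t \<theta>. f t \<theta> + g t \<theta>) (\<lambda>t \<theta>. f' t \<theta> + g' t \<theta>)"
      unfolding angle_partial_def by (auto intro: derivative_intros)
    then show ?case using family_algebra.add[OF *(1,2)] by blast
  next
    case (mult f g)
    then obtain f' g' where *: "f' \<in> family_algebra B" "g' \<in> family_algebra B" "angle_partial f f'" "angle_partial g g'"
      by blast
    from *(3,4) have "angle_partial (\<lambda>t \<theta>. f t \<theta> * g t \<theta>) (\<lambda>t \<theta>. f t \<theta> * g' t \<theta> + f' t \<theta> * g t \<theta>)"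
      unfolding angle_partial_def by (auto intro: has_vector_derivative_mult)
    then show ?case
      by (rule bexI[OF _ family_algebra.add[OF family_algebra.mult[OF mult.hyps(1) *(2)]
              family_algebra.mult[OF *(1) mult.hyps(2)]]])
  qed (rule a)
qed

lemma smooth_family_algebra_smooth:
  fixes f :: "real \<Rightarrow> real \<Rightarrow> 'a::{real_normed_algebra,banach}"
  assumes "f \<in> family_algebra (Collect smooth_family)"
  shows "smooth_family f"
  using assms
proof (rule smooth_family_algebra)
  fix g :: "real \<Rightarrow> real \<Rightarrow> 'a" assume "g \<in> Collect smooth_family"
  then have g: "smooth_family g" by simp
  show "jointly_cont g" using g by (rule smooth_family_jointly_cont)
  from smooth_family_partials[OF g] obtain h k
    where "smooth_family h" "t_partial g h" "smooth_family k" "angle_partial g k" .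
  then show "\<exists>h\<in>family_algebra (Collect smooth_family). t_partial g h"
    "\<exists>h\<in>family_algebra (Collect smooth_family). angle_partial g h"
    by (auto intro: family_algebra.base)
qed

lemma smooth_family_add:
  fixes f :: "real \<Rightarrow> real \<Rightarrow> 'a::{real_normed_algebra,banach}"
  shows "smooth_family f \<Longrightarrow> smooth_family g \<Longrightarrow> smooth_family (\<lambda>t \<theta>. f t \<theta> + g t \<theta>)"
  by (rule smooth_family_algebra_smooth, rule family_algebra.add) (simp_all add: family_algebra.base)

lemma smooth_family_mult:
  fixes f :: "real \<Rightarrow> real \<Rightarrow> 'a::{real_normed_algebra,banach}"
  shows "smooth_family f \<Longrightarrow> smooth_family g \<Longrightarrow> smooth_family (\<lambda>t \<theta>. f t \<theta> * g t \<theta>)"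
  by (rule smooth_family_algebra_smooth, rule family_algebra.mult) (simp_all add: family_algebra.base)

lemma smooth_family_const [simp]: "smooth_family (\<lambda>t \<theta>. c)"
  unfolding smooth_family_def
  by (rule exI[of _ "\<lambda>i j t \<theta>. if i = 0 \<and> j = 0 then c else 0"]) (auto simp: case_prod_unfold)

lemma smooth_family_minus: "smooth_family f \<Longrightarrow> smooth_family (\<lambda>t \<theta>. - f t \<theta>)"
  using smooth_family_bounded_linear[OF _ bounded_linear_minus[OF bounded_linear_ident]] by blast

lemma smooth_family_diff:
  fixes f :: "real \<Rightarrow> real \<Rightarrow> 'a::{real_normed_algebra,banach}"
  shows "smooth_family f \<Longrightarrow> smooth_family g \<Longrightarrow> smooth_family (\<lambda>t \<theta>. f t \<theta> - g t \<theta>)"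
  using smooth_family_add[of f "\<lambda>t \<theta>. - g t \<theta>"] smooth_family_minus[of g] by simp

lemma smooth_family_inverse:
  fixes f :: "real \<Rightarrow> real \<Rightarrow> 'a::{real_normed_field,banach}"
  assumes f: "smooth_family f" and nz: "\<And>t \<theta>. t \<in> {0..1} \<Longrightarrow> f t \<theta> \<noteq> 0"
  shows "smooth_family (\<lambda>t \<theta>. inverse (f t \<theta>))"
proof -
  let ?i = "\<lambda>t \<theta>. inverse (f t \<theta>)"
  let ?B = "insert ?i (Collect smooth_family)"
  from smooth_family_partials[OF f] obtain h k
    where hk: "smooth_family h" "t_partial f h" "smooth_family k" "angle_partial f k" .
  have d: "((\<lambda>s. inverse (g s)) has_vector_derivative - (inverse (g x) * inverse (g x) * y)) (at x within S)"
    if "(g has_vector_derivative y) (at x within S)" "g x \<noteq> 0" for g :: "real \<Rightarrow> 'a" and x y S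
    using Deriv.has_derivative_inverse[OF that(2) that(1)[unfolded has_vector_derivative_def]]
    unfolding has_vector_derivative_def
    by (rule has_derivative_eq_rhs) (auto simp: fun_eq_iff algebra_simps)
  have mem: "(\<lambda>t \<theta>. (inverse (f t \<theta>) * inverse (f t \<theta>)) * (- g t \<theta>)) \<in> family_algebra ?B"
    if "smooth_family g" for g
    by (intro family_algebra.mult family_algebra.base)
      (use that in \<open>auto intro: smooth_family_minus\<close>)
  show ?thesis
  proof (rule smooth_family_algebra[of _ ?B])
    show "?i \<in> family_algebra ?B" by (rule family_algebra.base) simp
    fix g assume g: "g \<in> ?B"
    show "jointly_cont g"
    proof (cases "g = ?i")
      case True
      then show ?thesis
        using smooth_family_jointly_cont[OF f] nz
        by (auto simp: jointly_cont_def case_prod_unfold intro!: continuous_intros)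
    qed (use g smooth_family_jointly_cont in auto)
    show "\<exists>h\<in>family_algebra ?B. t_partial g h"
    proof (cases "g = ?i")
      case True
      then have "t_partial g (\<lambda>t \<theta>. (inverse (f t \<theta>) * inverse (f t \<theta>)) * (- h t \<theta>))"
        using nz hk(2) unfolding t_partial_def by (auto intro!: d)
      then show ?thesis using mem[OF hk(1)] by blast
    next
      case False
      with g have "smooth_family g" by auto
      from smooth_family_partials[OF this] show ?thesis by (metis CollectI family_algebra.base insertI2)
    qed
    show "\<exists>h\<in>family_algebra ?B. angle_partial g h"
    proof (cases "g = ?i")
      case True
      then have "angle_partial g (\<lambda>t \<theta>. (inverse (f t \<theta>) * inverse (f t \<theta>)) * (- k t \<theta>))"
        using nz hk(4) unfolding angle_partial_def by (auto intro!: d)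
      then show ?thesis using mem[OF hk(3)] by blast
    next
      case False
      with g have "smooth_family g" by auto
      from smooth_family_partials[OF this] show ?thesis by (metis CollectI family_algebra.base insertI2)
    qed
  qed
qed

text \<open>Circle averages and the Hilbert transform are superpositions of rotates, of the following form.\<close>

lemma
  fixes f :: "real \<Rightarrow> real \<Rightarrow> 'a::banach" and k :: "'b::euclidean_space \<Rightarrow> real"
  assumes f: "smooth_family f" and k: "continuous_on (cbox a b) k" and s: "continuous_on (cbox a b) s"
  shows smooth_family_superposition:
      "smooth_family (\<lambda>t \<theta>. integral (cbox a b) (\<lambda>p. k p *\<^sub>R f t (\<theta> + s p)))" (is ?S)
    and t_partial_superposition: "t_partial f h \<Longrightarrow>
      t_partial (\<lambda>t \<theta>. integral (cbox a b) (\<lambda>p. k p *\<^sub>R f t (\<theta> + s p)))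
        (\<lambda>t \<theta>. integral (cbox a b) (\<lambda>p. k p *\<^sub>R h t (\<theta> + s p)))"
    and angle_partial_superposition: "angle_partial f h \<Longrightarrow>
      angle_partial (\<lambda>t \<theta>. integral (cbox a b) (\<lambda>p. k p *\<^sub>R f t (\<theta> + s p)))
        (\<lambda>t \<theta>. integral (cbox a b) (\<lambda>p. k p *\<^sub>R h t (\<theta> + s p)))"
proof -
  define I where "I f t \<theta> = integral (cbox a b) (\<lambda>p. k p *\<^sub>R f t (\<theta> + s p))"
    for f :: "real \<Rightarrow> real \<Rightarrow> 'a" and t \<theta> :: real
  have sub: "continuous_on S (\<lambda>p. k (r p) *\<^sub>R f (q p) (u p + s (r p)))"
    if "smooth_family f" "continuous_on S q" "continuous_on S r" "continuous_on S u"
      "\<And>p. p \<in> S \<Longrightarrow> q p \<in> {0..1} \<and> r p \<in> cbox a b"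
    for f :: "real \<Rightarrow> real \<Rightarrow> 'a" and S :: "'d::topological_space set" and q u r
  proof -
    have "continuous_on S (\<lambda>p. k (r p))" "continuous_on S (\<lambda>p. s (r p))"
      using that k s by (auto intro: continuous_on_compose2)
    then show ?thesis
      using that by (intro continuous_on_scaleR jointly_cont_compose[OF smooth_family_jointly_cont[OF that(1)]] continuous_intros) auto
  qed
  have tp: "t_partial (I f) (I h)" if "t_partial f h" "smooth_family f" for f h
    unfolding t_partial_def I_def
  proof (intro ballI allI leibniz_rule_vector_derivative)
    fix t \<theta> :: real assume t: "t \<in> {0..1}"
    show "\<And>x p. x \<in> {0..1} \<Longrightarrow> p \<in> cbox a b \<Longrightarrow>
       ((\<lambda>x. k p *\<^sub>R f x (\<theta> + s p)) has_vector_derivative k p *\<^sub>R h x (\<theta> + s p)) (at x within {0..1})"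
      by (intro bounded_linear.has_vector_derivative[OF bounded_linear_scaleR_right] t_partialD[OF that(1)]) auto
    show "\<And>x. x \<in> {0..1} \<Longrightarrow> (\<lambda>p. k p *\<^sub>R f x (\<theta> + s p)) integrable_on cbox a b"
      by (intro integrable_continuous sub that continuous_intros) auto
    show "continuous_on ({0..1} \<times> cbox a b) (\<lambda>(t, p). k p *\<^sub>R h t (\<theta> + s p))"
      unfolding case_prod_unfold
      by (intro sub smooth_family_t_partial[OF that(2,1)] continuous_intros) auto
  qed auto
  have ap: "angle_partial (I f) (I h)" if "angle_partial f h" "smooth_family f" for f h
    unfolding angle_partial_def
  proof (intro ballI allI)
    fix t \<theta> :: real assume t: "t \<in> {0..1}"
    show "(I f t has_vector_derivative I h t \<theta>) (at \<theta>)"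
      unfolding I_def
    proof (rule leibniz_rule_vector_derivative)
      show "((\<lambda>x. k p *\<^sub>R f t (x + s p)) has_vector_derivative k p *\<^sub>R h t (x + s p)) (at x within UNIV)" for x p
      proof (intro bounded_linear.has_vector_derivative[OF bounded_linear_scaleR_right])
        have "((\<lambda>x. x + s p) has_vector_derivative 1) (at x)"
          by (auto intro!: derivative_eq_intros)
        from vector_diff_chain_at[OF this angle_partialD[OF that(1) t]]
        show "((\<lambda>x. f t (x + s p)) has_vector_derivative h t (x + s p)) (at x)" by (simp add: o_def)
      qed
      show "\<And>x. (\<lambda>p. k p *\<^sub>R f t (x + s p)) integrable_on cbox a b"
        using t by (intro integrable_continuous sub that continuous_intros) auto
      show "continuous_on (UNIV \<times> cbox a b) (\<lambda>(\<theta>, p). k p *\<^sub>R h t (\<theta> + s p))"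
        unfolding case_prod_unfold
        using t by (intro sub smooth_family_angle_partial[OF that(2,1)] continuous_intros) auto
    qed auto
  qed
  have "smooth_family (I f)"
  proof (rule smooth_family_coinduct[of _ "I ` Collect smooth_family"])
    fix g assume "g \<in> I ` Collect smooth_family"
    then obtain f where f: "smooth_family f" "g = I f" by auto
    from smooth_family_partials[OF f(1)] obtain h m
      where hm: "smooth_family h" "t_partial f h" "smooth_family m" "angle_partial f m" .
    show "\<exists>h\<in>I ` Collect smooth_family. t_partial g h" using hm f tp by blast
    show "\<exists>h\<in>I ` Collect smooth_family. angle_partial g h" using hm f ap by blast
    have "continuous_on ({0..1} \<times> UNIV) (\<lambda>q. integral (cbox a b) (\<lambda>p. k p *\<^sub>R f (fst q) (snd q + s p)))"
    proof (rule integral_continuous_on_param)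
      show "continuous_on (({0..1} \<times> UNIV) \<times> cbox a b) (\<lambda>(q, p). k p *\<^sub>R f (fst q) (snd q + s p))"
        unfolding case_prod_unfold by (intro sub f continuous_intros) auto
    qed
    then show "jointly_cont g"
      by (simp add: jointly_cont_def f(2) I_def case_prod_unfold)
  qed (use f in auto)
  then show ?S by (simp add: I_def[abs_def])
  show "t_partial (\<lambda>t \<theta>. integral (cbox a b) (\<lambda>p. k p *\<^sub>R f t (\<theta> + s p)))
        (\<lambda>t \<theta>. integral (cbox a b) (\<lambda>p. k p *\<^sub>R h t (\<theta> + s p)))" if "t_partial f h"
    using tp[OF that f] by (simp add: I_def[abs_def])
  show "angle_partial (\<lambda>t \<theta>. integral (cbox a b) (\<lambda>p. k p *\<^sub>R f t (\<theta> + s p)))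
        (\<lambda>t \<theta>. integral (cbox a b) (\<lambda>p. k p *\<^sub>R h t (\<theta> + s p)))" if "angle_partial f h"
    using ap[OF that f] by (simp add: I_def[abs_def])
qed

section \<open>Vector fields on the circle and their curves\<close>

lemma Vect_periodic: "x \<in> Vect \<Longrightarrow> x (\<theta> + 2 * pi) = x \<theta>"
  by (simp add: Vect_def)

lemma curves_Vect_iff:
  "x \<in> curves Vect \<longleftrightarrow> smooth_family x \<and> (\<forall>t\<in>{0..1}. \<forall>\<theta>. x t (\<theta> + 2 * pi) = x t \<theta>)"
  by (auto simp: curves_def Vect_def smooth_slice)

lemma curves_smooth_family: "x \<in> curves V \<Longrightarrow> smooth_family x"
  by (simp add: curves_def)

lemma curves_slice: "x \<in> curves V \<Longrightarrow> t \<in> {0..1} \<Longrightarrow> x t \<in> V"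
  by (simp add: curves_def)

lemma constant_curve: "x \<in> Vect \<Longrightarrow> (\<lambda>t. x) \<in> curves Vect"
  by (simp add: curves_def Vect_def smooth_iff_constant_family)

lemma curves_slice_zero: "x \<in> curves V \<Longrightarrow> x 0 \<in> V"
  by (rule curves_slice) auto

lemma time_deriv_eqI:
  "((\<lambda>s. f s \<theta>) has_vector_derivative d) (at t within {0..1}) \<Longrightarrow> t \<in> {0..1} \<Longrightarrow> time_deriv f t \<theta> = d"
  unfolding time_deriv_def by (rule vector_derivative_within[OF within_unit_neq_bot])

lemma has_time_deriv:
  fixes x :: "real \<Rightarrow> real \<Rightarrow> real"
  assumes "smooth_family x" "t \<in> {0..1}"
  shows "((\<lambda>s. x s \<theta>) has_real_derivative time_deriv x t \<theta>) (at t within {0..1})"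
  using t_partialD[OF t_partial_time_deriv[OF assms(1)] assms(2)]
  by (simp add: has_real_derivative_iff_has_vector_derivative)

lemma has_angle_deriv:
  fixes x :: "real \<Rightarrow> real \<Rightarrow> real"
  assumes "smooth_family x" "t \<in> {0..1}"
  shows "(x t has_real_derivative deriv (x t) \<theta>) (at \<theta>)"
proof -
  from smooth_family_partials[OF assms(1)] obtain k where k: "angle_partial x k" by blast
  then show ?thesis
    using angle_partialD[OF k assms(2)]
    by (metis DERIV_imp_deriv has_real_derivative_iff_has_vector_derivative)
qed

lemma angle_partial_deriv:
  fixes x :: "real \<Rightarrow> real \<Rightarrow> real"
  shows "smooth_family x \<Longrightarrow> angle_partial x (\<lambda>t. deriv (x t))"
  unfolding angle_partial_def
  using has_angle_deriv by (simp add: has_real_derivative_iff_has_vector_derivative)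

lemma smooth_family_deriv:
  fixes x :: "real \<Rightarrow> real \<Rightarrow> real"
  shows "smooth_family x \<Longrightarrow> smooth_family (\<lambda>t. deriv (x t))"
  using smooth_family_angle_partial angle_partial_deriv by blast

lemma Vect_has_deriv: "x \<in> Vect \<Longrightarrow> (x has_real_derivative deriv x \<theta>) (at \<theta>)"
  using has_angle_deriv[of "\<lambda>t. x" 0] constant_curve[of x] by (simp add: curves_smooth_family)

lemma Vect_continuous: "x \<in> Vect \<Longrightarrow> continuous_on S x"
  by (meson DERIV_continuous_on Vect_has_deriv has_field_derivative_at_within)

lemma deriv_time_deriv:
  fixes x :: "real \<Rightarrow> real \<Rightarrow> real"
  assumes "smooth_family x" "t \<in> {0..1}"
  shows "time_deriv (\<lambda>t. deriv (x t)) t = deriv (time_deriv x t)"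
proof
  fix \<theta>
  have "angle_partial (time_deriv x) (time_deriv (\<lambda>t. deriv (x t)))"
    by (rule clairaut[where g = x and h = "\<lambda>t. deriv (x t)"])
      (intro angle_partial_deriv t_partial_time_deriv smooth_family_deriv
         smooth_family_jointly_cont smooth_family_time_deriv assms)+
  from angle_partialD[OF this assms(2), of \<theta>]
  show "time_deriv (\<lambda>t. deriv (x t)) t \<theta> = deriv (time_deriv x t) \<theta>"
    by (simp add: DERIV_imp_deriv has_real_derivative_iff_has_vector_derivative)
qed

lemma deriv_periodic:
  fixes x :: "real \<Rightarrow> real"
  assumes "\<And>\<theta>. x (\<theta> + 2 * pi) = x \<theta>" and d: "\<And>\<theta>. (x has_real_derivative deriv x \<theta>) (at \<theta>)"
  shows "deriv x (\<theta> + 2 * pi) = deriv x \<theta>"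
proof -
  have "((\<lambda>\<theta>. x (\<theta> + 2 * pi)) has_real_derivative deriv x (\<theta> + 2 * pi)) (at \<theta>)"
    using d[of "\<theta> + 2 * pi"] by (simp add: DERIV_shift)
  then show ?thesis using assms(1) DERIV_unique[OF _ d[of \<theta>]] by simp
qed

lemma curves_deriv: "x \<in> curves Vect \<Longrightarrow> (\<lambda>t. deriv (x t)) \<in> curves Vect"
  by (auto simp: curves_Vect_iff smooth_family_deriv intro!: deriv_periodic has_angle_deriv)

lemma curves_time_deriv:
  assumes "x \<in> curves Vect" shows "time_deriv x \<in> curves Vect"
  unfolding curves_Vect_iff
proof (intro conjI ballI allI)
  have x: "smooth_family x" "\<And>t \<theta>. t \<in> {0..1} \<Longrightarrow> x t (\<theta> + 2 * pi) = x t \<theta>"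
    using assms by (auto simp: curves_Vect_iff)
  show "smooth_family (time_deriv x)" using x by (rule_tac smooth_family_time_deriv)
  fix t \<theta> :: real assume t: "t \<in> {0..1}"
  have "((\<lambda>s. x s (\<theta> + 2 * pi)) has_vector_derivative time_deriv x t \<theta>) (at t within {0..1})"
    by (rule has_vector_derivative_transform[OF t _ t_partialD[OF t_partial_time_deriv[OF x(1)] t]])
      (rule x(2))
  then show "time_deriv x t (\<theta> + 2 * pi) = time_deriv x t \<theta>"
    using t by (rule time_deriv_eqI)
qed

lemma curves_add: "x \<in> curves Vect \<Longrightarrow> y \<in> curves Vect \<Longrightarrow> (\<lambda>t \<theta>. x t \<theta> + y t \<theta>) \<in> curves Vect"
  by (simp add: curves_Vect_iff smooth_family_add)

lemma curves_diff: "x \<in> curves Vect \<Longrightarrow> y \<in> curves Vect \<Longrightarrow> (\<lambda>t \<theta>. x t \<theta> - y t \<theta>) \<in> curves Vect"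
  by (simp add: curves_Vect_iff smooth_family_diff)

lemma curves_mult: "x \<in> curves Vect \<Longrightarrow> y \<in> curves Vect \<Longrightarrow> (\<lambda>t \<theta>. x t \<theta> * y t \<theta>) \<in> curves Vect"
  by (simp add: curves_Vect_iff smooth_family_mult)

lemma curves_const: "(\<lambda>t \<theta>. c) \<in> curves Vect"
  by (simp add: curves_Vect_iff)

lemmas curves_intros = curves_add curves_diff curves_mult curves_const curves_deriv curves_time_deriv

lemmas Vect_intros =
  curves_slice_zero[OF curves_add[OF constant_curve constant_curve]]
  curves_slice_zero[OF curves_diff[OF constant_curve constant_curve]]
  curves_slice_zero[OF curves_mult[OF constant_curve constant_curve]]
  curves_slice_zero[OF curves_const]
  curves_slice_zero[OF curves_deriv[OF constant_curve]]

lemma bracket_curve: "x \<in> curves Vect \<Longrightarrow> y \<in> curves Vect \<Longrightarrow> (\<lambda>t. bracket (x t) (y t)) \<in> curves Vect"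
  unfolding bracket_def by (intro curves_intros)

lemma ad_transpose_curve:
  "x \<in> curves Vect \<Longrightarrow> y \<in> curves Vect \<Longrightarrow> (\<lambda>t. ad_transpose (x t) (y t)) \<in> curves Vect"
  unfolding ad_transpose_def by (intro curves_intros)

lemma bracket_Vect: "x \<in> Vect \<Longrightarrow> y \<in> Vect \<Longrightarrow> bracket x y \<in> Vect"
  unfolding bracket_def by (intro Vect_intros)

lemma ad_transpose_Vect: "x \<in> Vect \<Longrightarrow> y \<in> Vect \<Longrightarrow> ad_transpose x y \<in> Vect"
  unfolding ad_transpose_def by (intro Vect_intros)

section \<open>Integration over the circle\<close>

lemma smooth_family_at_angle:
  assumes "smooth_family f" shows "smooth_family (\<lambda>t \<theta>. f t c)"
proof -
  obtain D where D: "\<forall>t\<in>{0..1}. D 0 0 t = f t"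
    "\<And>i j. continuous_on ({0..1} \<times> UNIV) (\<lambda>(t, \<theta>). D i j t \<theta>)"
    "\<And>i (j :: nat) t \<theta>. t \<in> {0..1} \<Longrightarrow> ((\<lambda>s. D i j s \<theta>) has_vector_derivative D (Suc i) j t \<theta>) (at t within {0..1})"
    using assms unfolding smooth_family_def by blast
  have c: "continuous_on ({0..1} \<times> (UNIV :: real set)) (\<lambda>p. D i 0 (fst p) c)" for i
    by (rule jointly_cont_compose[OF D(2)[of i 0, folded jointly_cont_def]]) (auto intro!: continuous_intros)
  show ?thesis unfolding smooth_family_def
  proof (intro exI[of _ "\<lambda>i j t \<theta>. if j = 0 then D i 0 t c else 0"] conjI ballI allI)
    show "continuous_on ({0..1} \<times> UNIV) (\<lambda>(t, \<theta> :: real). if j = 0 then D i 0 t c else 0)" for i and j :: nat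
      using c[of i] by (cases "j = 0") (simp_all add: case_prod_unfold)
  qed (use D in auto)
qed

lemma
  fixes f :: "real \<Rightarrow> real \<Rightarrow> 'a::banach"
  assumes f: "smooth_family f"
  shows smooth_family_circle_integral: "smooth_family (\<lambda>t \<theta>. integral {0..2 * pi} (f t))"
    and t_partial_circle_integral: "t_partial f h \<Longrightarrow>
      t_partial (\<lambda>t \<theta>. integral {0..2 * pi} (f t)) (\<lambda>t \<theta>. integral {0..2 * pi} (h t))"
proof -
  have c: "continuous_on (cbox 0 (2 * pi)) (\<lambda>p. 1 :: real)" "continuous_on (cbox 0 (2 * pi)) (\<lambda>p. p :: real)"
    by (intro continuous_intros)+
  show "smooth_family (\<lambda>t \<theta>. integral {0..2 * pi} (f t))"
    using smooth_family_at_angle[OF smooth_family_superposition[OF f c], of 0] by simp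
  assume "t_partial f h"
  from t_partial_superposition[OF f c this]
  show "t_partial (\<lambda>t \<theta>. integral {0..2 * pi} (f t)) (\<lambda>t \<theta>. integral {0..2 * pi} (h t))"
    unfolding t_partial_def using add_0 by (auto dest!: bspec spec[of _ 0])
qed

lemma integral_circle_shift:
  fixes f :: "real \<Rightarrow> 'a::euclidean_space"
  assumes per: "\<And>\<theta>. f (\<theta> + 2 * pi) = f \<theta>" and cont: "continuous_on UNIV f"
  shows "integral {0..2 * pi} (\<lambda>\<theta>. f (\<theta> + s)) = integral {0..2 * pi} f"
proof -
  define a b where "a = - \<bar>s\<bar> - 1" and "b = \<bar>s\<bar> + 1 + 2 * pi"
  have c: "continuous_on S f" for S using cont continuous_on_subset by blast
  define G where "G x = integral {a..x} f" for x
  have G: "(G has_vector_derivative f x) (at x)" if "x \<in> {a<..<b}" for x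
    using integral_has_vector_derivative[OF c[of "{a..b}"], of x] that at_within_Icc_at[of a x b]
    by (simp add: G_def[abs_def])
  have eq: "integral {r..r + 2 * pi} f = G (r + 2 * pi) - G r" if "\<bar>r\<bar> \<le> \<bar>s\<bar>" for r
  proof -
    have *: "a \<le> r" "r \<le> r + 2 * pi" "f integrable_on {a..r + 2 * pi}"
      using that integrable_continuous_interval[OF c] by (auto simp: a_def)
    from Henstock_Kurzweil_Integration.integral_combine[OF *] show ?thesis
      by (simp add: G_def algebra_simps)
  qed
  define H where "H r = G (r + 2 * pi) - G r" for r
  have H: "(H has_vector_derivative 0) (at r within {-\<bar>s\<bar>..\<bar>s\<bar>})" if "r \<in> {-\<bar>s\<bar>..\<bar>s\<bar>}" for r
  proof -
    have in1: "r + 2 * pi \<in> {a<..<b}" and in2: "r \<in> {a<..<b}"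
      using that pi_gt_zero unfolding a_def b_def greaterThanLessThan_iff atLeastAtMost_iff by linarith+
    have "((\<lambda>r. r + 2 * pi) has_vector_derivative 1) (at r)"
      by (auto intro!: derivative_eq_intros)
    from vector_diff_chain_at[OF this G[OF in1]]
    have "((\<lambda>r. G (r + 2 * pi)) has_vector_derivative f (r + 2 * pi)) (at r)" by (simp add: o_def)
    from has_vector_derivative_diff[OF this G[OF in2]] show ?thesis
      unfolding H_def[abs_def] using per by (simp add: has_vector_derivative_at_within)
  qed
  obtain k where k: "\<And>r. r \<in> {-\<bar>s\<bar>..\<bar>s\<bar>} \<Longrightarrow> H r = k"
    using has_vector_derivative_zero_constant[OF convex_real_interval(5) H] by blast
  have s: "s \<in> {-\<bar>s\<bar>..\<bar>s\<bar>}" unfolding atLeastAtMost_iff by linarith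
  have "integral {0..2 * pi} (\<lambda>\<theta>. f (\<theta> + s)) = integral {s..s + 2 * pi} f"
    using integral_shift[of 0 s "2 * pi" f] c by (simp add: add.commute o_def)
  also have "\<dots> = integral {0..0 + 2 * pi} f"
    using eq[of s] eq[of 0] k[OF s] k[of 0] by (simp add: H_def)
  finally show ?thesis by simp
qed

lemma integral_circle_deriv:
  assumes "x \<in> Vect" shows "integral {0..2 * pi} (deriv x) = 0"
proof -
  have "(x has_vector_derivative deriv x \<theta>) (at \<theta> within {0..2 * pi})" for \<theta>
    using has_field_derivative_at_within[OF Vect_has_deriv[OF assms]] by (simp add: has_real_derivative_iff_has_vector_derivative)
  then have "(deriv x has_integral x (2 * pi) - x 0) {0..2 * pi}"
    by (intro fundamental_theorem_of_calculus) simp_all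
  then show ?thesis using Vect_periodic[OF assms, of 0] by (simp add: integral_unique)
qed

lemma Vect_integrable: "x \<in> Vect \<Longrightarrow> x integrable_on {a..b}"
  by (intro integrable_continuous_interval Vect_continuous)

lemma deriv_mult_Vect:
  "x \<in> Vect \<Longrightarrow> y \<in> Vect \<Longrightarrow> deriv (\<lambda>\<theta>. x \<theta> * y \<theta>) \<theta> = deriv x \<theta> * y \<theta> + x \<theta> * deriv y \<theta>"
  by (rule DERIV_imp_deriv) (auto intro!: derivative_eq_intros Vect_has_deriv)

lemma deriv_add_Vect:
  "x \<in> Vect \<Longrightarrow> y \<in> Vect \<Longrightarrow> deriv (\<lambda>\<theta>. x \<theta> + y \<theta>) \<theta> = deriv x \<theta> + deriv y \<theta>"
  by (rule DERIV_imp_deriv) (auto intro!: derivative_eq_intros Vect_has_deriv)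

lemma deriv_diff_Vect:
  "x \<in> Vect \<Longrightarrow> y \<in> Vect \<Longrightarrow> deriv (\<lambda>\<theta>. x \<theta> - y \<theta>) \<theta> = deriv x \<theta> - deriv y \<theta>"
  by (rule DERIV_imp_deriv) (auto intro!: derivative_eq_intros Vect_has_deriv)

lemma L2_commute: "L2 x y = L2 y x"
  by (simp add: L2_def mult.commute)

lemma L2_add_left: "x \<in> Vect \<Longrightarrow> y \<in> Vect \<Longrightarrow> z \<in> Vect \<Longrightarrow> L2 (\<lambda>\<theta>. x \<theta> + y \<theta>) z = L2 x z + L2 y z"
  by (simp add: L2_def ring_distribs Vect_intros Vect_integrable
      Henstock_Kurzweil_Integration.integral_add add_divide_distrib)

lemma L2_diff_left: "x \<in> Vect \<Longrightarrow> y \<in> Vect \<Longrightarrow> z \<in> Vect \<Longrightarrow> L2 (\<lambda>\<theta>. x \<theta> - y \<theta>) z = L2 x z - L2 y z"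
  by (simp add: L2_def ring_distribs Vect_intros Vect_integrable
      Henstock_Kurzweil_Integration.integral_diff diff_divide_distrib)

lemma L2_scale_left: "L2 (\<lambda>\<theta>. c * x \<theta>) z = c * L2 x z"
  by (simp add: L2_def mult.assoc)

lemma L2_add_right: "x \<in> Vect \<Longrightarrow> y \<in> Vect \<Longrightarrow> z \<in> Vect \<Longrightarrow> L2 z (\<lambda>\<theta>. x \<theta> + y \<theta>) = L2 z x + L2 z y"
  by (subst (1 2 3) L2_commute) (rule L2_add_left)

lemma L2_diff_right: "x \<in> Vect \<Longrightarrow> y \<in> Vect \<Longrightarrow> z \<in> Vect \<Longrightarrow> L2 z (\<lambda>\<theta>. x \<theta> - y \<theta>) = L2 z x - L2 z y"
  by (subst (1 2 3) L2_commute) (rule L2_diff_left)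

lemma L2_zero_left [simp]: "L2 (\<lambda>\<theta>. 0) z = 0" by (simp add: L2_def)

lemma L2_deriv_left:
  assumes "x \<in> Vect" "y \<in> Vect" shows "L2 (deriv x) y = - L2 x (deriv y)"
proof -
  have "integral {0..2 * pi} (\<lambda>\<theta>. deriv x \<theta> * y \<theta> + x \<theta> * deriv y \<theta>) = 0"
    using integral_circle_deriv[OF Vect_intros(3)[OF assms]]
    unfolding deriv_mult_Vect[OF assms, abs_def] .
  then have "integral {0..2 * pi} (\<lambda>\<theta>. deriv x \<theta> * y \<theta>) + integral {0..2 * pi} (\<lambda>\<theta>. x \<theta> * deriv y \<theta>) = 0"
    using assms by (simp add: Henstock_Kurzweil_Integration.integral_add Vect_integrable Vect_intros)
  then show ?thesis by (simp add: L2_def add_eq_0_iff)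
qed

lemma L2_bracket_adjoint:
  assumes u: "u \<in> Vect" and x: "x \<in> Vect" and y: "y \<in> Vect"
  shows "L2 y (bracket u x) = L2 (ad_transpose u y) x"
proof -
  have "L2 (deriv x) (\<lambda>\<theta>. u \<theta> * y \<theta>) = - L2 x (deriv (\<lambda>\<theta>. u \<theta> * y \<theta>))"
    by (intro L2_deriv_left x Vect_intros u y)
  also have "deriv (\<lambda>\<theta>. u \<theta> * y \<theta>) = (\<lambda>\<theta>. deriv u \<theta> * y \<theta> + u \<theta> * deriv y \<theta>)"
    using deriv_mult_Vect[OF u y] by auto
  finally have 1: "L2 (deriv x) (\<lambda>\<theta>. u \<theta> * y \<theta>) =
      - L2 x (\<lambda>\<theta>. deriv u \<theta> * y \<theta>) - L2 x (\<lambda>\<theta>. u \<theta> * deriv y \<theta>)"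
    by (simp add: L2_add_right Vect_intros u x y)
  have "L2 y (bracket u x) = L2 y (\<lambda>\<theta>. deriv u \<theta> * x \<theta>) - L2 y (\<lambda>\<theta>. u \<theta> * deriv x \<theta>)"
    unfolding bracket_def by (intro L2_diff_right Vect_intros u x y)
  also have "L2 y (\<lambda>\<theta>. deriv u \<theta> * x \<theta>) = L2 x (\<lambda>\<theta>. deriv u \<theta> * y \<theta>)"
    by (simp add: L2_def mult_ac)
  also have "L2 y (\<lambda>\<theta>. u \<theta> * deriv x \<theta>) = L2 (deriv x) (\<lambda>\<theta>. u \<theta> * y \<theta>)"
    by (simp add: L2_def mult_ac)
  also have "L2 x (\<lambda>\<theta>. deriv u \<theta> * y \<theta>) - L2 (deriv x) (\<lambda>\<theta>. u \<theta> * y \<theta>) =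
      2 * L2 x (\<lambda>\<theta>. deriv u \<theta> * y \<theta>) + L2 x (\<lambda>\<theta>. u \<theta> * deriv y \<theta>)"
    using 1 by simp
  also have "\<dots> = L2 (ad_transpose u y) x"
    unfolding ad_transpose_def
    using L2_add_left[of "\<lambda>\<theta>. u \<theta> * deriv y \<theta>" "\<lambda>\<theta>. 2 * (deriv u \<theta> * y \<theta>)" x]
      L2_scale_left[of 2 "\<lambda>\<theta>. deriv u \<theta> * y \<theta>" x] u x y
    by (simp add: Vect_intros L2_commute[of x] mult.assoc)
  finally show ?thesis .
qed

lemma L2_has_time_deriv:
  assumes x: "x \<in> curves Vect" and y: "y \<in> curves Vect" and t: "t \<in> {0..1}"
  shows "((\<lambda>t. L2 (x t) (y t)) has_real_derivative
    L2 (time_deriv x t) (y t) + L2 (x t) (time_deriv y t)) (at t within {0..1})"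
proof -
  let ?f = "\<lambda>t \<theta>. x t \<theta> * y t \<theta>"
  let ?h = "\<lambda>t \<theta>. time_deriv x t \<theta> * y t \<theta> + x t \<theta> * time_deriv y t \<theta>"
  have xs: "smooth_family x" and ys: "smooth_family y" using x y by (auto intro: curves_smooth_family)
  have "t_partial ?f ?h" unfolding t_partial_def
  proof (intro ballI allI)
    fix t \<theta> :: real assume t: "t \<in> {0..1}"
    show "((\<lambda>s. x s \<theta> * y s \<theta>) has_vector_derivative ?h t \<theta>) (at t within {0..1})"
      unfolding has_real_derivative_iff_has_vector_derivative[symmetric]
      by (rule DERIV_cong, rule DERIV_mult[OF has_time_deriv[OF xs t] has_time_deriv[OF ys t]]) simp
  qed
  from t_partialD[OF t_partial_circle_integral[OF smooth_family_mult[OF xs ys] this] t]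
  have "((\<lambda>t. integral {0..2 * pi} (?f t)) has_real_derivative integral {0..2 * pi} (?h t)) (at t within {0..1})"
    by (simp add: has_real_derivative_iff_has_vector_derivative)
  from DERIV_cmult[OF this, of "1 / (2 * pi)"]
  have "((\<lambda>t. L2 (x t) (y t)) has_real_derivative 1 / (2 * pi) * integral {0..2 * pi} (?h t)) (at t within {0..1})"
    by (simp add: L2_def)
  moreover have "integral {0..2 * pi} (?h t) =
      integral {0..2 * pi} (\<lambda>\<theta>. time_deriv x t \<theta> * y t \<theta>) + integral {0..2 * pi} (\<lambda>\<theta>. x t \<theta> * time_deriv y t \<theta>)"
    using curves_slice[OF x t] curves_slice[OF y t] curves_slice[OF curves_time_deriv[OF x] t]
      curves_slice[OF curves_time_deriv[OF y] t]
    by (intro Henstock_Kurzweil_Integration.integral_add Vect_integrable Vect_intros)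
  ultimately show ?thesis by (simp add: L2_def add_divide_distrib)
qed

lemma L2_nonneg: "x \<in> Vect \<Longrightarrow> 0 \<le> L2 x x"
  using integral_nonneg[OF Vect_integrable[OF Vect_intros(3)[of x x]], of 0 "2 * pi"]
  by (simp add: L2_def)

text \<open>The integrand \<open>x\<^sup>2\<close> is continuous and nonnegative. A rotation carries an arbitrary point into the
  interval of integration.\<close>

lemma L2_self_zero:
  assumes x: "x \<in> Vect" and 0: "L2 x x = 0" shows "x \<theta> = 0"
proof -
  have int: "integral {0..2 * pi} (\<lambda>\<theta>. x \<theta> * x \<theta>) = 0" using 0 by (simp add: L2_def)
  have "integral {0..2 * pi} (\<lambda>\<phi>. x (\<phi> + (\<theta> - pi)) * x (\<phi> + (\<theta> - pi))) = 0"
    using integral_circle_shift[of "\<lambda>\<theta>. x \<theta> * x \<theta>" "\<theta> - pi"] Vect_periodic[OF x] int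
      Vect_continuous[OF Vect_intros(3)[OF x x]] by simp
  moreover have "continuous_on {0..2 * pi} (\<lambda>\<phi>. x (\<phi> + (\<theta> - pi)) * x (\<phi> + (\<theta> - pi)))"
    by (intro continuous_intros continuous_on_compose2[OF Vect_continuous[OF x, of UNIV]]) auto
  ultimately have "x (pi + (\<theta> - pi)) * x (pi + (\<theta> - pi)) = 0"
    using integral_eq_0_iff[of 0 "2 * pi" "\<lambda>\<phi>. x (\<phi> + (\<theta> - pi)) * x (\<phi> + (\<theta> - pi))"]
    by (auto dest!: bspec[of _ _ pi])
  then show ?thesis by simp
qed

section \<open>The Hilbert transform\<close>

text \<open>Folding the principal value integral at the singularity turns it into
  \<open>\<integral> (x (\<theta> + s) - x (\<theta> - s)) cot (s / 2) ds\<close> over \<open>[0, \<pi>]\<close>, and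
  \<open>x (\<theta> + s) - x (\<theta> - s) = s \<integral> x' (\<theta> + s \<sigma>) d\<sigma>\<close> over \<open>[-1, 1]\<close>. The factor \<open>s\<close> cancels the pole of
  the cotangent, which leaves this continuous kernel.\<close>

definition hilbert_kernel :: "real \<Rightarrow> real" where
  "hilbert_kernel s = (if s = 0 then 2 else s * cos (s / 2) / sin (s / 2))"

lemma hilbert_kernel_continuous: "continuous_on {0..pi} hilbert_kernel"
  unfolding continuous_on_eq_continuous_within
proof
  fix s :: real assume s: "s \<in> {0..pi}"
  show "continuous (at s within {0..pi}) hilbert_kernel"
  proof (cases "s = 0")
    case True
    have sin: "((\<lambda>h :: real. sin h / h) \<longlongrightarrow> 1) (at 0)"
      using DERIV_sin[of "0::real"] by (simp add: DERIV_def)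
    have half: "filterlim (\<lambda>s :: real. s / 2) (at 0) (at 0)"
      by (rule filterlim_atI) (auto intro!: tendsto_eq_intros simp: eventually_at_filter)
    have "((\<lambda>s. 2 * cos (s / 2) / (sin (s / 2) / (s / 2))) \<longlongrightarrow> 2 * cos (0 / 2) / 1) (at (0 :: real))"
      by (intro tendsto_intros filterlim_compose[OF sin half]) auto
    then have "((\<lambda>s. 2 * cos (s / 2) / (sin (s / 2) / (s / 2))) \<longlongrightarrow> 2) (at (0 :: real))"
      by simp
    then have "(hilbert_kernel \<longlongrightarrow> 2) (at 0)"
      by (rule Lim_transform_eventually)
        (auto simp: hilbert_kernel_def eventually_at_filter field_simps)
    then have "(hilbert_kernel \<longlongrightarrow> 2) (at 0 within {0..pi})"
      by (rule tendsto_within_subset) simp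
    then show ?thesis using True by (simp add: continuous_within hilbert_kernel_def)
  next
    case False
    have "sin (s / 2) > 0" using s False by (intro sin_gt_zero) auto
    then have "isCont (\<lambda>s. s * cos (s / 2) / sin (s / 2)) s" by (intro continuous_intros) auto
    moreover have "\<forall>\<^sub>F r in nhds s. hilbert_kernel r = r * cos (r / 2) / sin (r / 2)"
      using t1_space_nhds[OF False] by eventually_elim (simp add: hilbert_kernel_def)
    ultimately have "isCont hilbert_kernel s" by (simp add: isCont_cong)
    then show ?thesis by (rule continuous_at_imp_continuous_at_within)
  qed
qed

definition hilbert_chord :: "(real \<Rightarrow> real) \<Rightarrow> real \<Rightarrow> real \<Rightarrow> real" where
  "hilbert_chord x \<theta> s = integral {-1..1} (\<lambda>\<sigma>. deriv x (\<theta> + s * \<sigma>))"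

lemma hilbert_chord:
  assumes x: "x \<in> Vect"
  shows "s * hilbert_chord x \<theta> s = x (\<theta> + s) - x (\<theta> - s)"
proof -
  have "((\<lambda>\<sigma>. x (\<theta> + s * \<sigma>)) has_vector_derivative s * deriv x (\<theta> + s * \<sigma>)) (at \<sigma> within {-1..1})" for \<sigma>
    unfolding has_real_derivative_iff_has_vector_derivative[symmetric]
    by (rule DERIV_cong, rule DERIV_chain2[OF Vect_has_deriv[OF x]])
      (auto intro!: derivative_eq_intros)
  then have "((\<lambda>\<sigma>. s * deriv x (\<theta> + s * \<sigma>)) has_integral x (\<theta> + s * 1) - x (\<theta> + s * -1)) {-1..1}"
    by (intro fundamental_theorem_of_calculus) auto
  from integral_unique[OF this] show ?thesis by (simp add: hilbert_chord_def)
qed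

lemma continuous_on_chord_integrand:
  assumes "x \<in> Vect"
  shows "continuous_on ({0..pi} \<times> {-1..1}) (\<lambda>p. hilbert_kernel (fst p) * deriv x (\<theta> + fst p * snd p))"
  by (intro continuous_intros continuous_on_compose2[OF hilbert_kernel_continuous]
      continuous_on_compose2[OF Vect_continuous[OF Vect_intros(5)[OF assms], of UNIV]]) auto

lemma hilbert_folded_continuous:
  assumes "x \<in> Vect"
  shows "continuous_on {0..pi} (\<lambda>s. hilbert_kernel s * hilbert_chord x \<theta> s)"
proof -
  have "continuous_on {0..pi} (\<lambda>s. integral (cbox (-1) 1) (\<lambda>\<sigma>. deriv x (\<theta> + s * \<sigma>)))"
    by (rule integral_continuous_on_param)
      (auto simp: case_prod_unfold intro!: continuous_intros
        continuous_on_compose2[OF Vect_continuous[OF Vect_intros(5)[OF assms], of UNIV]])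
  then show ?thesis
    unfolding hilbert_chord_def by (intro continuous_on_mult hilbert_kernel_continuous) simp
qed

lemma hilbert_truncated:
  assumes x: "x \<in> Vect" and e: "0 < \<epsilon>" "\<epsilon> < pi"
  shows "integral {\<theta> + \<epsilon>..\<theta> + 2 * pi - \<epsilon>} (\<lambda>t. x t / tan ((t - \<theta>) / 2)) =
    integral {\<epsilon>..pi} (\<lambda>s. hilbert_kernel s * hilbert_chord x \<theta> s)"
proof -
  define h where "h s = x (s + \<theta>) * cos (s / 2) / sin (s / 2)" for s
  have cont: "continuous_on S h" if "S \<subseteq> {0<..<2 * pi}" for S
  proof -
    have "sin (s / 2) \<noteq> 0" if "s \<in> S" for s
      using \<open>S \<subseteq> _\<close> that sin_gt_zero[of "s / 2"] by force
    then show ?thesis unfolding h_def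
      by (intro continuous_intros continuous_on_compose2[OF Vect_continuous[OF x, of UNIV]]) auto
  qed
  have cont': "continuous_on {\<epsilon> + \<theta>..2 * pi - \<epsilon> + \<theta>} (\<lambda>t. h (t - \<theta>))"
    using e by (intro continuous_on_compose2[OF cont[of "{\<epsilon>..2 * pi - \<epsilon>}"]] continuous_intros) auto
  have "integral {\<theta> + \<epsilon>..\<theta> + 2 * pi - \<epsilon>} (\<lambda>t. x t / tan ((t - \<theta>) / 2)) =
      integral {\<epsilon> + \<theta>..2 * pi - \<epsilon> + \<theta>} (\<lambda>t. h (t - \<theta>))"
    by (simp add: h_def tan_def algebra_simps)
  also have "\<dots> = integral {\<epsilon>..2 * pi - \<epsilon>} h"
    using integral_shift[OF cont'] by (simp add: o_def)
  also have "\<dots> = integral {\<epsilon>..pi} h + integral {pi..2 * pi - \<epsilon>} h"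
    using e by (intro Henstock_Kurzweil_Integration.integral_combine[symmetric]
        integrable_continuous_interval cont) auto
  also have "integral {pi..2 * pi - \<epsilon>} h = integral {\<epsilon>..pi} (\<lambda>s. h (2 * pi - s))"
  proof -
    have c: "continuous_on {-pi + 2 * pi..-\<epsilon> + 2 * pi} h" using e by (intro cont) auto
    have "integral {\<epsilon>..pi} (\<lambda>s. h (2 * pi - s)) = integral {-pi..-\<epsilon>} (\<lambda>s. h (s + 2 * pi))"
      using Henstock_Kurzweil_Integration.integral_reflect_real[of "-\<epsilon>" "-pi" "\<lambda>s. h (s + 2 * pi)"] by simp
    also have "\<dots> = integral {-pi + 2 * pi..-\<epsilon> + 2 * pi} h"
      using integral_shift[OF c] by (simp add: o_def)
    finally show ?thesis by simp
  qed
  also have "integral {\<epsilon>..pi} h + integral {\<epsilon>..pi} (\<lambda>s. h (2 * pi - s)) =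
      integral {\<epsilon>..pi} (\<lambda>s. h s + h (2 * pi - s))"
    using e by (intro Henstock_Kurzweil_Integration.integral_add[symmetric] integrable_continuous_interval
        cont continuous_on_compose2[OF cont[of "{0<..<2 * pi}"]] continuous_intros) auto
  also have "\<dots> = integral {\<epsilon>..pi} (\<lambda>s. hilbert_kernel s * hilbert_chord x \<theta> s)"
  proof (rule integral_cong)
    fix s assume s: "s \<in> {\<epsilon>..pi}"
    have "sin (pi - s / 2) = sin (s / 2)" "cos (pi - s / 2) = - cos (s / 2)"
      by simp_all
    moreover have "(2 * pi - s) / 2 = pi - s / 2" by (simp add: field_simps)
    moreover have "x (2 * pi - s + \<theta>) = x (\<theta> - s)"
      using Vect_periodic[OF x, of "\<theta> - s"] by (simp add: algebra_simps)
    ultimately have "h s + h (2 * pi - s) = (x (\<theta> + s) - x (\<theta> - s)) * (cos (s / 2) / sin (s / 2))"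
      by (simp add: h_def algebra_simps diff_divide_distrib)
    also have "\<dots> = hilbert_kernel s * hilbert_chord x \<theta> s"
      using s e by (simp add: hilbert_kernel_def hilbert_chord[OF x, symmetric])
    finally show "h s + h (2 * pi - s) = hilbert_kernel s * hilbert_chord x \<theta> s" .
  qed
  finally show ?thesis .
qed

lemma hilbert_folded:
  assumes x: "x \<in> Vect"
  shows "hilbert x \<theta> = 1 / (2 * pi) * integral {0..pi} (\<lambda>s. hilbert_kernel s * hilbert_chord x \<theta> s)"
proof -
  let ?F = "\<lambda>s. hilbert_kernel s * hilbert_chord x \<theta> s"
  have "continuous_on {0..pi} (\<lambda>\<epsilon>. integral {\<epsilon>..pi} ?F)"
    by (intro indefinite_integral_continuous_1' integrable_continuous_interval hilbert_folded_continuous x)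
  then have "((\<lambda>\<epsilon>. integral {\<epsilon>..pi} ?F) \<longlongrightarrow> integral {0..pi} ?F) (at 0 within {0..pi})"
    by (simp add: continuous_on)
  then have "((\<lambda>\<epsilon>. integral {\<epsilon>..pi} ?F) \<longlongrightarrow> integral {0..pi} ?F) (at_right 0)"
    by (simp add: at_within_Icc_at_right)
  moreover have "\<forall>\<^sub>F \<epsilon> in at_right 0. integral {\<epsilon>..pi} ?F =
      integral {\<theta> + \<epsilon>..\<theta> + 2 * pi - \<epsilon>} (\<lambda>t. x t / tan ((t - \<theta>) / 2))"
    using eventually_at_right_real[OF pi_gt_zero]
    by eventually_elim (simp add: hilbert_truncated[OF x])
  ultimately have lim: "((\<lambda>\<epsilon>. integral {\<theta> + \<epsilon>..\<theta> + 2 * pi - \<epsilon>} (\<lambda>t. x t / tan ((t - \<theta>) / 2)))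
      \<longlongrightarrow> integral {0..pi} ?F) (at_right 0)"
    by (rule Lim_transform_eventually)
  then show ?thesis
    by (simp add: hilbert_def tendsto_Lim)
qed

lemma hilbert_integral:
  assumes "x \<in> Vect"
  shows "hilbert x \<theta> = 1 / (2 * pi) *
    integral (cbox (0, -1) (pi, 1)) (\<lambda>p. hilbert_kernel (fst p) *\<^sub>R deriv x (\<theta> + fst p * snd p))"
  using continuous_on_chord_integrand[OF assms, of \<theta>]
  by (subst integral_prod_continuous)
    (simp_all add: hilbert_folded[OF assms] hilbert_chord_def cbox_Pair_eq)

lemma hilbert_diff:
  assumes "x \<in> Vect" "y \<in> Vect"
  shows "hilbert (\<lambda>\<theta>. x \<theta> - y \<theta>) \<theta> = hilbert x \<theta> - hilbert y \<theta>"
proof -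
  let ?k = "\<lambda>x p. hilbert_kernel (fst p) *\<^sub>R deriv x (\<theta> + fst p * snd p)"
  have "integral (cbox (0, -1) (pi, 1)) (?k (\<lambda>\<theta>. x \<theta> - y \<theta>)) =
      integral (cbox (0, -1) (pi, 1)) (\<lambda>p. ?k x p - ?k y p)"
    using assms by (intro integral_cong) (simp add: deriv_diff_Vect algebra_simps)
  also have "\<dots> = integral (cbox (0, -1) (pi, 1)) (?k x) - integral (cbox (0, -1) (pi, 1)) (?k y)"
    using continuous_on_chord_integrand assms
    by (intro Henstock_Kurzweil_Integration.integral_diff integrable_continuous) (auto simp: cbox_Pair_eq)
  finally show ?thesis
    using assms by (simp add: hilbert_integral Vect_intros diff_divide_distrib)
qed

text \<open>In the form just obtained the Hilbert transform is a superposition of rotates, hence acts on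
  smooth families and commutes with both partial derivatives.\<close>

lemma
  assumes x: "x \<in> curves Vect"
  shows hilbert_curve: "(\<lambda>t. hilbert (x t)) \<in> curves Vect"
    and time_deriv_hilbert: "t \<in> {0..1} \<Longrightarrow> time_deriv (\<lambda>t. hilbert (x t)) t = hilbert (time_deriv x t)"
    and deriv_hilbert_curve: "t \<in> {0..1} \<Longrightarrow> deriv (hilbert (x t)) = hilbert (deriv (x t))"
proof -
  define I where "I f t \<theta> = 1 / (2 * pi) * integral (cbox (0, -1) (pi, 1))
      (\<lambda>p. hilbert_kernel (fst p) *\<^sub>R f t (\<theta> + fst p * snd p))" for f :: "real \<Rightarrow> real \<Rightarrow> real" and t \<theta>
  have xs: "smooth_family x" using x by (rule curves_smooth_family)
  have I: "hilbert (y t) = I (\<lambda>t. deriv (y t)) t" if "y \<in> curves Vect" "t \<in> {0..1}" for y t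
    using hilbert_integral[OF curves_slice[OF that]] by (auto simp: I_def)
  have c: "continuous_on (cbox (0, -1) (pi, 1)) (\<lambda>p. hilbert_kernel (fst p))"
    "continuous_on (cbox (0, -1) (pi, 1)) (\<lambda>p. fst p * snd p :: real)"
    by (auto intro!: continuous_intros continuous_on_compose2[OF hilbert_kernel_continuous] simp: cbox_Pair_eq)
  have tp: "t_partial (I f) (I h)" if "t_partial f h" "smooth_family f" for f h
    using t_partial_superposition[OF that(2) c that(1)]
    unfolding t_partial_def I_def
    by (intro ballI allI bounded_linear.has_vector_derivative[OF bounded_linear_mult_right]) blast
  have ap: "angle_partial (I f) (I h)" if "angle_partial f h" "smooth_family f" for f h
    using angle_partial_superposition[OF that(2) c that(1)]
    unfolding angle_partial_def I_def[abs_def]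
    by (intro ballI allI bounded_linear.has_vector_derivative[OF bounded_linear_mult_right]) blast
  have "smooth_family (I (\<lambda>t. deriv (x t)))"
    unfolding I_def[abs_def]
    by (intro smooth_family_mult smooth_family_const smooth_family_superposition c smooth_family_deriv xs)
  then have sm: "smooth_family (\<lambda>t. hilbert (x t))"
    by (rule smooth_family_cong) (simp add: I[OF x])
  have per: "I f t (\<theta> + 2 * pi) = I f t \<theta>" if "f \<in> curves Vect" "t \<in> {0..1}" for f t \<theta>
    using Vect_periodic[OF curves_slice[OF that]] unfolding I_def
    by (simp add: add.commute add.left_commute)
      (metis add.assoc add.commute)
  show "(\<lambda>t. hilbert (x t)) \<in> curves Vect"
    using sm per[OF curves_deriv[OF x]] by (simp add: curves_Vect_iff I[OF x])
  show "time_deriv (\<lambda>t. hilbert (x t)) t = hilbert (time_deriv x t)" if t: "t \<in> {0..1}"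
  proof
    fix \<theta>
    have "t_partial (I (\<lambda>t. deriv (x t))) (I (time_deriv (\<lambda>t. deriv (x t))))"
      by (intro tp t_partial_time_deriv smooth_family_deriv xs)
    from t_partialD[OF this t]
    have "((\<lambda>s. hilbert (x s) \<theta>) has_vector_derivative I (time_deriv (\<lambda>t. deriv (x t))) t \<theta>) (at t within {0..1})"
      by (rule has_vector_derivative_transform[OF t, rotated]) (simp add: I[OF x])
    then have "time_deriv (\<lambda>t. hilbert (x t)) t \<theta> = I (time_deriv (\<lambda>t. deriv (x t))) t \<theta>"
      using t by (rule time_deriv_eqI)
    also have "\<dots> = hilbert (time_deriv x t) \<theta>"
      using I[OF curves_time_deriv[OF x] t] deriv_time_deriv[OF xs t] by (simp add: I_def)
    finally show "time_deriv (\<lambda>t. hilbert (x t)) t \<theta> = hilbert (time_deriv x t) \<theta>" .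
  qed
  show "deriv (hilbert (x t)) = hilbert (deriv (x t))" if t: "t \<in> {0..1}"
  proof
    fix \<theta>
    have "angle_partial (I (\<lambda>t. deriv (x t))) (I (\<lambda>t. deriv (deriv (x t))))"
      by (intro ap angle_partial_deriv smooth_family_deriv xs)
    from angle_partialD[OF this t]
    show "deriv (hilbert (x t)) \<theta> = hilbert (deriv (x t)) \<theta>"
      by (simp add: DERIV_imp_deriv has_real_derivative_iff_has_vector_derivative I[OF x t]
          I[OF curves_deriv[OF x] t])
  qed
qed

lemma hilbert_Vect: "x \<in> Vect \<Longrightarrow> hilbert x \<in> Vect"
  using curves_slice_zero[OF hilbert_curve[OF constant_curve]] .

lemma deriv_hilbert: "x \<in> Vect \<Longrightarrow> deriv (hilbert x) = hilbert (deriv x)"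
  using deriv_hilbert_curve[OF constant_curve, of x 0] by simp

text \<open>Moving the rotation and the derivative from one factor to the other costs a sign and
  reverses the rotation; the chord \<open>[-1, 1]\<close> is symmetric.\<close>

lemma L2_hilbert_skew:
  assumes x: "x \<in> Vect" and y: "y \<in> Vect"
  shows "L2 (hilbert x) y = - L2 x (hilbert y)"
proof -
  define M where "M x y s = integral {0..2 * pi} (\<lambda>\<theta>. deriv x (\<theta> + s) * y \<theta>)" for x y :: "real \<Rightarrow> real" and s
  let ?B = "cbox (0, -1) (pi, 1 :: real)"
  have c: "continuous_on S (\<lambda>p. z (f p))" if "z \<in> Vect" "continuous_on S f"
    for S :: "'b::topological_space set" and z f
    using continuous_on_compose2[OF Vect_continuous[OF that(1), of UNIV] that(2)] by auto
  have k: "continuous_on S (\<lambda>p. hilbert_kernel (f p))" if "continuous_on S f" "f ` S \<subseteq> {0..pi}"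
    for S :: "'b::topological_space set" and f
    using continuous_on_compose2[OF hilbert_kernel_continuous that] .
  have Mcont: "continuous_on UNIV (M x y)" if "x \<in> Vect" "y \<in> Vect" for x y
  proof -
    have "continuous_on UNIV (\<lambda>s. integral (cbox 0 (2 * pi)) (\<lambda>\<theta>. deriv x (\<theta> + s) * y \<theta>))"
      unfolding case_prod_unfold
      by (rule integral_continuous_on_param)
        (unfold case_prod_unfold, intro continuous_on_mult c[OF Vect_intros(5)[OF that(1)]] c[OF that(2)]
           continuous_on_add continuous_on_fst continuous_on_snd continuous_on_id)
    then show ?thesis by (simp add: M_def[abs_def])
  qed
  have swap: "L2 (hilbert x) y = 1 / (2 * pi) * (1 / (2 * pi) *
      integral {0..pi} (\<lambda>s. integral {-1..1} (\<lambda>\<sigma>. hilbert_kernel s * M x y (s * \<sigma>))))"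
    if x: "x \<in> Vect" and y: "y \<in> Vect" for x y
  proof -
    have "integral {0..2 * pi} (\<lambda>\<theta>. hilbert x \<theta> * y \<theta>) =
        1 / (2 * pi) * integral (cbox 0 (2 * pi)) (\<lambda>\<theta>. integral ?B
          (\<lambda>p. hilbert_kernel (fst p) * deriv x (\<theta> + fst p * snd p) * y \<theta>))"
      by (simp add: hilbert_integral[OF x])
    also have "integral (cbox 0 (2 * pi)) (\<lambda>\<theta>. integral ?B
          (\<lambda>p. hilbert_kernel (fst p) * deriv x (\<theta> + fst p * snd p) * y \<theta>)) =
        integral ?B (\<lambda>p. integral (cbox 0 (2 * pi))
          (\<lambda>\<theta>. hilbert_kernel (fst p) * deriv x (\<theta> + fst p * snd p) * y \<theta>))"
      by (rule integral_swap_continuous)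
        (auto simp: case_prod_unfold cbox_Pair_eq intro!: continuous_on_mult k c[OF Vect_intros(5)[OF x]] c[OF y] continuous_intros)
    also have "\<dots> = integral ?B (\<lambda>p. hilbert_kernel (fst p) * M x y (fst p * snd p))"
      by (simp add: M_def mult.assoc)
    also have "\<dots> = integral (cbox 0 pi) (\<lambda>s. integral (cbox (-1) 1) (\<lambda>\<sigma>. hilbert_kernel s * M x y (s * \<sigma>)))"
      by (subst integral_prod_continuous)
        (auto simp: cbox_Pair_eq intro!: continuous_intros k continuous_on_compose2[OF Mcont[OF x y]])
    finally show ?thesis by (simp add: L2_def)
  qed
  have skew: "M x y s = - M y x (- s)" if x: "x \<in> Vect" and y: "y \<in> Vect" for x y s
  proof -
    let ?d = "\<lambda>\<theta>. deriv x (\<theta> + s) * y \<theta> + x (\<theta> + s) * deriv y \<theta>"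
    have "((\<lambda>\<theta>. x (\<theta> + s) * y \<theta>) has_vector_derivative ?d \<theta>) (at \<theta> within {0..2 * pi})" for \<theta>
      unfolding has_real_derivative_iff_has_vector_derivative[symmetric]
      by (rule has_field_derivative_at_within, rule DERIV_cong,
          rule DERIV_mult[OF DERIV_chain2[OF Vect_has_deriv[OF x]] Vect_has_deriv[OF y]])
        (auto intro!: derivative_eq_intros)
    then have "(?d has_integral x (2 * pi + s) * y (2 * pi) - x (0 + s) * y 0) {0..2 * pi}"
      by (intro fundamental_theorem_of_calculus) auto
    then have "integral {0..2 * pi} ?d = 0"
      using Vect_periodic[OF x, of s] Vect_periodic[OF y, of 0]
      by (simp add: integral_unique add.commute)
    moreover have "integral {0..2 * pi} ?d =
        M x y s + integral {0..2 * pi} (\<lambda>\<theta>. x (\<theta> + s) * deriv y \<theta>)"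
      unfolding M_def
      by (intro Henstock_Kurzweil_Integration.integral_add integrable_continuous_interval
          continuous_on_mult c[OF Vect_intros(5)[OF x]] c[OF Vect_intros(5)[OF y]]
          c[OF x] c[OF y] continuous_on_add continuous_on_id continuous_on_const)
    moreover have "integral {0..2 * pi} (\<lambda>\<theta>. x (\<theta> + s) * deriv y \<theta>) = M y x (- s)"
      using integral_circle_shift[of "\<lambda>\<theta>. x (\<theta> + s) * deriv y \<theta>" "- s"]
        Vect_periodic[OF x, of "_ + s"] Vect_periodic[OF Vect_intros(5)[OF y]]
        continuous_on_mult[OF c[OF x, of UNIV "\<lambda>\<theta>. \<theta> + s"] Vect_continuous[OF Vect_intros(5)[OF y]]]
      by (simp add: M_def algebra_simps continuous_intros)
    ultimately show ?thesis by simp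
  qed
  have refl: "integral {-1..1} (\<lambda>\<sigma>. f (s * - \<sigma>)) = integral {-1..1} (\<lambda>\<sigma>. f (s * \<sigma>))"
    for f :: "real \<Rightarrow> real" and s
    using Henstock_Kurzweil_Integration.integral_reflect_real[of 1 "-1" "\<lambda>\<sigma>. f (s * \<sigma>)"] by simp
  have "integral {-1..1} (\<lambda>\<sigma>. hilbert_kernel s * M x y (s * \<sigma>)) =
      - integral {-1..1} (\<lambda>\<sigma>. hilbert_kernel s * M y x (s * \<sigma>))" for s
    using refl[of "\<lambda>r. hilbert_kernel s * M y x r" s] by (simp add: skew[OF x y])
  then show ?thesis
    by (simp add: swap[OF x y] swap[OF y x] L2_commute[of x])
qed

section \<open>Fourier coefficients and the Moebius algebra\<close>

definition mob :: "real \<Rightarrow> complex \<Rightarrow> real \<Rightarrow> real" where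
  "mob a w \<theta> = a + 2 * Re (w * cis \<theta>)"

lemma mob_complex: "complex_of_real a + w * cis \<theta> + cnj w * cis (- \<theta>) = complex_of_real (mob a w \<theta>)"
  by (simp add: mob_def complex_eq_iff)

lemma mob_algebra_iff: "x \<in> \<mm> \<longleftrightarrow> (\<exists>a w. x = mob a w)"
  by (auto simp: mob_algebra_def mob_complex fun_eq_iff simp del: of_real_add of_real_mult)

lemma mob_in_algebra [simp]: "mob a w \<in> \<mm>"
  by (auto simp: mob_algebra_iff)

lemma cis_has_derivative:
  "((\<lambda>\<theta>. cis (r * \<theta>)) has_vector_derivative (\<i> * r) * cis (r * \<theta>)) (at \<theta> within S)"
proof -
  have "((\<lambda>\<theta>. r * \<theta>) has_vector_derivative r) (at \<theta> within S)"
    by (auto intro!: derivative_eq_intros)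
  moreover have "(cis has_vector_derivative \<i> * cis (r * \<theta>)) (at (r * \<theta>) within (\<lambda>\<theta>. r * \<theta>) ` S)"
    using has_derivative_cis[of "\<lambda>x. x" "\<lambda>x. x" "r * \<theta>"]
    by (auto simp: has_vector_derivative_def cis_conv_exp scaleR_conv_of_real intro!: derivative_eq_intros ext)
  ultimately have "(cis \<circ> (\<lambda>\<theta>. r * \<theta>) has_vector_derivative r *\<^sub>R (\<i> * cis (r * \<theta>))) (at \<theta> within S)"
    by (rule vector_diff_chain_within)
  moreover have "r *\<^sub>R (\<i> * cis (r * \<theta>)) = (\<i> * r) * cis (r * \<theta>)"
    by (simp add: scaleR_conv_of_real mult.left_commute)
  ultimately show ?thesis by (simp add: o_def)
qed

lemma smooth_cis: "smooth (\<lambda>\<theta>. cis (r * \<theta>))"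
  unfolding smooth_def
  by (rule exI[of _ "\<lambda>k \<theta>. (\<i> * r) ^ k * cis (r * \<theta>)"])
    (auto intro!: derivative_eq_intros cis_has_derivative[THEN has_vector_derivative_eq_rhs])

lemma smooth_family_cis: "smooth_family (\<lambda>t \<theta>. cis (r * \<theta>))"
  using smooth_cis by (simp add: smooth_iff_constant_family)

lemma smooth_family_mob:
  assumes "smooth_family (\<lambda>t \<theta>. a t)" "smooth_family (\<lambda>t \<theta>. w t)"
  shows "(\<lambda>t. mob (a t) (w t)) \<in> curves Vect"
proof -
  have "smooth_family (\<lambda>t \<theta>. Re (w t * cis (1 * \<theta>)))"
    by (intro smooth_family_bounded_linear[OF _ bounded_linear_Re] smooth_family_mult smooth_family_cis assms)
  then have "smooth_family (\<lambda>t \<theta>. a t + 2 * Re (w t * cis (1 * \<theta>)))"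
    by (intro smooth_family_add smooth_family_mult smooth_family_const assms)
  moreover have "cis (\<theta> + 2 * pi) = cis \<theta>" for \<theta>
    by (simp add: complex_eq_iff)
  ultimately show ?thesis by (simp add: curves_Vect_iff mob_def[abs_def])
qed

lemma mob_Vect [simp]: "mob a w \<in> Vect"
  using curves_slice_zero[OF smooth_family_mob[OF smooth_family_const smooth_family_const]] .

lemma mob_algebra_Vect: "x \<in> \<mm> \<Longrightarrow> x \<in> Vect"
  by (auto simp: mob_algebra_iff)

lemma curves_mob_Vect: "x \<in> curves \<mm> \<Longrightarrow> x \<in> curves Vect"
  by (auto simp: curves_def mob_algebra_Vect)

lemma deriv_mob: "deriv (mob a w) = mob 0 (\<i> * w)"
proof
  fix \<theta>
  have "(mob a w has_real_derivative mob 0 (\<i> * w) \<theta>) (at \<theta>)"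
    unfolding mob_def[abs_def] by (auto intro!: derivative_eq_intros simp: algebra_simps)
  then show "deriv (mob a w) \<theta> = mob 0 (\<i> * w) \<theta>" by (rule DERIV_imp_deriv)
qed

lemma integral_cis_circle:
  assumes "k \<noteq> 0" shows "integral {0..2 * pi} (\<lambda>\<theta>. cis (of_int k * \<theta>)) = 0"
proof -
  have "((\<lambda>\<theta>. (\<i> * of_real (of_int k)) * cis (of_int k * \<theta>)) has_integral cis (of_int k * (2 * pi)) - cis (of_int k * 0)) {0..2 * pi}"
    by (intro fundamental_theorem_of_calculus cis_has_derivative) auto
  moreover have "cis (of_int k * (2 * pi)) = 1"
    using cis_multiple_2pi[of "of_int k"] by (simp add: mult_ac)
  ultimately have "((\<lambda>\<theta>. (\<i> * of_real (of_int k)) * cis (of_int k * \<theta>)) has_integral 0) {0..2 * pi}"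
    by simp
  from integral_unique[OF this]
  have "(\<i> * of_real (of_int k)) * integral {0..2 * pi} (\<lambda>\<theta>. cis (of_int k * \<theta>)) = 0"
    by (simp only: Henstock_Kurzweil_Integration.integral_mult_right)
  then show ?thesis using assms by simp
qed

lemma Vect_cis_integrable:
  "x \<in> Vect \<Longrightarrow> (\<lambda>\<theta>. complex_of_real (x \<theta>) * cis (r * \<theta>)) integrable_on {a..b}"
  by (intro integrable_continuous_interval continuous_intros Vect_continuous)

lemma L2_cis:
  assumes x: "x \<in> Vect"
  shows "L2 x (\<lambda>\<theta>. 2 * Re (w * cis (real n * \<theta>))) = 2 * Re (cnj w * fourier_coeff n x)"
proof -
  let ?f = "\<lambda>\<theta>. complex_of_real (x \<theta>) * cis (- real n * \<theta>)"
  have "bounded_linear (\<lambda>z. Re (cnj w * z))"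
    by (rule bounded_linear_compose[OF bounded_linear_Re bounded_linear_mult_right])
  from integral_linear[OF Vect_cis_integrable[OF x, of "- real n" 0 "2 * pi"] this]
  have "integral {0..2 * pi} (\<lambda>\<theta>. Re (cnj w * ?f \<theta>)) = Re (cnj w * integral {0..2 * pi} ?f)"
    by (simp add: o_def)
  moreover have "Re (cnj w * ?f \<theta>) = x \<theta> * Re (w * cis (real n * \<theta>))" for \<theta>
    by (simp add: algebra_simps)
  ultimately have e1: "integral {0..2 * pi} (\<lambda>\<theta>. x \<theta> * Re (w * cis (real n * \<theta>))) =
      Re (cnj w * integral {0..2 * pi} ?f)" by simp
  have e0: "integral {0..2 * pi} (\<lambda>\<theta>. x \<theta> * (2 * Re (w * cis (real n * \<theta>)))) =
      2 * integral {0..2 * pi} (\<lambda>\<theta>. x \<theta> * Re (w * cis (real n * \<theta>)))"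
    by (simp only: mult.left_commute[of _ 2] Henstock_Kurzweil_Integration.integral_mult_right)
  have e2: "Re (cnj w * fourier_coeff n x) = Re (cnj w * integral {0..2 * pi} ?f) / (2 * pi)"
  proof -
    have "cnj w * fourier_coeff n x = cnj w * integral {0..2 * pi} ?f / of_real (2 * pi)"
      by (simp add: fourier_coeff_def)
    then show ?thesis by (simp only: Re_divide_of_real)
  qed
  show ?thesis unfolding L2_def e0 e1 e2 by simp
qed

lemma L2_const: "L2 x (\<lambda>\<theta>. a) = a * eta0 x"
  by (simp add: L2_def eta0_def)

lemma L2_mob:
  assumes "x \<in> Vect" shows "L2 x (mob a w) = a * eta0 x + 2 * Re (cnj w * eta1 x)"
proof -
  have 1: "mob a w = (\<lambda>\<theta>. (\<lambda>\<theta>. a) \<theta> + mob 0 w \<theta>)" by (auto simp: mob_def)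
  have 2: "mob 0 w = (\<lambda>\<theta>. 2 * Re (w * cis (real 1 * \<theta>)))" by (auto simp: mob_def)
  have "L2 x (mob a w) = L2 x (\<lambda>\<theta>. a) + L2 x (mob 0 w)"
    by (subst 1, rule L2_add_right) (auto intro: assms Vect_intros)
  also have "L2 x (mob 0 w) = 2 * Re (cnj w * eta1 x)"
    unfolding 2 by (rule L2_cis[OF assms])
  finally show ?thesis by (simp add: L2_const)
qed

lemma ker_eta_Vect: "x \<in> \<dd> \<Longrightarrow> x \<in> Vect" by (simp add: ker_eta_def)

lemma curves_ker_Vect: "x \<in> curves \<dd> \<Longrightarrow> x \<in> curves Vect"
  by (auto simp: curves_def ker_eta_Vect)

lemma eta_eqI:
  assumes x: "x \<in> Vect" and *: "\<And>b z. L2 x (mob b z) = 2 * Re (cnj z * c)"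
  shows "eta0 x = 0 \<and> eta1 x = c"
proof -
  have "eta0 x = 0" using *[of 1 0] by (simp add: L2_mob[OF x])
  moreover have "Re (eta1 x) = Re c" using *[of 0 1] by (simp add: L2_mob[OF x])
  moreover have "Im (eta1 x) = Im c" using *[of 0 \<i>] by (simp add: L2_mob[OF x])
  ultimately show ?thesis by (simp add: complex_eq_iff)
qed

lemma ker_eta_iff: "x \<in> \<dd> \<longleftrightarrow> x \<in> Vect \<and> (\<forall>a w. L2 x (mob a w) = 0)"
  using eta_eqI[of x 0] by (auto simp: ker_eta_def L2_mob)

lemma L2_ker_mob: "x \<in> \<dd> \<Longrightarrow> y \<in> \<mm> \<Longrightarrow> L2 x y = 0"
  by (auto simp: ker_eta_iff mob_algebra_iff)

lemma
  shows eta0_mob: "eta0 (mob a w) = a" and eta1_mob: "eta1 (mob a w) = w"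
proof -
  have c: "(\<lambda>\<theta>. c * cis (r * \<theta>)) integrable_on {0..2 * pi}" for r c
    by (intro integrable_continuous_interval continuous_intros)
  have "mob 0 w = deriv (mob 0 (- \<i> * w))" by (simp only: deriv_mob) simp
  then have "integral {0..2 * pi} (mob 0 w) = 0"
    using integral_circle_deriv[of "mob 0 (- \<i> * w)"] by simp
  moreover have "integral {0..2 * pi} (\<lambda>\<theta>. a + mob 0 w \<theta>) =
      integral {0..2 * pi} (\<lambda>\<theta>. a) + integral {0..2 * pi} (mob 0 w)"
    by (intro Henstock_Kurzweil_Integration.integral_add Vect_integrable) (auto intro: Vect_intros)
  moreover have "mob a w = (\<lambda>\<theta>. a + mob 0 w \<theta>)" by (simp add: mob_def[abs_def])
  ultimately show "eta0 (mob a w) = a" by (simp add: eta0_def)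
  have m: "complex_of_real (mob a w \<theta>) * cis (- \<theta>) =
      complex_of_real a * cis (of_int (-1) * \<theta>) + (w + cnj w * cis (of_int (-2) * \<theta>))" for \<theta>
  proof -
    have "cis (- \<theta>) * cis (- \<theta>) = cis (- (2 * \<theta>))" "cis \<theta> * cis (- \<theta>) = 1"
      by (simp_all add: cis_mult)
    then show ?thesis
      by (simp add: mob_complex[symmetric] distrib_right mult.assoc del: cis_mult)
  qed
  have "integral {0..2 * pi} (\<lambda>\<theta>. complex_of_real a * cis (of_int (-1) * \<theta>) + (w + cnj w * cis (of_int (-2) * \<theta>)))
     = of_real (2 * pi) * w"
    by (subst Henstock_Kurzweil_Integration.integral_add,
        (intro c integrable_add integrable_const_ivl)+,
        subst Henstock_Kurzweil_Integration.integral_add, (intro c integrable_const_ivl)+)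
      (use integral_cis_circle[of "-1"] integral_cis_circle[of "-2"] in \<open>simp add: scaleR_conv_of_real\<close>)
  then show "eta1 (mob a w) = w" by (simp add: fourier_coeff_def m)
qed

lemma smooth_family_eta0: "u \<in> curves Vect \<Longrightarrow> smooth_family (\<lambda>t \<theta>. eta0 (u t))"
  unfolding eta0_def
  by (intro smooth_family_mult smooth_family_const smooth_family_circle_integral curves_smooth_family)

lemma
  assumes u: "u \<in> curves Vect"
  shows smooth_family_fourier: "smooth_family (\<lambda>t \<theta>. fourier_coeff n (u t))"
    and fourier_has_time_deriv: "t \<in> {0..1} \<Longrightarrow>
      ((\<lambda>t. fourier_coeff n (u t)) has_vector_derivative fourier_coeff n (time_deriv u t)) (at t within {0..1})"
proof -
  let ?f = "\<lambda>u t \<theta>. complex_of_real (u t \<theta>) * cis (- real n * \<theta>)"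
  have us: "smooth_family u" using u by (rule curves_smooth_family)
  have s: "smooth_family (?f u)"
    by (intro smooth_family_mult smooth_family_cis smooth_family_bounded_linear[OF us bounded_linear_of_real])
  from smooth_family_mult[OF smooth_family_const[of "1 / (2 * complex_of_real pi)"] smooth_family_circle_integral[OF s]]
  show "smooth_family (\<lambda>t \<theta>. fourier_coeff n (u t))" by (simp add: fourier_coeff_def)
  have "t_partial (?f u) (?f (time_deriv u))"
    unfolding t_partial_def
    using t_partialD[OF t_partial_time_deriv[OF us]]
    by (auto intro!: bounded_linear.has_vector_derivative[OF bounded_linear_mult_left]
        bounded_linear.has_vector_derivative[OF bounded_linear_of_real])
  from t_partialD[OF t_partial_circle_integral[OF s this]]
  have "((\<lambda>t. 1 / (2 * complex_of_real pi) * integral {0..2 * pi} (?f u t)) has_vector_derivative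
      1 / (2 * complex_of_real pi) * integral {0..2 * pi} (?f (time_deriv u) t)) (at t within {0..1})"
    if "t \<in> {0..1}"
    using that by (intro bounded_linear.has_vector_derivative[OF bounded_linear_mult_right])
  then show "t \<in> {0..1} \<Longrightarrow>
      ((\<lambda>t. fourier_coeff n (u t)) has_vector_derivative fourier_coeff n (time_deriv u t)) (at t within {0..1})"
    by (simp add: fourier_coeff_def)
qed

lemma eta0_has_time_deriv:
  assumes u: "u \<in> curves Vect" and t: "t \<in> {0..1}"
  shows "((\<lambda>t. eta0 (u t)) has_real_derivative eta0 (time_deriv u t)) (at t within {0..1})"
proof -
  have us: "smooth_family u" using u by (rule curves_smooth_family)
  from t_partialD[OF t_partial_circle_integral[OF us t_partial_time_deriv[OF us]] t]
  have "((\<lambda>t. integral {0..2 * pi} (u t)) has_real_derivative integral {0..2 * pi} (time_deriv u t)) (at t within {0..1})"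
    by (simp add: has_real_derivative_iff_has_vector_derivative)
  from DERIV_cmult[OF this, of "1 / (2 * pi)"] show ?thesis by (simp add: eta0_def)
qed

lemma time_deriv_mob:
  assumes "(a has_real_derivative a') (at t within {0..1})"
    and "(w has_vector_derivative w') (at t within {0..1})" and "t \<in> {0..1}"
  shows "time_deriv (\<lambda>t. mob (a t) (w t)) t = mob a' w'"
proof
  fix \<theta>
  show "time_deriv (\<lambda>t. mob (a t) (w t)) t \<theta> = mob a' w' \<theta>"
    unfolding mob_def
    by (rule time_deriv_eqI[OF _ assms(3)])
      (intro has_vector_derivative_add bounded_linear.has_vector_derivative[OF bounded_linear_mult_right]
        bounded_linear.has_vector_derivative[OF bounded_linear_Re]
        bounded_linear.has_vector_derivative[OF bounded_linear_mult_left]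
        assms(1)[unfolded has_real_derivative_iff_has_vector_derivative] assms(2))
qed

lemma mob_curve_coordinates:
  assumes "x \<in> curves \<mm>" "t \<in> {0..1}"
  shows "x t = mob (eta0 (x t)) (eta1 (x t))"
  using curves_slice[OF assms] unfolding mob_algebra_iff by (metis eta0_mob eta1_mob)

text \<open>The coordinates of a curve in the Moebius algebra are the values of the functionals \<open>\<eta>\<^sub>0\<close> and
  \<open>\<eta>\<^sub>1\<close>, which can be differentiated under the integral.\<close>

lemma time_deriv_mob_curve:
  assumes x: "x \<in> curves \<mm>" and t: "t \<in> {0..1}"
  shows "time_deriv x t \<in> \<mm>"
proof -
  have "time_deriv x t = time_deriv (\<lambda>t. mob (eta0 (x t)) (eta1 (x t))) t"
  proof
    fix \<theta>
    have "((\<lambda>s. mob (eta0 (x s)) (eta1 (x s)) \<theta>) has_vector_derivative time_deriv x t \<theta>) (at t within {0..1})"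
      by (rule has_vector_derivative_transform[OF t _ t_partialD[OF t_partial_time_deriv[OF curves_smooth_family[OF x]] t]])
        (simp only: mob_curve_coordinates[OF x, symmetric])
    then show "time_deriv x t \<theta> = time_deriv (\<lambda>t. mob (eta0 (x t)) (eta1 (x t))) t \<theta>"
      using t by (simp only: time_deriv_eqI)
  qed
  also have "\<dots> = mob (eta0 (time_deriv x t)) (eta1 (time_deriv x t))"
    by (intro time_deriv_mob eta0_has_time_deriv fourier_has_time_deriv curves_mob_Vect x t)
  finally show ?thesis by (metis mob_in_algebra)
qed

text \<open>For the generator \<open>e\<^sup>i\<^sup>\<theta>\<close> this is the identity
  \<open>(cis s - 1) cot (s / 2) = \<i> (cis s + 1)\<close>: the difference of the values cancels the pole of the cotangent.\<close>

lemma mob_cot: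
  assumes "sin (s / 2) \<noteq> 0"
  shows "(mob a w (\<theta> + s) - mob a w \<theta>) * (cos (s / 2) / sin (s / 2)) =
    mob (2 * Re (\<i> * w * cis \<theta>)) (\<i> * w) (\<theta> + s)"
proof -
  define d where "d = s / 2"
  have s: "s = 2 * d" by (simp add: d_def)
  have "(cis (2 * d) - 1) * of_real (cos d) = \<i> * (cis (2 * d) + 1) * of_real (sin d)"
  proof (rule complex_eqI)
    show "Re ((cis (2 * d) - 1) * of_real (cos d)) = Re (\<i> * (cis (2 * d) + 1) * of_real (sin d))"
      by (simp add: cos_double_sin sin_double power2_eq_square)
    show "Im ((cis (2 * d) - 1) * of_real (cos d)) = Im (\<i> * (cis (2 * d) + 1) * of_real (sin d))"
      by (simp add: cos_double_cos sin_double power2_eq_square)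
  qed
  then have "2 * Re (w * cis \<theta> * ((cis (2 * d) - 1) * of_real (cos d))) =
      2 * Re (w * cis \<theta> * (\<i> * (cis (2 * d) + 1) * of_real (sin d)))" by (simp only:)
  then have "(2 * Re (w * (cis \<theta> * cis (2 * d))) - 2 * Re (w * cis \<theta>)) * cos d =
      (2 * Re (\<i> * w * cis \<theta>) + 2 * Re (\<i> * w * (cis \<theta> * cis (2 * d)))) * sin d"
    by (simp add: algebra_simps)
  then show ?thesis using assms unfolding s
    by (simp add: mob_def divide_simps flip: cis_mult del: cis.sel)
qed

text \<open>Multiplication by the generators of the Moebius algebra shifts Fourier modes by at most one,
  and the modes of an element of \<open>\<dd>\<close> have absolute value at least two, so no mode changes its
  sign and the two sides agree. In terms of the integral, the difference of the two sides
  pairs \<open>f\<close> with \<open>(\<xi> (t) - \<xi> (\<theta>)) cot ((t - \<theta>) / 2)\<close>, which as a function of \<open>t\<close> lies in the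
  Moebius algebra.\<close>

lemma hilbert_mob_mult:
  assumes f: "f \<in> \<dd>"
  shows "hilbert (\<lambda>\<theta>. mob a w \<theta> * f \<theta>) \<theta> = mob a w \<theta> * hilbert f \<theta>"
proof -
  have fV: "f \<in> Vect" using f by (rule ker_eta_Vect)
  define m where "m = mob (2 * Re (\<i> * w * cis \<theta>)) (\<i> * w)"
  define g where "g t = f t * m t" for t
  let ?h = "\<lambda>\<theta>. mob a w \<theta> * f \<theta>"
  have hV: "?h \<in> Vect" and gV: "g \<in> Vect"
    unfolding g_def[abs_def] m_def by (auto intro!: Vect_intros fV)
  let ?F = "\<lambda>x s. hilbert_kernel s * hilbert_chord x \<theta> s"
  have cg: "continuous_on S (\<lambda>s. g (q s))" if "continuous_on S q" for S q
    using continuous_on_compose2[OF Vect_continuous[OF gV, of UNIV] that] by auto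
  have "integral {0..pi} (?F ?h) - mob a w \<theta> * integral {0..pi} (?F f) =
      integral {0..pi} (\<lambda>s. ?F ?h s - mob a w \<theta> * ?F f s)"
    using hV fV
    by (subst Henstock_Kurzweil_Integration.integral_diff)
      (auto intro!: integrable_continuous_interval continuous_on_mult_left hilbert_folded_continuous)
  also have "\<dots> = integral {0..pi} (\<lambda>s. g (\<theta> + s) + g (\<theta> - s))"
  proof (rule integral_spike[of "{0}"])
    fix s assume "s \<in> {0..pi} - {0}"
    then have s: "s \<noteq> 0" "sin (s / 2) > 0" by (auto intro!: sin_gt_zero)
    have e1: "g (\<theta> + s) = f (\<theta> + s) * ((mob a w (\<theta> + s) - mob a w \<theta>) * (cos (s / 2) / sin (s / 2)))"
      using mob_cot[of s a w \<theta>] s by (simp add: g_def m_def)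
    have "m (\<theta> - s) = - ((mob a w (\<theta> - s) - mob a w \<theta>) * (cos (s / 2) / sin (s / 2)))"
      using mob_cot[of "- s" a w \<theta>] s by (simp add: m_def)
    then have e2: "g (\<theta> - s) = - f (\<theta> - s) * ((mob a w (\<theta> - s) - mob a w \<theta>) * (cos (s / 2) / sin (s / 2)))"
      by (simp add: g_def)
    have e3: "?F x s = (x (\<theta> + s) - x (\<theta> - s)) * (cos (s / 2) / sin (s / 2))" if "x \<in> Vect" for x
      using s by (simp add: hilbert_chord[OF that, symmetric] hilbert_kernel_def)
    show "g (\<theta> + s) + g (\<theta> - s) = ?F ?h s - mob a w \<theta> * ?F f s"
      unfolding e1 e2 e3[OF hV] e3[OF fV]
      by (simp add: algebra_simps diff_divide_distrib add_divide_distrib)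
  qed auto
  also have "\<dots> = integral {0..pi} (\<lambda>s. g (\<theta> + s)) + integral {0..pi} (\<lambda>s. g (\<theta> - s))"
    by (intro Henstock_Kurzweil_Integration.integral_add integrable_continuous_interval cg continuous_intros)
  also have "integral {0..pi} (\<lambda>s. g (\<theta> - s)) = integral {-pi..0} (\<lambda>s. g (\<theta> + s))"
    using Henstock_Kurzweil_Integration.integral_reflect_real[of 0 "-pi" "\<lambda>s. g (\<theta> + s)"] by simp
  also have "integral {0..pi} (\<lambda>s. g (\<theta> + s)) + integral {-pi..0} (\<lambda>s. g (\<theta> + s)) =
      integral {-pi..pi} (\<lambda>s. g (\<theta> + s))"
    by (subst add.commute, rule Henstock_Kurzweil_Integration.integral_combine)
      (auto intro!: integrable_continuous_interval cg continuous_intros)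
  also have "\<dots> = integral {0..2 * pi} (\<lambda>s. g (s + (\<theta> - pi)))"
  proof -
    have c: "continuous_on {0 + - pi..2 * pi + - pi} (\<lambda>s. g (\<theta> + s))" by (intro cg continuous_intros)
    show ?thesis using integral_shift[OF c] by (simp add: o_def algebra_simps)
  qed
  also have "\<dots> = integral {0..2 * pi} g"
    using integral_circle_shift[of g "\<theta> - pi"] Vect_periodic[OF gV] Vect_continuous[OF gV] by simp
  also have "\<dots> = 0"
    using L2_ker_mob[OF f, of m] by (simp add: g_def[abs_def] m_def L2_def)
  finally show ?thesis
    by (simp add: hilbert_folded[OF hV] hilbert_folded[OF fV])
qed

section \<open>Invariance of the metric under the Moebius algebra\<close>

text \<open>The operator \<open>\<partial>\<^sup>3 + \<partial>\<close>, whose kernel is the Moebius algebra.\<close>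

definition mob_op :: "(real \<Rightarrow> real) \<Rightarrow> real \<Rightarrow> real" where
  "mob_op x \<theta> = deriv (deriv (deriv x)) \<theta> + deriv x \<theta>"

abbreviation momentum :: "(real \<Rightarrow> real) \<Rightarrow> real \<Rightarrow> real" where
  "momentum u \<equiv> L (-1) 1 (hilbert (deriv u))"

lemma momentum_eq: "u \<in> Vect \<Longrightarrow> momentum u = mob_op (hilbert u)"
  by (auto simp: L_def mob_op_def deriv_hilbert[symmetric])

lemma mob_op_curve: "x \<in> curves Vect \<Longrightarrow> (\<lambda>t. mob_op (x t)) \<in> curves Vect"
  unfolding mob_op_def by (intro curves_intros)

lemma mob_op_Vect: "x \<in> Vect \<Longrightarrow> mob_op x \<in> Vect"
  unfolding mob_op_def[abs_def] by (intro Vect_intros)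

lemma momentum_Vect: "u \<in> Vect \<Longrightarrow> momentum u \<in> Vect"
  by (simp add: momentum_eq mob_op_Vect hilbert_Vect)

lemma momentum_curve:
  assumes "u \<in> curves Vect" shows "(\<lambda>t. momentum (u t)) \<in> curves Vect"
  unfolding curves_def
proof (intro CollectI conjI ballI)
  have "smooth_family (\<lambda>t. mob_op (hilbert (u t)))"
    by (intro curves_smooth_family[OF mob_op_curve] hilbert_curve assms)
  then show "smooth_family (\<lambda>t. momentum (u t))"
    by (rule smooth_family_cong) (simp add: momentum_eq curves_slice[OF assms])
  show "momentum (u t) \<in> Vect" if "t \<in> {0..1}" for t
    using curves_slice[OF assms that] by (rule momentum_Vect)
qed

lemma time_deriv_add:
  fixes x y :: "real \<Rightarrow> real \<Rightarrow> real"
  assumes "smooth_family x" "smooth_family y" "t \<in> {0..1}"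
  shows "time_deriv (\<lambda>t \<theta>. x t \<theta> + y t \<theta>) t \<theta> = time_deriv x t \<theta> + time_deriv y t \<theta>"
  by (rule time_deriv_eqI[OF _ assms(3)])
    (intro has_vector_derivative_add t_partialD[OF t_partial_time_deriv] assms)

lemma time_deriv_mob_op:
  assumes x: "x \<in> curves Vect" and t: "t \<in> {0..1}"
  shows "time_deriv (\<lambda>t. mob_op (x t)) t = mob_op (time_deriv x t)"
proof
  fix \<theta>
  have s: "smooth_family x" using x by (rule curves_smooth_family)
  have d: "time_deriv (\<lambda>t. deriv (y t)) s = deriv (time_deriv y s)" if "smooth_family y" "s \<in> {0..1}"
    for y :: "real \<Rightarrow> real \<Rightarrow> real" and s
    using that by (rule deriv_time_deriv)
  have "time_deriv (\<lambda>t. mob_op (x t)) t \<theta> =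
      time_deriv (\<lambda>t. deriv (deriv (deriv (x t)))) t \<theta> + time_deriv (\<lambda>t. deriv (x t)) t \<theta>"
    unfolding mob_op_def[abs_def]
    by (intro time_deriv_add smooth_family_deriv s t)
  then show "time_deriv (\<lambda>t. mob_op (x t)) t \<theta> = mob_op (time_deriv x t) \<theta>"
    using d[OF smooth_family_deriv[OF smooth_family_deriv[OF s]] t] d[OF smooth_family_deriv[OF s] t] d[OF s t]
    by (simp add: mob_op_def)
qed

lemma time_deriv_momentum:
  assumes u: "u \<in> curves Vect" and t: "t \<in> {0..1}"
  shows "time_deriv (\<lambda>t. momentum (u t)) t = momentum (time_deriv u t)"
proof
  fix \<theta>
  have "((\<lambda>s. momentum (u s) \<theta>) has_vector_derivative time_deriv (\<lambda>t. mob_op (hilbert (u t))) t \<theta>) (at t within {0..1})"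
    by (rule has_vector_derivative_transform[OF t _ t_partialD[OF t_partial_time_deriv
              [OF curves_smooth_family[OF mob_op_curve[OF hilbert_curve[OF u]]]] t]])
      (simp add: momentum_eq curves_slice[OF u])
  then have "time_deriv (\<lambda>t. momentum (u t)) t \<theta> = time_deriv (\<lambda>t. mob_op (hilbert (u t))) t \<theta>"
    using t by (rule time_deriv_eqI)
  then show "time_deriv (\<lambda>t. momentum (u t)) t \<theta> = momentum (time_deriv u t) \<theta>"
    using curves_slice[OF curves_time_deriv[OF u] t]
    by (simp add: time_deriv_mob_op[OF hilbert_curve[OF u] t] time_deriv_hilbert[OF u t] momentum_eq)
qed

lemma mob_op_skew:
  assumes "x \<in> Vect" "y \<in> Vect" shows "L2 (mob_op x) y = - L2 x (mob_op y)"
  using assms unfolding mob_op_def[abs_def]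
  by (simp add: L2_add_left L2_add_right L2_deriv_left Vect_intros)

lemma momentum_self_adjoint:
  assumes x: "x \<in> Vect" and y: "y \<in> Vect" shows "L2 (momentum x) y = L2 x (momentum y)"
proof -
  have 1: "L2 (deriv (hilbert x)) y = L2 x (deriv (hilbert y))" if "x \<in> Vect" "y \<in> Vect" for x y
    using that by (simp add: deriv_hilbert L2_hilbert_skew L2_deriv_left Vect_intros hilbert_Vect)
  have "L2 (deriv (deriv (deriv (hilbert x)))) y = L2 (deriv (hilbert x)) (deriv (deriv y))"
    using x y by (simp add: L2_deriv_left Vect_intros hilbert_Vect)
  also have "\<dots> = L2 x (deriv (deriv (deriv (hilbert y))))"
    using 1[OF x, of "deriv (deriv y)"] x y by (simp add: deriv_hilbert Vect_intros hilbert_Vect)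
  finally show ?thesis
    using x y 1[OF x y] by (simp add: momentum_eq mob_op_def[abs_def] L2_add_left L2_add_right Vect_intros hilbert_Vect)
qed

lemma mob_op_mob: "mob_op (mob a w) = (\<lambda>\<theta>. 0)"
  by (auto simp: mob_op_def deriv_mob mob_def)

lemma momentum_ker:
  assumes u: "u \<in> Vect" shows "momentum u \<in> \<dd>"
  unfolding ker_eta_iff
  using u by (simp add: momentum_eq mob_op_Vect hilbert_Vect mob_op_skew mob_op_mob L2_commute[of _ "\<lambda>_. 0"])

text \<open>The form \<open>\<langle>(\<partial>\<^sup>3 + \<partial>) x, y\<rangle>\<close> is the Gelfand-Fuchs cocycle. It vanishes if one argument lies in the
  Moebius algebra, so the cocycle identity makes \<open>\<partial>\<^sup>3 + \<partial>\<close> intertwine the adjoint and the coadjoint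
  action of that algebra.\<close>

lemma mob_op_bracket:
  assumes v: "v \<in> Vect"
  shows "mob_op (bracket v (mob a w)) = ad_transpose (mob a w) (mob_op v)"
proof
  fix \<theta>
  let ?x = "mob a w" and ?y = "mob 0 (\<i> * w)"
  let ?v1 = "deriv v" and ?v2 = "deriv (deriv v)" and ?v3 = "deriv (deriv (deriv v))"
    and ?v4 = "deriv (deriv (deriv (deriv v)))"
  have dv: "(v has_real_derivative ?v1 \<theta>) (at \<theta>)" "(?v1 has_real_derivative ?v2 \<theta>) (at \<theta>)"
    "(?v2 has_real_derivative ?v3 \<theta>) (at \<theta>)" "(?v3 has_real_derivative ?v4 \<theta>) (at \<theta>)" for \<theta>
    by (intro Vect_has_deriv Vect_intros v)+
  have m: "mob 0 (- w) \<theta> = a - mob a w \<theta>" for \<theta>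
    by (simp add: mob_def algebra_simps)
  have dx: "(?x has_real_derivative ?y \<theta>) (at \<theta>)" "(?y has_real_derivative a - ?x \<theta>) (at \<theta>)" for \<theta>
    using Vect_has_deriv[OF mob_Vect[of a w], of \<theta>] Vect_has_deriv[OF mob_Vect[of 0 "\<i> * w"], of \<theta>]
    by (simp_all add: deriv_mob m)
  have b: "bracket v ?x = (\<lambda>\<theta>. ?v1 \<theta> * ?x \<theta> - v \<theta> * ?y \<theta>)"
    by (simp add: bracket_def deriv_mob)
  have b1: "deriv (bracket v ?x) = (\<lambda>\<theta>. ?v2 \<theta> * ?x \<theta> - v \<theta> * (a - ?x \<theta>))"
    unfolding b by (intro ext DERIV_imp_deriv) (auto intro!: derivative_eq_intros dv dx)
  have b2: "deriv (deriv (bracket v ?x)) = (\<lambda>\<theta>. ?v3 \<theta> * ?x \<theta> + ?v2 \<theta> * ?y \<theta> - ?v1 \<theta> * (a - ?x \<theta>) + v \<theta> * ?y \<theta>)"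
    unfolding b1 by (intro ext DERIV_imp_deriv) (auto intro!: derivative_eq_intros dv dx)
  have b3: "deriv (deriv (deriv (bracket v ?x))) = (\<lambda>\<theta>. ?v4 \<theta> * ?x \<theta> + 2 * ?v3 \<theta> * ?y \<theta> + 2 * ?v1 \<theta> * ?y \<theta>
      + v \<theta> * (a - ?x \<theta>))"
    unfolding b2
    by (intro ext DERIV_imp_deriv) (auto intro!: derivative_eq_intros dv dx simp: algebra_simps)
  have p: "deriv (mob_op v) \<theta> = ?v4 \<theta> + ?v2 \<theta>"
    unfolding mob_op_def[abs_def] by (intro DERIV_imp_deriv derivative_intros dv)
  show "mob_op (bracket v ?x) \<theta> = ad_transpose ?x (mob_op v) \<theta>"
    unfolding mob_op_def[of "bracket v ?x"]
    unfolding b3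
    unfolding b1
    by (simp add: ad_transpose_def p deriv_mob mob_op_def algebra_simps)
qed

lemma hilbert_bracket_mob:
  assumes u: "u \<in> \<dd>"
  shows "hilbert (bracket u (mob a w)) = bracket (hilbert u) (mob a w)"
proof
  fix \<theta>
  have uV: "u \<in> Vect" using u by (rule ker_eta_Vect)
  have du: "deriv u \<in> \<dd>"
    using u uV by (auto simp: ker_eta_iff Vect_intros L2_deriv_left deriv_mob)
  have "hilbert (bracket u (mob a w)) \<theta> =
      hilbert (\<lambda>\<theta>. mob a w \<theta> * deriv u \<theta> - mob 0 (\<i> * w) \<theta> * u \<theta>) \<theta>"
    by (simp add: bracket_def deriv_mob mult.commute)
  also have "\<dots> = hilbert (\<lambda>\<theta>. mob a w \<theta> * deriv u \<theta>) \<theta> - hilbert (\<lambda>\<theta>. mob 0 (\<i> * w) \<theta> * u \<theta>) \<theta>"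
    by (intro hilbert_diff Vect_intros uV mob_Vect)
  also have "\<dots> = mob a w \<theta> * hilbert (deriv u) \<theta> - mob 0 (\<i> * w) \<theta> * hilbert u \<theta>"
    by (simp only: hilbert_mob_mult u du)
  also have "\<dots> = bracket (hilbert u) (mob a w) \<theta>"
    by (simp add: bracket_def deriv_mob deriv_hilbert[OF uV])
  finally show "hilbert (bracket u (mob a w)) \<theta> = bracket (hilbert u) (mob a w) \<theta>" .
qed

lemma bracket_skew: "bracket x y = (\<lambda>\<theta>. - bracket y x \<theta>)"
  by (auto simp: bracket_def)

text \<open>The Weil-Petersson form descends to the homogeneous space, so it is invariant under the adjoint
  action of the Moebius algebra: the pairing of \<open>[u, \<xi>]\<close> with the momentum of \<open>u\<close> equals its own
  negative.\<close>

lemma ad_transpose_momentum_ker: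
  assumes u: "u \<in> \<dd>"
  shows "ad_transpose u (momentum u) \<in> \<dd>"
proof -
  have uV: "u \<in> Vect" using u by (rule ker_eta_Vect)
  have "L2 (ad_transpose u (momentum u)) (mob a w) = 0" for a w
  proof -
    let ?x = "mob a w"
    have bV: "bracket u ?x \<in> Vect" by (intro bracket_Vect uV mob_Vect)
    have "L2 (momentum u) (bracket u ?x) = L2 u (momentum (bracket u ?x))"
      by (intro momentum_self_adjoint uV bV)
    also have "momentum (bracket u ?x) = ad_transpose ?x (momentum u)"
      using uV u by (simp add: momentum_eq bV hilbert_bracket_mob mob_op_bracket hilbert_Vect)
    also have "L2 u \<dots> = L2 (momentum u) (bracket ?x u)"
      using L2_bracket_adjoint[OF mob_Vect[of a w] uV momentum_Vect[OF uV]] by (simp add: L2_commute)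
    also have "\<dots> = - L2 (momentum u) (bracket u ?x)"
      by (subst bracket_skew) (simp add: L2_def)
    finally have "L2 (momentum u) (bracket u ?x) = 0" by simp
    then show ?thesis
      using L2_bracket_adjoint[OF uV mob_Vect momentum_Vect[OF uV]] by simp
  qed
  then show ?thesis
    by (simp add: ker_eta_iff ad_transpose_Vect momentum_Vect uV)
qed

text \<open>For \<open>\<xi>\<close> and \<open>\<zeta>\<close> in the Moebius algebra only the modes of order two of \<open>\<xi>' \<zeta> + 2 \<xi> \<zeta>'\<close> contribute
  to the pairing with an element of \<open>\<dd>\<close>. Since the coefficient \<open>3 \<i> w z\<close> of that mode is
  symmetric, the bracket and its transpose have the same component in the Moebius algebra.\<close>

lemma L2_ad_transpose_mob:
  assumes u: "u \<in> \<dd>"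
  shows "L2 (ad_transpose u (mob a w)) (mob b z) = 2 * Re (cnj z * (3 * \<i> * cnj w * fourier_coeff 2 u))"
proof -
  have uV: "u \<in> Vect" using u by (rule ker_eta_Vect)
  let ?x = "mob a w" and ?z = "mob b z"
  let ?k = "\<lambda>\<theta>. 2 * Re (3 * \<i> * w * z * cis (real 2 * \<theta>))"
  let ?m = "mob (2 * Re (\<i> * w * cnj z)) (- \<i> * (w * of_real b + 2 * of_real a * z))"
  have kV: "?k \<in> Vect"
  proof -
    have "smooth_family (\<lambda>t \<theta>. 2 * Re (3 * \<i> * w * z * cis (real 2 * \<theta>)))"
      by (intro smooth_family_mult smooth_family_const smooth_family_cis
          smooth_family_bounded_linear[OF _ bounded_linear_Re])
    moreover have "cis (real 2 * (\<theta> + 2 * pi)) = cis (real 2 * \<theta>)" for \<theta>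
      using cos_periodic[of "2 * \<theta>"] sin_periodic[of "2 * \<theta>"] cos_periodic[of "2 * \<theta> + 2 * pi"] sin_periodic[of "2 * \<theta> + 2 * pi"]
      by (simp add: complex_eq_iff algebra_simps)
    ultimately show ?thesis
      unfolding Vect_def smooth_iff_constant_family by (simp only: mem_Collect_eq simp_thms)
  qed
  have b: "bracket u ?z = (\<lambda>\<theta>. deriv u \<theta> * ?z \<theta> - u \<theta> * deriv ?z \<theta>)" by (simp add: bracket_def)
  have "L2 (ad_transpose u ?x) ?z = L2 ?x (bracket u ?z)"
    using L2_bracket_adjoint[OF uV mob_Vect mob_Vect] by simp
  also have "\<dots> = L2 (deriv u) (\<lambda>\<theta>. ?x \<theta> * ?z \<theta>) - L2 u (\<lambda>\<theta>. ?x \<theta> * deriv ?z \<theta>)"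
    unfolding b
    using L2_diff_right[of "\<lambda>\<theta>. deriv u \<theta> * ?z \<theta>" "\<lambda>\<theta>. u \<theta> * deriv ?z \<theta>" ?x] uV
    by (simp add: Vect_intros) (simp add: L2_def mult_ac)
  also have "L2 (deriv u) (\<lambda>\<theta>. ?x \<theta> * ?z \<theta>) = - L2 u (\<lambda>\<theta>. deriv ?x \<theta> * ?z \<theta> + ?x \<theta> * deriv ?z \<theta>)"
    using L2_deriv_left[OF uV, of "\<lambda>\<theta>. ?x \<theta> * ?z \<theta>"]
    by (simp add: Vect_intros deriv_mult_Vect[OF mob_Vect[of a w] mob_Vect[of b z], abs_def])
  also have "\<dots> - L2 u (\<lambda>\<theta>. ?x \<theta> * deriv ?z \<theta>) =
      - (L2 u (\<lambda>\<theta>. deriv ?x \<theta> * ?z \<theta> + ?x \<theta> * deriv ?z \<theta>) + L2 u (\<lambda>\<theta>. ?x \<theta> * deriv ?z \<theta>))" by simp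
  also have "L2 u (\<lambda>\<theta>. deriv ?x \<theta> * ?z \<theta> + ?x \<theta> * deriv ?z \<theta>) + L2 u (\<lambda>\<theta>. ?x \<theta> * deriv ?z \<theta>) =
      L2 u (\<lambda>\<theta>. (deriv ?x \<theta> * ?z \<theta> + ?x \<theta> * deriv ?z \<theta>) + ?x \<theta> * deriv ?z \<theta>)"
    by (intro L2_add_right[symmetric] Vect_intros mob_Vect uV)
  also have "(\<lambda>\<theta>. (deriv ?x \<theta> * ?z \<theta> + ?x \<theta> * deriv ?z \<theta>) + ?x \<theta> * deriv ?z \<theta>) = (\<lambda>\<theta>. ?k \<theta> - ?m \<theta>)"
  proof
    fix \<theta> :: real
    obtain w1 w2 z1 z2 where w: "w = Complex w1 w2" and z: "z = Complex z1 z2" by (metis complex.exhaust)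
    have "cos (2 * \<theta>) = cos \<theta> * cos \<theta> - sin \<theta> * sin \<theta>" "sin (2 * \<theta>) = 2 * sin \<theta> * cos \<theta>"
      by (simp_all add: cos_double sin_double power2_eq_square)
    moreover have "cos \<theta> * cos \<theta> + sin \<theta> * sin \<theta> = 1"
      using sin_cos_squared_add[of \<theta>] by (simp add: power2_eq_square)
    ultimately show "(deriv ?x \<theta> * ?z \<theta> + ?x \<theta> * deriv ?z \<theta>) + ?x \<theta> * deriv ?z \<theta> = ?k \<theta> - ?m \<theta>"
      unfolding deriv_mob mob_def w z by (simp, algebra)
  qed
  also have "L2 u (\<lambda>\<theta>. ?k \<theta> - ?m \<theta>) = L2 u ?k"
    using L2_diff_right[OF kV mob_Vect uV] L2_ker_mob[OF u mob_in_algebra] by simp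
  also have "L2 u ?k = 2 * Re (cnj (3 * \<i> * w * z) * fourier_coeff 2 u)"
    by (rule L2_cis[OF uV])
  finally show ?thesis by (simp add: algebra_simps)
qed

lemma L2_bracket_mob:
  assumes "u \<in> \<dd>"
  shows "L2 (bracket u (mob a w)) (mob b z) = 2 * Re (cnj z * (3 * \<i> * cnj w * fourier_coeff 2 u))"
proof -
  have "L2 (bracket u (mob a w)) (mob b z) = L2 (ad_transpose u (mob b z)) (mob a w)"
    using L2_bracket_adjoint[OF ker_eta_Vect[OF assms] mob_Vect mob_Vect] by (simp add: L2_commute)
  also have "\<dots> = 2 * Re (cnj w * (3 * \<i> * cnj z * fourier_coeff 2 u))"
    by (rule L2_ad_transpose_mob[OF assms])
  also have "cnj w * (3 * \<i> * cnj z * fourier_coeff 2 u) = cnj z * (3 * \<i> * cnj w * fourier_coeff 2 u)"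
    by (simp only: mult_ac)
  finally show ?thesis .
qed

section \<open>Linear equations for curves in the Moebius algebra\<close>

text \<open>Picard iteration. The \<open>n\<close>-th correction is bounded by \<open>C (M t)\<^sup>n / n!\<close>, where \<open>M\<close> bounds \<open>p\<close>
  and \<open>C\<close> the initial guess, so the series of corrections converges uniformly on the whole of \<open>[0,1]\<close>.
  The equation is only real linear, because the unknown enters through its conjugate.\<close>

lemma conjugate_linear_ode:
  fixes p q :: "real \<Rightarrow> complex"
  assumes p: "continuous_on {0..1} p" and q: "continuous_on {0..1} q"
  obtains z where "z 0 = z0"
    "\<And>t. t \<in> {0..1} \<Longrightarrow> (z has_vector_derivative p t * cnj (z t) + q t) (at t within {0..1})"
proof -
  define Z where "Z n = ((\<lambda>f t. integral {0..t} (\<lambda>s. p s * cnj (f s))) ^^ n) (\<lambda>t. z0 + integral {0..t} q)" for n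
  have Z0: "Z 0 t = z0 + integral {0..t} q" for t by (simp add: Z_def)
  have ZS: "Z (Suc n) t = integral {0..t} (\<lambda>s. p s * cnj (Z n s))" for n t by (simp add: Z_def)
  have cont: "continuous_on {0..1} (Z n)" for n
  proof (induction n)
    case 0
    show ?case unfolding Z0[abs_def]
      by (intro continuous_intros indefinite_integral_continuous_1 integrable_continuous_interval q)
  next
    case (Suc n)
    then show ?case unfolding ZS[abs_def]
      by (intro indefinite_integral_continuous_1 integrable_continuous_interval continuous_intros p)
  qed
  have bound: "\<exists>B\<ge>0. \<forall>t\<in>{0..1}. norm (f t) \<le> B" if f: "continuous_on {0..1} f" for f :: "real \<Rightarrow> complex"
  proof -
    have "bounded (f ` {0..1})" by (intro compact_imp_bounded compact_continuous_image f) auto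
    then obtain B where B: "\<forall>t\<in>{0..1}. norm (f t) \<le> B" by (auto simp: bounded_iff)
    from bspec[OF B, of 0] have "0 \<le> B" using norm_ge_zero[of "f 0"] by (simp del: norm_ge_zero)
    with B show ?thesis by blast
  qed
  obtain M where M: "M \<ge> 0" "\<forall>t\<in>{0..1}. norm (p t) \<le> M" using bound[OF p] by blast
  obtain C where C: "C \<ge> 0" "\<forall>t\<in>{0..1}. norm (Z 0 t) \<le> C" using bound[OF cont] by blast
  have est: "t \<in> {0..1} \<Longrightarrow> norm (Z n t) \<le> C * (M * t) ^ n / fact n" for n t
  proof (induction n arbitrary: t)
    case 0 then show ?case using C by simp
  next
    case (Suc n)
    let ?F = "\<lambda>s. C * (M * s) ^ Suc n / fact (Suc n)" and ?f = "\<lambda>s. M * (C * (M * s) ^ n / fact n)"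
    have "(?F has_vector_derivative ?f s) (at s within {0..t})" for s
    proof -
      have "(?F has_real_derivative C * (real (Suc n) * (M * s) ^ n * M) / fact (Suc n)) (at s within {0..t})"
        by (rule DERIV_cong, rule DERIV_cdivide, rule DERIV_cmult, rule DERIV_power_Suc,
            rule DERIV_cmult[OF DERIV_ident]) simp
      moreover have "C * (real (Suc n) * (M * s) ^ n * M) / fact (Suc n) = ?f s"
        by (simp add: divide_simps del: of_nat_Suc)
      ultimately show ?thesis by (simp only: has_real_derivative_iff_has_vector_derivative)
    qed
    then have int: "(?f has_integral ?F t - ?F 0) {0..t}"
      using Suc.prems by (intro fundamental_theorem_of_calculus) auto
    have "norm (integral {0..t} (\<lambda>s. p s * cnj (Z n s))) \<le> integral {0..t} ?f"
    proof (rule integral_norm_bound_integral)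
      show "(\<lambda>s. p s * cnj (Z n s)) integrable_on {0..t}"
        using Suc.prems
        by (intro integrable_continuous_interval continuous_intros continuous_on_subset[OF p]
            continuous_on_subset[OF cont]) auto
      show "?f integrable_on {0..t}" using int by (rule has_integral_integrable)
      show "norm (p s * cnj (Z n s)) \<le> ?f s" if "s \<in> {0..t}" for s
        using that Suc.prems M Suc.IH[of s] mult_mono[of "norm (p s)" M "norm (Z n s)" "C * (M * s) ^ n / fact n"]
        by (simp add: norm_mult)
    qed
    then show ?case using integral_unique[OF int] by (simp add: ZS)
  qed
  define z where "z t = (\<Sum>n. Z n t)" for t
  have summ: "summable (\<lambda>n. C * M ^ n / fact n)"
    using summable_mult[OF summable_exp[of M], of C] by (simp add: field_simps)
  have unif: "uniform_limit {0..1} (\<lambda>n t. \<Sum>i<n. Z i t) z sequentially"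
    unfolding z_def[abs_def]
  proof (rule Weierstrass_m_test[OF _ summ])
    fix n and t :: real assume t: "t \<in> {0..1}"
    have "norm (Z n t) \<le> C * (M * t) ^ n / fact n" by (rule est[OF t])
    also have "\<dots> \<le> C * M ^ n / fact n"
      using t M C by (intro divide_right_mono mult_left_mono power_mono) (auto intro: mult_left_le)
    finally show "norm (Z n t) \<le> C * M ^ n / fact n" .
  qed
  have contS: "continuous_on {0..1} (\<lambda>t. \<Sum>i<n. Z i t)" for n
    by (intro continuous_on_sum cont)
  have contz: "continuous_on {0..1} z"
    by (rule uniform_limit_theorem[OF _ unif]) (auto intro!: always_eventually contS)
  have eq: "z t = z0 + integral {0..t} q + integral {0..t} (\<lambda>s. p s * cnj (z s))" if t: "t \<in> {0..1}" for t
  proof -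
    have sub: "{0..t} \<subseteq> {0..1}" using t by auto
    have c: "continuous_on {0..t} (\<lambda>s. p s * cnj (f s))" if "continuous_on {0..1} f" for f
      using sub that by (intro continuous_intros continuous_on_subset[OF p] continuous_on_subset[OF that])
    have "uniform_limit {0..t} (\<lambda>n s. \<Sum>i<n. Z i s) z sequentially"
      by (rule uniform_limit_on_subset[OF unif sub])
    then have uc: "uniform_limit {0..t} (\<lambda>n s. cnj (\<Sum>i<n. Z i s)) (\<lambda>s. cnj (z s)) sequentially"
      by (rule bounded_linear.uniform_limit[OF bounded_linear_cnj])
    have u: "uniform_limit {0..t} (\<lambda>n s. p s * cnj (\<Sum>i<n. Z i s)) (\<lambda>s. p s * cnj (z s)) sequentially"
      by (rule uniform_lim_mult[OF uniform_limit_const uc];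
          intro compact_imp_bounded compact_continuous_image continuous_on_cnj compact_Icc
            continuous_on_subset[OF p sub] continuous_on_subset[OF contz sub])
    have l1: "(\<lambda>n. integral {0..t} (\<lambda>s. p s * cnj (\<Sum>i<n. Z i s))) \<longlonglongrightarrow> integral {0..t} (\<lambda>s. p s * cnj (z s))"
    proof -
      obtain I J where IJ: "\<And>n. ((\<lambda>s. p s * cnj (\<Sum>i<n. Z i s)) has_integral I n) {0..t}"
        "((\<lambda>s. p s * cnj (z s)) has_integral J) {0..t}" "(I \<longlongrightarrow> J) sequentially"
        using uniform_limit_integral[OF u c[OF contS]] by auto
      from integral_unique[OF IJ(1)] integral_unique[OF IJ(2)] IJ(3) show ?thesis by simp
    qed
    have "integral {0..t} (\<lambda>s. p s * cnj (\<Sum>i<n. Z i s)) = (\<Sum>i<n. Z (Suc i) t)" for n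
    proof -
      have "integral {0..t} (\<lambda>s. p s * cnj (\<Sum>i<n. Z i s)) = integral {0..t} (\<lambda>s. \<Sum>i<n. p s * cnj (Z i s))"
        by (simp add: sum_distrib_left)
      also have "\<dots> = (\<Sum>i<n. integral {0..t} (\<lambda>s. p s * cnj (Z i s)))"
        by (intro Henstock_Kurzweil_Integration.integral_sum integrable_continuous_interval c[OF cont]) simp
      finally show ?thesis by (simp add: ZS)
    qed
    with l1 have "(\<lambda>n. Z 0 t + (\<Sum>i<n. Z (Suc i) t)) \<longlonglongrightarrow> Z 0 t + integral {0..t} (\<lambda>s. p s * cnj (z s))"
      by (intro tendsto_intros) simp
    then have "(\<lambda>n. \<Sum>i<Suc n. Z i t) \<longlonglongrightarrow> Z 0 t + integral {0..t} (\<lambda>s. p s * cnj (z s))"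
      by (simp only: sum.lessThan_Suc_shift)
    moreover have "(\<lambda>n. \<Sum>i<Suc n. Z i t) \<longlonglongrightarrow> z t"
      using tendsto_uniform_limitI[OF unif t] by (rule LIMSEQ_Suc)
    ultimately show ?thesis using LIMSEQ_unique Z0 by metis
  qed
  show thesis
  proof (rule that)
    show "z 0 = z0" using eq[of 0] by simp
    fix t :: real assume t: "t \<in> {0..1}"
    have "((\<lambda>t. z0 + integral {0..t} q + integral {0..t} (\<lambda>s. p s * cnj (z s))) has_vector_derivative
        0 + q t + p t * cnj (z t)) (at t within {0..1})"
      by (intro has_vector_derivative_add has_vector_derivative_const integral_has_vector_derivative
          continuous_intros p q contz t)
    then have "(z has_vector_derivative 0 + q t + p t * cnj (z t)) (at t within {0..1})"
      by (rule has_vector_derivative_transform[OF t, rotated]) (rule eq)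
    then show "(z has_vector_derivative p t * cnj (z t) + q t) (at t within {0..1})"
      by (simp add: add.commute)
  qed
qed

lemma smooth_family_time_continuous:
  "smooth_family (\<lambda>t \<theta>. p t) \<Longrightarrow> continuous_on {0..1} p"
  using jointly_cont_compose[OF smooth_family_jointly_cont, of "\<lambda>t \<theta>. p t" "{0..1}" "\<lambda>t. t" "\<lambda>t. 0"]
  by (simp add: continuous_intros)

text \<open>The equation expresses the derivative of a solution as a polynomial in the coefficients, the
  solution and its conjugate, so these generate a differentially closed algebra.\<close>

lemma conjugate_linear_ode_smooth:
  fixes p q z :: "real \<Rightarrow> complex"
  assumes p: "smooth_family (\<lambda>t \<theta>. p t)" and q: "smooth_family (\<lambda>t \<theta>. q t)"
    and z: "\<And>t. t \<in> {0..1} \<Longrightarrow> (z has_vector_derivative p t * cnj (z t) + q t) (at t within {0..1})"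
  shows "smooth_family (\<lambda>t \<theta>. z t)"
proof -
  let ?z = "\<lambda>(t :: real) (\<theta> :: real). z t" and ?y = "\<lambda>(t :: real) (\<theta> :: real). cnj (z t)"
  let ?B = "{?z, ?y} \<union> Collect smooth_family"
  note base = family_algebra.base
  have cnj: "smooth_family (\<lambda>t \<theta>. cnj (f t))" if "smooth_family (\<lambda>t \<theta>. f t)" for f
    by (rule smooth_family_bounded_linear[OF that bounded_linear_cnj])
  have z': "t_partial ?z (\<lambda>t \<theta>. p t * cnj (z t) + q t)"
    using z by (simp add: t_partial_def)
  have y': "t_partial ?y (\<lambda>t \<theta>. cnj (p t) * z t + cnj (q t))"
    unfolding t_partial_def
    using bounded_linear.has_vector_derivative[OF bounded_linear_cnj z] by simp
  have mz: "(\<lambda>t \<theta>. p t * cnj (z t) + q t) \<in> family_algebra ?B"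
    by (rule family_algebra.add[OF family_algebra.mult[OF base base] base]) (use p q in auto)
  have my: "(\<lambda>t \<theta>. cnj (p t) * z t + cnj (q t)) \<in> family_algebra ?B"
    by (rule family_algebra.add[OF family_algebra.mult[OF base base] base]) (use cnj[OF p] cnj[OF q] in auto)
  have zero: "(\<lambda>t \<theta>. 0) \<in> family_algebra ?B" by (rule base) simp
  have cz: "continuous_on {0..1} z"
    using z by (meson continuous_on_eq_continuous_within has_vector_derivative_continuous)
  show ?thesis
  proof (rule smooth_family_algebra[of _ ?B])
    show "?z \<in> family_algebra ?B" by (rule base) simp
    fix g assume "g \<in> ?B"
    then consider "g = ?z" | "g = ?y" | "smooth_family g" by auto
    note cases = this
    have cz2: "continuous_on ({0..1} \<times> (UNIV :: real set)) (\<lambda>p. z (fst p))"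
      by (rule continuous_on_compose2[OF cz]) (auto intro: continuous_intros)
    show "jointly_cont g"
      using cases cz2 smooth_family_jointly_cont
      by cases (auto simp: jointly_cont_def case_prod_unfold intro: continuous_on_cnj)
    show "\<exists>h\<in>family_algebra ?B. t_partial g h"
      using cases
    proof cases
      case 3
      from smooth_family_partials[OF this] show ?thesis by (metis CollectI base UnI2)
    qed (use z' y' mz my in blast)+
    show "\<exists>h\<in>family_algebra ?B. angle_partial g h"
      using cases
    proof cases
      case 3
      from smooth_family_partials[OF this] show ?thesis by (metis CollectI base UnI2)
    qed (use zero in \<open>auto simp: angle_partial_def intro!: bexI[of _ "\<lambda>t \<theta>. 0"]\<close>)
  qed
qed

section \<open>Orthogonal projection onto finitely many curves\<close>

text \<open>The weight vanishes at the ends of the time interval, so that the weighted integral is an ordinary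
  pairing with a variation that is fixed there.\<close>

definition weighted_inner :: "(real \<Rightarrow> real \<Rightarrow> real) \<Rightarrow> (real \<Rightarrow> real \<Rightarrow> real) \<Rightarrow> real" where
  "weighted_inner f g = integral {0..1} (\<lambda>t. t * (1 - t) * L2 (f t) (g t))"

lemma weighted_integrand_continuous:
  assumes "f \<in> curves Vect" "g \<in> curves Vect"
  shows "continuous_on {0..1} (\<lambda>t. t * (1 - t) * L2 (f t) (g t))"
  using DERIV_continuous_on[OF L2_has_time_deriv[OF assms]] by (intro continuous_intros)

lemma weighted_inner_commute: "weighted_inner f g = weighted_inner g f"
  by (simp add: weighted_inner_def L2_commute)

lemma weighted_inner_lin:
  assumes f: "f \<in> curves Vect" and g: "g \<in> curves Vect" and k: "k \<in> curves Vect"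
  shows "weighted_inner (\<lambda>t \<theta>. f t \<theta> - c * g t \<theta>) k = weighted_inner f k - c * weighted_inner g k"
proof -
  have "weighted_inner (\<lambda>t \<theta>. f t \<theta> - c * g t \<theta>) k =
      integral {0..1} (\<lambda>t. t * (1 - t) * L2 (f t) (k t) - c * (t * (1 - t) * L2 (g t) (k t)))"
    unfolding weighted_inner_def
  proof (rule integral_cong)
    fix t :: real assume t: "t \<in> {0..1}"
    have "L2 (\<lambda>\<theta>. f t \<theta> - c * g t \<theta>) (k t) = L2 (f t) (k t) - c * L2 (g t) (k t)"
      using L2_diff_left[OF curves_slice[OF f t] Vect_intros(3)[OF Vect_intros(4) curves_slice[OF g t]] curves_slice[OF k t]]
      by (simp add: L2_scale_left)
    then show "t * (1 - t) * L2 (\<lambda>\<theta>. f t \<theta> - c * g t \<theta>) (k t) =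
        t * (1 - t) * L2 (f t) (k t) - c * (t * (1 - t) * L2 (g t) (k t))"
      by (simp only: right_diff_distrib) simp
  qed
  also have "\<dots> = integral {0..1} (\<lambda>t. t * (1 - t) * L2 (f t) (k t)) -
      integral {0..1} (\<lambda>t. c * (t * (1 - t) * L2 (g t) (k t)))"
    by (intro Henstock_Kurzweil_Integration.integral_diff integrable_continuous_interval
        continuous_on_mult_left weighted_integrand_continuous f g k)
  finally show ?thesis by (simp add: weighted_inner_def)
qed

lemma weighted_inner_definite:
  assumes f: "f \<in> curves Vect" and 0: "weighted_inner f f = 0" and t: "t \<in> {0..1}"
  shows "f t \<theta> = 0"
proof -
  have "\<forall>t\<in>{0..1}. t * (1 - t) * L2 (f t) (f t) = 0"
    using 0 unfolding weighted_inner_def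
    by (subst (asm) integral_eq_0_iff)
      (auto intro!: weighted_integrand_continuous f mult_nonneg_nonneg L2_nonneg curves_slice[OF f])
  then have "L2 (f t) (f t) = 0" if "t \<in> {0<..<1}" for t
    using that by (auto dest!: bspec[of _ _ t])
  moreover have "continuous_on (closure {0<..<1}) (\<lambda>t. L2 (f t) (f t))"
    using DERIV_continuous_on[OF L2_has_time_deriv[OF f f]] by simp
  ultimately have "L2 (f t) (f t) = 0"
    using continuous_constant_on_closure[of "{0<..<1}" "\<lambda>t. L2 (f t) (f t)" 0 t] t by simp
  then show ?thesis using L2_self_zero[OF curves_slice[OF f t]] by blast
qed

lemma weighted_inner_degenerate:
  assumes f: "f \<in> curves Vect" and g: "g \<in> curves Vect" and 0: "weighted_inner g g = 0"
  shows "weighted_inner f g = 0"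
proof -
  have "weighted_inner f g = integral {0..1 :: real} (\<lambda>t. 0)"
    unfolding weighted_inner_def
    by (rule integral_cong) (simp add: L2_def weighted_inner_definite[OF g 0])
  then show ?thesis by simp
qed

definition projectable :: "(real \<Rightarrow> real \<Rightarrow> real) set \<Rightarrow> bool" where
  "projectable S \<longleftrightarrow> S \<subseteq> curves Vect \<and> (\<forall>s\<in>S. \<forall>s'\<in>S. \<forall>c. (\<lambda>t \<theta>. s t \<theta> - c * s' t \<theta>) \<in> S) \<and>
     (\<forall>r\<in>curves Vect. \<exists>s\<in>S. \<forall>k\<in>S. weighted_inner (\<lambda>t \<theta>. r t \<theta> - s t \<theta>) k = 0)"

lemma projectable_zero: "projectable {\<lambda>t \<theta>. 0}"
  by (auto simp: projectable_def curves_const weighted_inner_def L2_def)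

text \<open>A Gram-Schmidt step: the new direction is replaced by its component orthogonal to \<open>S\<close>. If that
  component is zero, the quotient \<open>c\<close> has the default value zero and the step adds nothing.\<close>

lemma projectable_insert:
  assumes S: "projectable S" and h: "h \<in> curves Vect"
  shows "projectable {\<lambda>t \<theta>. s t \<theta> + c * h t \<theta> | s c. s \<in> S}"
  unfolding projectable_def
proof (intro conjI ballI allI)
  let ?T = "{\<lambda>t \<theta>. s t \<theta> + c * h t \<theta> | s c. s \<in> S}"
  have SV: "s \<in> curves Vect" if "s \<in> S" for s using S that by (auto simp: projectable_def)
  have Sd: "(\<lambda>t \<theta>. s t \<theta> - c * s' t \<theta>) \<in> S" if "s \<in> S" "s' \<in> S" for s s' c
    using S that by (auto simp: projectable_def)
  have proj: "\<exists>s\<in>S. \<forall>k\<in>S. weighted_inner (\<lambda>t \<theta>. r t \<theta> - s t \<theta>) k = 0" if "r \<in> curves Vect" for r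
    using S that by (auto simp: projectable_def)
  have TI: "(\<lambda>t \<theta>. s t \<theta> + c * h t \<theta>) \<in> ?T" if "s \<in> S" for s c using that by blast
  show "?T \<subseteq> curves Vect" using h SV by (auto intro!: curves_intros)
  show "(\<lambda>t \<theta>. s t \<theta> - d * s' t \<theta>) \<in> ?T" if ss: "s \<in> ?T" "s' \<in> ?T" for s s' d
  proof -
    obtain a b c e where *: "s = (\<lambda>t \<theta>. a t \<theta> + c * h t \<theta>)" "s' = (\<lambda>t \<theta>. b t \<theta> + e * h t \<theta>)" "a \<in> S" "b \<in> S"
      using ss by blast
    have "(\<lambda>t \<theta>. s t \<theta> - d * s' t \<theta>) = (\<lambda>t \<theta>. (\<lambda>t \<theta>. a t \<theta> - d * b t \<theta>) t \<theta> + (c - d * e) * h t \<theta>)"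
      by (simp add: * algebra_simps)
    then show ?thesis using TI[OF Sd[OF *(3,4), of d], of "c - d * e"] by (simp only:)
  qed
  show "\<exists>s\<in>?T. \<forall>k\<in>?T. weighted_inner (\<lambda>t \<theta>. r t \<theta> - s t \<theta>) k = 0" if r: "r \<in> curves Vect" for r
  proof -
    obtain s0 where s0: "s0 \<in> S" "\<And>k. k \<in> S \<Longrightarrow> weighted_inner (\<lambda>t \<theta>. r t \<theta> - s0 t \<theta>) k = 0"
      using proj[OF r] by blast
    obtain s1 where s1: "s1 \<in> S" "\<And>k. k \<in> S \<Longrightarrow> weighted_inner (\<lambda>t \<theta>. h t \<theta> - s1 t \<theta>) k = 0"
      using proj[OF h] by blast
    define r' where "r' = (\<lambda>t \<theta>. r t \<theta> - s0 t \<theta>)"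
    define h' where "h' = (\<lambda>t \<theta>. h t \<theta> - s1 t \<theta>)"
    have V: "r' \<in> curves Vect" "h' \<in> curves Vect"
      unfolding r'_def h'_def by (intro curves_intros r h SV s0 s1)+
    define c where "c = weighted_inner r' h' / weighted_inner h' h'"
    have c: "weighted_inner r' h' - c * weighted_inner h' h' = 0"
      using weighted_inner_degenerate[OF V] by (simp add: c_def)
    let ?s = "\<lambda>t \<theta>. (\<lambda>t \<theta>. s0 t \<theta> - c * s1 t \<theta>) t \<theta> + c * h t \<theta>"
    have res: "(\<lambda>t \<theta>. r t \<theta> - ?s t \<theta>) = (\<lambda>t \<theta>. r' t \<theta> - c * h' t \<theta>)"
      by (simp add: r'_def h'_def algebra_simps)
    have resV: "(\<lambda>t \<theta>. r' t \<theta> - c * h' t \<theta>) \<in> curves Vect" by (intro curves_intros V)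
    have orthS: "weighted_inner (\<lambda>t \<theta>. r' t \<theta> - c * h' t \<theta>) k = 0" if "k \<in> S" for k
      using s0(2)[OF that] s1(2)[OF that] by (simp add: weighted_inner_lin V SV that r'_def[symmetric] h'_def[symmetric])
    have orthh: "weighted_inner (\<lambda>t \<theta>. r' t \<theta> - c * h' t \<theta>) h' = 0"
      using c by (simp add: weighted_inner_lin V)
    have "weighted_inner (\<lambda>t \<theta>. r' t \<theta> - c * h' t \<theta>) k = 0" if kT: "k \<in> ?T" for k
    proof -
      obtain a d where k: "k = (\<lambda>t \<theta>. a t \<theta> + d * h t \<theta>)" "a \<in> S" using kT by blast
      have aV: "(\<lambda>t \<theta>. a t \<theta> - (- d) * s1 t \<theta>) \<in> S" by (rule Sd[OF k(2) s1(1)])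
      have "k = (\<lambda>t \<theta>. (\<lambda>t \<theta>. a t \<theta> - (- d) * s1 t \<theta>) t \<theta> - (- d) * h' t \<theta>)"
        by (simp add: k h'_def algebra_simps)
      then have "weighted_inner k (\<lambda>t \<theta>. r' t \<theta> - c * h' t \<theta>) =
          weighted_inner (\<lambda>t \<theta>. a t \<theta> - (- d) * s1 t \<theta>) (\<lambda>t \<theta>. r' t \<theta> - c * h' t \<theta>)
          - (- d) * weighted_inner h' (\<lambda>t \<theta>. r' t \<theta> - c * h' t \<theta>)"
        using weighted_inner_lin[OF SV[OF aV] V(2) resV] by presburger
      then show ?thesis using orthS[OF aV] orthh
        by (simp add: weighted_inner_commute[of _ "\<lambda>t \<theta>. r' t \<theta> - c * h' t \<theta>"])
    qed
    moreover have "?s \<in> ?T" by (rule TI[OF Sd[OF s0(1) s1(1)]])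
    ultimately show ?thesis unfolding res[symmetric] by (intro bexI[of _ ?s] ballI)
  qed
qed

section \<open>First variation of the energy\<close>

lemma ker_inter_mob:
  assumes "y \<in> \<dd>" "y \<in> \<mm>" shows "y = (\<lambda>\<theta>. 0)"
  using L2_self_zero[OF ker_eta_Vect[OF assms(1)] L2_ker_mob[OF assms]] by auto

lemma mob_zero: "mob 0 0 = (\<lambda>\<theta>. 0)" by (auto simp: mob_def)

lemma zero_mob: "(\<lambda>\<theta>. 0) \<in> \<mm>" using mob_in_algebra[of 0 0] by (simp add: mob_zero)

lemma ker_diff: "x \<in> \<dd> \<Longrightarrow> y \<in> \<dd> \<Longrightarrow> (\<lambda>\<theta>. x \<theta> - y \<theta>) \<in> \<dd>"
  by (simp add: ker_eta_iff Vect_intros L2_diff_left)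

lemma ker_add: "x \<in> \<dd> \<Longrightarrow> y \<in> \<dd> \<Longrightarrow> (\<lambda>\<theta>. x \<theta> + y \<theta>) \<in> \<dd>"
  by (simp add: ker_eta_iff Vect_intros L2_add_left)

lemma ker_scale: "x \<in> \<dd> \<Longrightarrow> (\<lambda>\<theta>. c * x \<theta>) \<in> \<dd>"
  by (simp add: ker_eta_iff Vect_intros L2_scale_left)

lemma proj_m_ker:
  assumes x: "x \<in> \<dd>" shows "proj_m x = (\<lambda>\<theta>. 0)"
  unfolding proj_m_def
proof (rule the_equality)
  show "(\<lambda>\<theta>. 0) \<in> \<mm> \<and> (\<lambda>\<theta>. x \<theta> - 0) \<in> \<dd>" using x zero_mob by simp
  fix y assume y: "y \<in> \<mm> \<and> (\<lambda>\<theta>. x \<theta> - y \<theta>) \<in> \<dd>"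
  then have "(\<lambda>\<theta>. x \<theta> - (x \<theta> - y \<theta>)) \<in> \<dd>" using x ker_diff by blast
  then show "y = (\<lambda>\<theta>. 0)" using ker_inter_mob y by simp
qed

lemma vect_inner_ker:
  assumes "u \<in> \<dd>" "x \<in> \<dd>" shows "vect_inner u x = L2 (momentum u) x"
  using assms by (simp add: vect_inner_def proj_d_def proj_m_ker weil_petersson_def)

lemma ker_time_deriv:
  assumes y: "y \<in> curves \<dd>" and t: "t \<in> {0..1}"
  shows "time_deriv y t \<in> \<dd>"
proof -
  have yV: "y \<in> curves Vect" using y by (rule curves_ker_Vect)
  have "L2 (time_deriv y t) (mob a w) = 0" for a w
  proof -
    have c: "(\<lambda>t. mob a w) \<in> curves Vect" by (intro constant_curve mob_Vect)
    have "((\<lambda>t. L2 (y t) (mob a w)) has_real_derivative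
        L2 (time_deriv y t) (mob a w) + L2 (y t) (time_deriv (\<lambda>t. mob a w) t)) (at t within {0..1})"
      by (rule L2_has_time_deriv[OF yV c t])
    moreover have "time_deriv (\<lambda>t. mob a w) t = mob 0 0"
      by (rule time_deriv_mob) (use t in auto)
    ultimately have "((\<lambda>t. L2 (y t) (mob a w)) has_real_derivative L2 (time_deriv y t) (mob a w)) (at t within {0..1})"
      by (simp add: mob_zero L2_def)
    moreover have "((\<lambda>t. L2 (y t) (mob a w)) has_vector_derivative 0) (at t within {0..1})"
      by (rule has_vector_derivative_transform[OF t _ has_vector_derivative_const[of 0]])
        (use curves_slice[OF y] in \<open>auto simp: L2_ker_mob\<close>)
    ultimately show ?thesis
      using unit_deriv_unique t by (metis has_real_derivative_iff_has_vector_derivative)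
  qed
  then show ?thesis using curves_slice[OF curves_time_deriv[OF yV] t] by (simp add: ker_eta_iff)
qed

text \<open>The residual vanishes exactly if \<open>m\<close> is transported by the coadjoint action along the curve with
  left logarithmic derivative \<open>u\<close>.\<close>

definition coadjoint_residual ::
    "(real \<Rightarrow> real \<Rightarrow> real) \<Rightarrow> (real \<Rightarrow> real \<Rightarrow> real) \<Rightarrow> real \<Rightarrow> real \<Rightarrow> real" where
  "coadjoint_residual u m t \<theta> = ad_transpose (u t) (m t) \<theta> - time_deriv m t \<theta>"

lemma coadjoint_residual_curve:
  "u \<in> curves Vect \<Longrightarrow> m \<in> curves Vect \<Longrightarrow> coadjoint_residual u m \<in> curves Vect"
  unfolding coadjoint_residual_def[abs_def]
  by (intro curves_diff ad_transpose_curve curves_time_deriv)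

lemma tau_curve: "u \<in> curves Vect \<Longrightarrow> x \<in> curves Vect \<Longrightarrow> tau u x \<in> curves Vect"
  unfolding tau_def by (intro curves_add bracket_curve curves_time_deriv)

lemma L2_curve_continuous:
  "x \<in> curves Vect \<Longrightarrow> y \<in> curves Vect \<Longrightarrow> continuous_on {0..1} (\<lambda>t. L2 (x t) (y t))"
  using DERIV_continuous_on[OF L2_has_time_deriv] by blast

text \<open>Integration by parts in time and the adjointness of the bracket and \<open>ad\<^sup>T\<close> in space.\<close>

lemma first_variation:
  assumes u: "u \<in> curves Vect" and m: "m \<in> curves Vect" and x: "x \<in> curves Vect"
  shows "integral {0..1} (\<lambda>t. L2 (m t) (tau u x t)) =
    L2 (m 1) (x 1) - L2 (m 0) (x 0) + integral {0..1} (\<lambda>t. L2 (coadjoint_residual u m t) (x t))"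
proof -
  note V = curves_slice[OF u] curves_slice[OF m] curves_slice[OF x]
    curves_slice[OF curves_time_deriv[OF m]] curves_slice[OF curves_time_deriv[OF x]]
  let ?f' = "\<lambda>t. L2 (time_deriv m t) (x t) + L2 (m t) (time_deriv x t)"
  have "(?f' has_integral L2 (m 1) (x 1) - L2 (m 0) (x 0)) {0..1}"
    by (intro fundamental_theorem_of_calculus)
      (auto simp: has_real_derivative_iff_has_vector_derivative[symmetric] intro!: L2_has_time_deriv m x)
  then have 1: "integral {0..1} ?f' = L2 (m 1) (x 1) - L2 (m 0) (x 0)" by (rule integral_unique)
  have "integral {0..1} (\<lambda>t. L2 (m t) (tau u x t)) =
      integral {0..1} (\<lambda>t. ?f' t + L2 (coadjoint_residual u m t) (x t))"
  proof (rule integral_cong)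
    fix t :: real assume t: "t \<in> {0..1}"
    have "L2 (m t) (tau u x t) = L2 (m t) (time_deriv x t) + L2 (m t) (bracket (u t) (x t))"
      unfolding tau_def by (intro L2_add_right bracket_Vect V t)
    moreover have "L2 (coadjoint_residual u m t) (x t) =
        L2 (ad_transpose (u t) (m t)) (x t) - L2 (time_deriv m t) (x t)"
      unfolding coadjoint_residual_def[abs_def] by (intro L2_diff_left ad_transpose_Vect V t)
    ultimately show "L2 (m t) (tau u x t) = ?f' t + L2 (coadjoint_residual u m t) (x t)"
      using L2_bracket_adjoint[OF V(1)[OF t] V(3)[OF t] V(2)[OF t]] by simp
  qed
  also have "\<dots> = integral {0..1} ?f' + integral {0..1} (\<lambda>t. L2 (coadjoint_residual u m t) (x t))"
    by (intro Henstock_Kurzweil_Integration.integral_add integrable_continuous_interval continuous_on_add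
        L2_curve_continuous curves_time_deriv coadjoint_residual_curve u m x)
  finally show ?thesis using 1 by simp
qed

lemma coadjoint_residual_lin:
  assumes l: "l \<in> curves Vect" and m: "m \<in> curves Vect" and t: "t \<in> {0..1}"
  shows "coadjoint_residual u (\<lambda>t \<theta>. l t \<theta> + c * m t \<theta>) t \<theta> =
    coadjoint_residual u l t \<theta> + c * coadjoint_residual u m t \<theta>"
proof -
  have V: "l t \<in> Vect" "m t \<in> Vect" using l m t by (auto intro: curves_slice)
  have s: "smooth_family l" "smooth_family m" using l m by (auto intro: curves_smooth_family)
  have "time_deriv (\<lambda>t \<theta>. l t \<theta> + c * m t \<theta>) t \<theta> = time_deriv l t \<theta> + c * time_deriv m t \<theta>"
    by (rule time_deriv_eqI[OF _ t])
      (intro has_vector_derivative_add bounded_linear.has_vector_derivative[OF bounded_linear_mult_right]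
        t_partialD[OF t_partial_time_deriv] s t)
  moreover have "deriv (\<lambda>\<theta>. l t \<theta> + c * m t \<theta>) \<theta> = deriv (l t) \<theta> + c * deriv (m t) \<theta>"
    by (rule DERIV_imp_deriv) (auto intro!: derivative_eq_intros Vect_has_deriv V)
  ultimately show ?thesis by (simp add: coadjoint_residual_def ad_transpose_def algebra_simps)
qed

section \<open>Multipliers and test curves\<close>

text \<open>The curves in the Moebius algebra whose residual stays in \<open>\<dd>\<close>. Their pairing with \<open>\<tau>\<^sub>u x\<close>
  vanishes for admissible \<open>x\<close>, so their residuals are orthogonal to all admissible variations.\<close>

definition multiplier :: "(real \<Rightarrow> real \<Rightarrow> real) \<Rightarrow> (real \<Rightarrow> real \<Rightarrow> real) \<Rightarrow> bool" where
  "multiplier u m \<longleftrightarrow> m \<in> curves \<mm> \<and> coadjoint_residual u m \<in> curves \<dd>"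

lemma mob_lin: "mob a w \<theta> + c * mob b z \<theta> = mob (a + c * b) (w + of_real c * z) \<theta>"
  by (simp add: mob_def algebra_simps)

lemma smooth_family_time: "smooth_family (\<lambda>t \<theta>. t)"
proof (rule smooth_family_coinduct[of _ "{\<lambda>t \<theta>. t, \<lambda>t \<theta>. 1, \<lambda>t \<theta>. 0}"])
  show "jointly_cont g" if "g \<in> {\<lambda>t \<theta>. t, \<lambda>t \<theta>. 1, \<lambda>t \<theta>. 0}" for g
    using that by (auto simp: jointly_cont_def case_prod_unfold intro: continuous_intros)
qed (auto simp: t_partial_def angle_partial_def intro: derivative_intros)

lemma curves_mob_lin:
  assumes "l \<in> curves \<mm>" "m \<in> curves \<mm>"
  shows "(\<lambda>t \<theta>. l t \<theta> + c * m t \<theta>) \<in> curves \<mm>"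
proof -
  have "(\<lambda>t \<theta>. l t \<theta> + c * m t \<theta>) \<in> curves Vect"
    using assms by (intro curves_intros curves_mob_Vect)
  moreover have "(\<lambda>\<theta>. l t \<theta> + c * m t \<theta>) \<in> \<mm>" if t: "t \<in> {0..1}" for t
  proof -
    obtain a w b z where "l t = mob a w" "m t = mob b z"
      using curves_slice[OF assms(1) t] curves_slice[OF assms(2) t] by (auto simp: mob_algebra_iff)
    then show ?thesis using mob_in_algebra[of "a + c * b" "w + of_real c * z"] by (simp add: mob_lin)
  qed
  ultimately show ?thesis by (simp add: curves_def)
qed

text \<open>In the coordinate \<open>w\<close> the multiplier equation reads \<open>w' = 3 \<i> c\<^sub>2 w\<^sup>*\<close> with \<open>w\<^sup>*\<close> the conjugate
  of \<open>w\<close>.\<close>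

lemma multiplier_mob:
  assumes u: "u \<in> curves \<dd>" and w: "smooth_family (\<lambda>t \<theta>. w t)"
    and ode: "\<And>t. t \<in> {0..1} \<Longrightarrow>
      (w has_vector_derivative 3 * \<i> * fourier_coeff 2 (u t) * cnj (w t)) (at t within {0..1})"
  shows "multiplier u (\<lambda>t. mob a (w t))"
proof -
  have uV: "u \<in> curves Vect" using u by (rule curves_ker_Vect)
  have mV: "(\<lambda>t. mob a (w t)) \<in> curves Vect"
    by (intro smooth_family_mob w smooth_family_const)
  have res: "coadjoint_residual u (\<lambda>t. mob a (w t)) \<in> curves Vect"
    by (rule coadjoint_residual_curve[OF uV mV])
  have "coadjoint_residual u (\<lambda>t. mob a (w t)) t \<in> \<dd>" if t: "t \<in> {0..1}" for t
  proof -
    let ?w' = "3 * \<i> * fourier_coeff 2 (u t) * cnj (w t)"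
    have td: "time_deriv (\<lambda>t. mob a (w t)) t = mob 0 ?w'"
      by (intro time_deriv_mob ode t) simp
    have "L2 (coadjoint_residual u (\<lambda>t. mob a (w t)) t) (mob b z) =
        L2 (ad_transpose (u t) (mob a (w t))) (mob b z) - L2 (mob 0 ?w') (mob b z)" for b z
      unfolding coadjoint_residual_def[abs_def] td
      by (intro L2_diff_left ad_transpose_Vect curves_slice[OF uV t] mob_Vect)
    then have "L2 (coadjoint_residual u (\<lambda>t. mob a (w t)) t) (mob b z) = 0" for b z
      by (simp add: L2_ad_transpose_mob[OF curves_slice[OF u t]] L2_mob eta0_mob eta1_mob[simplified] algebra_simps)
    then show ?thesis using curves_slice[OF res t] by (simp add: ker_eta_iff)
  qed
  then show ?thesis using res mV by (simp add: multiplier_def curves_def)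
qed

text \<open>The imaginary part of \<open>w\<^sub>1\<^sup>* w\<^sub>2\<close> is conserved for two solutions \<open>w\<^sub>1\<close>, \<open>w\<^sub>2\<close> of the multiplier
  equation, so solutions that are independent over the reals at time zero are still independent at time one.
  Constant fields are multipliers as well and separate the remaining real coordinate.\<close>

lemma multipliers_separate:
  assumes u: "u \<in> curves \<dd>"
  obtains l1 l2 l3 where "multiplier u l1" "multiplier u l2" "multiplier u l3"
    "\<forall>a z. L2 (l1 1) (mob a z) = 0 \<longrightarrow> L2 (l2 1) (mob a z) = 0 \<longrightarrow> L2 (l3 1) (mob a z) = 0 \<longrightarrow> a = 0 \<and> z = 0"
proof -
  have uV: "u \<in> curves Vect" using u by (rule curves_ker_Vect)
  let ?p = "\<lambda>t. 3 * \<i> * fourier_coeff 2 (u t)"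
  have p: "smooth_family (\<lambda>t \<theta>. ?p t)"
    by (intro smooth_family_mult smooth_family_const smooth_family_fourier uV)
  have zero: "smooth_family (\<lambda>(t :: real) (\<theta> :: real). 0 :: complex)" by simp
  have sol: "\<exists>w. w 0 = z0 \<and> smooth_family (\<lambda>t \<theta>. w t) \<and>
      (\<forall>t\<in>{0..1}. (w has_vector_derivative ?p t * cnj (w t)) (at t within {0..1}))" for z0
  proof -
    obtain w where w: "w 0 = z0"
      "\<And>t. t \<in> {0..1} \<Longrightarrow> (w has_vector_derivative ?p t * cnj (w t) + 0) (at t within {0..1})"
      using conjugate_linear_ode[OF smooth_family_time_continuous[OF p] smooth_family_time_continuous[OF zero]]
      by blast
    from conjugate_linear_ode_smooth[OF p zero w(2)] have "smooth_family (\<lambda>t \<theta>. w t)" by simp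
    then show ?thesis using w by (intro exI[of _ w]) auto
  qed
  obtain w1 where w1: "w1 0 = 1" "smooth_family (\<lambda>t \<theta>. w1 t)"
    "\<And>t. t \<in> {0..1} \<Longrightarrow> (w1 has_vector_derivative ?p t * cnj (w1 t)) (at t within {0..1})"
    using sol[of 1] by blast
  obtain w2 where w2: "w2 0 = \<i>" "smooth_family (\<lambda>t \<theta>. w2 t)"
    "\<And>t. t \<in> {0..1} \<Longrightarrow> (w2 has_vector_derivative ?p t * cnj (w2 t)) (at t within {0..1})"
    using sol[of \<i>] by blast
  have D: "((\<lambda>t. Im (cnj (w1 t) * w2 t)) has_vector_derivative 0) (at t within {0..1})" if t: "t \<in> {0..1}" for t
  proof -
    have "((\<lambda>t. cnj (w1 t)) has_vector_derivative cnj (?p t * cnj (w1 t))) (at t within {0..1})"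
      by (rule bounded_linear.has_vector_derivative[OF bounded_linear_cnj w1(3)[OF t]])
    from bounded_linear.has_vector_derivative[OF bounded_linear_Im has_vector_derivative_mult[OF this w2(3)[OF t]]]
    have "((\<lambda>t. Im (cnj (w1 t) * w2 t)) has_vector_derivative
        Im (cnj (w1 t) * (?p t * cnj (w2 t)) + cnj (?p t * cnj (w1 t)) * w2 t)) (at t within {0..1})" .
    moreover have "cnj (w1 t) * (?p t * cnj (w2 t)) + cnj (?p t * cnj (w1 t)) * w2 t =
        (cnj (w1 t) * (?p t * cnj (w2 t))) + cnj (cnj (w1 t) * (?p t * cnj (w2 t)))"
      by simp
    moreover have "Im (k + cnj k) = 0" for k by simp
    ultimately show ?thesis by (simp only:)
  qed
  obtain k where k: "\<And>t. t \<in> {0..1} \<Longrightarrow> Im (cnj (w1 t) * w2 t) = k"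
    using has_vector_derivative_zero_constant[OF convex_real_interval(5)[of 0 1], of "\<lambda>t. Im (cnj (w1 t) * w2 t)"]
      D by blast
  from k[of 0] k[of 1] have conserved: "Im (cnj (w1 1) * w2 1) = 1" by (simp add: w1 w2)
  show thesis
  proof (rule that)
    show "multiplier u (\<lambda>t. mob 1 0)" by (rule multiplier_mob[OF u]) auto
    show "multiplier u (\<lambda>t. mob 0 (w1 t))" by (rule multiplier_mob[OF u w1(2,3)])
    show "multiplier u (\<lambda>t. mob 0 (w2 t))" by (rule multiplier_mob[OF u w2(2,3)])
    have "a = 0 \<and> z = 0" if *: "L2 (mob 1 0) (mob a z) = 0" "L2 (mob 0 (w1 1)) (mob a z) = 0" "L2 (mob 0 (w2 1)) (mob a z) = 0" for a z
    proof -
    from * have a: "a = 0" and z: "Re (cnj z * w1 1) = 0" "Re (cnj z * w2 1) = 0"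
      by (simp_all add: L2_mob eta0_mob eta1_mob[simplified] del: complex_cnj_mult times_complex.sel)
    from z conserved have e: "Re z * Re (w1 1) + Im z * Im (w1 1) = 0" "Re z * Re (w2 1) + Im z * Im (w2 1) = 0"
      "Re (w1 1) * Im (w2 1) - Im (w1 1) * Re (w2 1) = 1" by simp_all
    have "Re z = 0" "Im z = 0" using e by algebra+
    with a show ?thesis by (simp add: complex_eq_iff)
    qed
    then show "\<forall>a z. L2 (mob 1 0) (mob a z) = 0 \<longrightarrow> L2 (mob 0 (w1 1)) (mob a z) = 0 \<longrightarrow>
        L2 (mob 0 (w2 1)) (mob a z) = 0 \<longrightarrow> a = 0 \<and> z = 0" by blast
  qed
qed

text \<open>The conditions \<open>\<eta>\<^sub>0 (\<tau>\<^sub>u x) = 0\<close> and \<open>\<eta>\<^sub>1 (\<tau>\<^sub>u x) = 0\<close> are linear differential equations for the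
  component of \<open>x\<close> in the Moebius algebra, with inhomogeneity \<open>- [u, y]\<close>.\<close>

lemma horizontal_completion:
  assumes u: "u \<in> curves \<dd>" and y: "y \<in> curves \<dd>"
  obtains a z where "smooth_family (\<lambda>t \<theta>. a t)" "smooth_family (\<lambda>t \<theta>. z t)" "a 0 = 0" "z 0 = 0"
    "tau u (\<lambda>t \<theta>. y t \<theta> + mob (a t) (z t) \<theta>) \<in> curves \<dd>"
proof -
  have uV: "u \<in> curves Vect" and yV: "y \<in> curves Vect" using u y by (auto intro: curves_ker_Vect)
  have bV: "(\<lambda>t. bracket (u t) (y t)) \<in> curves Vect" by (rule bracket_curve[OF uV yV])
  let ?p = "\<lambda>t. - (3 * \<i> * fourier_coeff 2 (u t))"
  let ?q = "\<lambda>t. - eta1 (bracket (u t) (y t))" and ?r = "\<lambda>t. - complex_of_real (eta0 (bracket (u t) (y t)))"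
  have p: "smooth_family (\<lambda>t \<theta>. ?p t)"
    by (intro smooth_family_minus smooth_family_mult smooth_family_const smooth_family_fourier uV)
  have q: "smooth_family (\<lambda>t \<theta>. ?q t)"
    by (intro smooth_family_minus smooth_family_fourier bV)
  have r: "smooth_family (\<lambda>t \<theta>. ?r t)"
    by (intro smooth_family_minus smooth_family_bounded_linear[OF smooth_family_eta0 bounded_linear_of_real] bV)
  have zero: "smooth_family (\<lambda>(t :: real) (\<theta> :: real). 0 :: complex)" by simp
  obtain z where z: "z 0 = 0"
    "\<And>t. t \<in> {0..1} \<Longrightarrow> (z has_vector_derivative ?p t * cnj (z t) + ?q t) (at t within {0..1})"
    using conjugate_linear_ode[OF smooth_family_time_continuous[OF p] smooth_family_time_continuous[OF q]]
    by blast
  obtain A where A: "A 0 = 0"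
    "\<And>t. t \<in> {0..1} \<Longrightarrow> (A has_vector_derivative 0 * cnj (A t) + ?r t) (at t within {0..1})"
    using conjugate_linear_ode[OF smooth_family_time_continuous[OF zero] smooth_family_time_continuous[OF r]]
    by blast
  have zs: "smooth_family (\<lambda>t \<theta>. z t)" by (rule conjugate_linear_ode_smooth[OF p q z(2)])
  have As: "smooth_family (\<lambda>t \<theta>. Re (A t))"
    by (rule smooth_family_bounded_linear[OF conjugate_linear_ode_smooth[OF zero r A(2)] bounded_linear_Re])
  let ?m = "\<lambda>t. mob (Re (A t)) (z t)"
  let ?x = "\<lambda>t \<theta>. y t \<theta> + ?m t \<theta>"
  have mV: "?m \<in> curves Vect" by (rule smooth_family_mob[OF As zs])
  have xV: "?x \<in> curves Vect" by (intro curves_add yV mV)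
  have "tau u ?x t \<in> \<dd>" if t: "t \<in> {0..1}" for t
  proof -
    let ?a' = "- eta0 (bracket (u t) (y t))" and ?z' = "?p t * cnj (z t) + ?q t"
    have "((\<lambda>t. Re (A t)) has_vector_derivative Re (0 * cnj (A t) + ?r t)) (at t within {0..1})"
      by (rule bounded_linear.has_vector_derivative[OF bounded_linear_Re A(2)[OF t]])
    then have a': "((\<lambda>t. Re (A t)) has_real_derivative ?a') (at t within {0..1})"
      by (simp add: has_real_derivative_iff_has_vector_derivative)
    have td: "time_deriv ?x t \<theta> = time_deriv y t \<theta> + mob ?a' ?z' \<theta>" for \<theta>
      using time_deriv_add[OF curves_smooth_family[OF yV] curves_smooth_family[OF mV] t]
      unfolding time_deriv_mob[OF a' z(2)[OF t] t] .
    have V: "u t \<in> Vect" "y t \<in> Vect" "time_deriv y t \<in> Vect"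
      using uV yV t curves_time_deriv[OF yV] by (auto intro: curves_slice)
    have br: "bracket (u t) (?x t) \<theta> = bracket (u t) (y t) \<theta> + bracket (u t) (?m t) \<theta>" for \<theta>
      using V by (simp add: bracket_def deriv_add_Vect algebra_simps)
    have tau: "tau u ?x t = (\<lambda>\<theta>. (\<lambda>\<theta>. time_deriv y t \<theta> + mob ?a' ?z' \<theta>) \<theta> +
        (\<lambda>\<theta>. bracket (u t) (y t) \<theta> + bracket (u t) (?m t) \<theta>) \<theta>)"
      by (auto simp: tau_def td br)
    have "L2 (tau u ?x t) (mob b w) = 0" for b w
    proof -
      have "L2 (tau u ?x t) (mob b w) = (L2 (time_deriv y t) (mob b w) + L2 (mob ?a' ?z') (mob b w)) +
          (L2 (bracket (u t) (y t)) (mob b w) + L2 (bracket (u t) (?m t)) (mob b w))"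
        unfolding tau by (simp add: L2_add_left V Vect_intros bracket_Vect)
      moreover have "L2 (time_deriv y t) (mob b w) = 0"
        using L2_ker_mob[OF ker_time_deriv[OF y t] mob_in_algebra] .
      moreover have "L2 (bracket (u t) (y t)) (mob b w) =
          b * eta0 (bracket (u t) (y t)) + 2 * Re (cnj w * eta1 (bracket (u t) (y t)))"
        by (intro L2_mob bracket_Vect V)
      moreover have "L2 (mob ?a' ?z') (mob b w) = b * ?a' + 2 * Re (cnj w * ?z')"
        by (simp only: L2_mob[OF mob_Vect] eta0_mob eta1_mob)
      moreover have "L2 (bracket (u t) (?m t)) (mob b w) =
          2 * Re (cnj w * (3 * \<i> * cnj (z t) * fourier_coeff 2 (u t)))"
        by (rule L2_bracket_mob[OF curves_slice[OF u t]])
      ultimately show ?thesis by (simp add: algebra_simps)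
    qed
    then show ?thesis
      using curves_slice[OF tau_curve[OF uV xV] t] by (simp add: ker_eta_iff)
  qed
  then have "tau u ?x \<in> curves \<dd>"
    using tau_curve[OF uV xV] by (simp add: curves_def)
  then show thesis using that[OF As zs] A(1) z(1) by simp
qed

lemma multiplier_pairing:
  assumes u: "u \<in> curves \<dd>" and l: "l \<in> curves \<mm>" and x: "x \<in> curves Vect"
    and tau: "tau u x \<in> curves \<dd>" and x0: "\<And>\<theta>. x 0 \<theta> = 0"
  shows "L2 (l 1) (x 1) = - integral {0..1} (\<lambda>t. L2 (coadjoint_residual u l t) (x t))"
proof -
  have "integral {0..1} (\<lambda>t. L2 (l t) (tau u x t)) = integral {0..1 :: real} (\<lambda>t. 0)"
  proof (rule integral_cong)
    fix t :: real assume t: "t \<in> {0..1}"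
    show "L2 (l t) (tau u x t) = 0"
      using L2_ker_mob[OF curves_slice[OF tau t] curves_slice[OF l t]] by (simp add: L2_commute)
  qed
  then show ?thesis
    using first_variation[OF curves_ker_Vect[OF u] curves_mob_Vect[OF l] x]
    by (simp add: L2_def x0)
qed

section \<open>The geodesic equation\<close>

lemma geodesic_equation_iff:
  assumes u: "u \<in> curves Vect" and lam: "lam \<in> curves Vect"
  shows "geodesic_equation u lam \<longleftrightarrow>
    (\<forall>t\<in>{0..1}. \<forall>\<theta>. coadjoint_residual u (\<lambda>t. momentum (u t)) t \<theta> + coadjoint_residual u lam t \<theta> = 0)"
  unfolding geodesic_equation_def
proof (intro ball_cong refl iff_allI)
  fix t \<theta> :: real assume t: "t \<in> {0..1}"
  have V: "momentum (u t) \<in> Vect" "lam t \<in> Vect"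
    using curves_slice[OF momentum_curve[OF u] t] curves_slice[OF lam t] by auto
  have "ad_transpose (u t) (\<lambda>\<theta>. momentum (u t) \<theta> + lam t \<theta>) \<theta> =
      ad_transpose (u t) (momentum (u t)) \<theta> + ad_transpose (u t) (lam t) \<theta>"
    using V by (simp add: ad_transpose_def deriv_add_Vect algebra_simps)
  then show "(momentum (time_deriv u t) \<theta> + time_deriv lam t \<theta> =
        ad_transpose (u t) (\<lambda>\<theta>. momentum (u t) \<theta> + lam t \<theta>) \<theta>) \<longleftrightarrow>
      (coadjoint_residual u (\<lambda>t. momentum (u t)) t \<theta> + coadjoint_residual u lam t \<theta> = 0)"
    by (auto simp: coadjoint_residual_def time_deriv_momentum[OF u t])
qed

lemma momentum_residual_ker:
  assumes u: "u \<in> curves \<dd>"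
  shows "coadjoint_residual u (\<lambda>t. momentum (u t)) \<in> curves \<dd>"
proof -
  have uV: "u \<in> curves Vect" using u by (rule curves_ker_Vect)
  have M: "(\<lambda>t. momentum (u t)) \<in> curves \<dd>"
    using momentum_curve[OF uV] curves_slice[OF uV] by (auto simp: curves_def momentum_ker)
  have "coadjoint_residual u (\<lambda>t. momentum (u t)) t \<in> \<dd>" if t: "t \<in> {0..1}" for t
    unfolding coadjoint_residual_def[abs_def]
    by (intro ker_diff ad_transpose_momentum_ker curves_slice[OF u t] ker_time_deriv M t)
  then show ?thesis
    using coadjoint_residual_curve[OF uV momentum_curve[OF uV]] by (simp add: curves_def)
qed

lemma energy_variation:
  assumes u: "u \<in> curves \<dd>" and x: "x \<in> horizontal_variations u"
  shows "integral {0..1} (\<lambda>t. vect_inner (u t) (tau u x t)) =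
    integral {0..1} (\<lambda>t. L2 (coadjoint_residual u (\<lambda>t. momentum (u t)) t) (x t))"
proof -
  have uV: "u \<in> curves Vect" using u by (rule curves_ker_Vect)
  have x': "x \<in> curves Vect" "tau u x \<in> curves \<dd>" "\<And>\<theta>. x 0 \<theta> = 0" "\<And>\<theta>. x 1 \<theta> = 0"
    using x by (auto simp: horizontal_variations_def variations_def)
  have "integral {0..1} (\<lambda>t. vect_inner (u t) (tau u x t)) =
      integral {0..1} (\<lambda>t. L2 (momentum (u t)) (tau u x t))"
    by (intro integral_cong vect_inner_ker curves_slice[OF u] curves_slice[OF x'(2)])
  then show ?thesis
    using first_variation[OF uV momentum_curve[OF uV] x'(1)] by (simp add: L2_def x')
qed

text \<open>If the geodesic equation holds, the residual of the momentum is minus the residual of a curve in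
  the Moebius algebra, which pairs to zero with all admissible variations.\<close>

lemma geodesic_equation_imp_critical:
  assumes u: "u \<in> curves \<dd>" and lam: "lam \<in> curves \<mm>" and eq: "geodesic_equation u lam"
    and x: "x \<in> horizontal_variations u"
  shows "integral {0..1} (\<lambda>t. vect_inner (u t) (tau u x t)) = 0"
proof -
  have uV: "u \<in> curves Vect" using u by (rule curves_ker_Vect)
  have x': "x \<in> curves Vect" "tau u x \<in> curves \<dd>" "\<And>\<theta>. x 0 \<theta> = 0" "\<And>\<theta>. x 1 \<theta> = 0"
    using x by (auto simp: horizontal_variations_def variations_def)
  have res: "coadjoint_residual u (\<lambda>t. momentum (u t)) t \<theta> = - coadjoint_residual u lam t \<theta>"
    if "t \<in> {0..1}" for t \<theta>
    using eq[unfolded geodesic_equation_iff[OF uV curves_mob_Vect[OF lam]]] that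
    by (auto simp: eq_neg_iff_add_eq_0)
  have "integral {0..1} (\<lambda>t. L2 (coadjoint_residual u (\<lambda>t. momentum (u t)) t) (x t)) =
      integral {0..1} (\<lambda>t. - L2 (coadjoint_residual u lam t) (x t))"
    by (rule integral_cong) (simp add: L2_def res)
  then show ?thesis
    using multiplier_pairing[OF u lam x'(1,2,3)] energy_variation[OF u x] by (simp add: L2_def x')
qed

text \<open>Conversely, the residual of the momentum is projected, with respect to the weight
  \<open>t (1 - t)\<close>, onto the residuals of the separating multipliers. The orthogonal rest \<open>g\<close> yields the
  admissible test curve \<open>t (1 - t) g\<close> plus a completion: orthogonality forces the completion to
  vanish at time one. Testing with it gives \<open>\<integral> t (1 - t) \<langle>g, g\<rangle> = 0\<close>, so that \<open>g = 0\<close>.\<close>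

lemma critical_imp_geodesic_equation:
  assumes u: "u \<in> curves \<dd>"
    and crit: "\<And>x. x \<in> horizontal_variations u \<Longrightarrow>
      integral {0..1} (\<lambda>t. vect_inner (u t) (tau u x t)) = 0"
  shows "\<exists>lam \<in> curves \<mm>. geodesic_equation u lam"
proof -
  have uV: "u \<in> curves Vect" using u by (rule curves_ker_Vect)
  let ?R = "coadjoint_residual u"
  define r where "r = ?R (\<lambda>t. momentum (u t))"
  have r: "r \<in> curves \<dd>" unfolding r_def by (rule momentum_residual_ker[OF u])
  obtain l1 l2 l3 where l: "multiplier u l1" "multiplier u l2" "multiplier u l3"
    and sep: "\<forall>a z. L2 (l1 1) (mob a z) = 0 \<longrightarrow> L2 (l2 1) (mob a z) = 0 \<longrightarrow> L2 (l3 1) (mob a z) = 0 \<longrightarrow> a = 0 \<and> z = 0"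
    by (rule multipliers_separate[OF u])
  have lm: "l1 \<in> curves \<mm>" "l2 \<in> curves \<mm>" "l3 \<in> curves \<mm>"
    and h: "?R l1 \<in> curves \<dd>" "?R l2 \<in> curves \<dd>" "?R l3 \<in> curves \<dd>"
    using l by (auto simp: multiplier_def)
  define T where "T S k = {\<lambda>t \<theta>. s t \<theta> + c * k t \<theta> | s c. s \<in> S}"
    for S :: "(real \<Rightarrow> real \<Rightarrow> real) set" and k
  have TI: "(\<lambda>t \<theta>. s t \<theta> + c * k t \<theta>) \<in> T S k" if "s \<in> S" for s c S k
    using that by (auto simp: T_def)
  have TS: "s \<in> T S k" if "s \<in> S" for s S k using TI[OF that, of 0 k] by simp
  let ?S0 = "{\<lambda>t \<theta>. 0} :: (real \<Rightarrow> real \<Rightarrow> real) set"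
  define S where "S = T (T (T ?S0 (?R l1)) (?R l2)) (?R l3)"
  have pS: "projectable S"
    unfolding S_def T_def by (intro projectable_insert projectable_zero curves_ker_Vect h)
  have z0: "(\<lambda>t \<theta>. 0) \<in> ?S0" by simp
  have hS: "?R l1 \<in> S" "?R l2 \<in> S" "?R l3 \<in> S"
    unfolding S_def
    using TS[OF TS[OF TI[OF z0, of 1 "?R l1"]]] TS[OF TI[OF TS[OF z0], of 1 "?R l2"]]
      TI[OF TS[OF TS[OF z0]], of 1 "?R l3"] by simp_all
  obtain s where s: "s \<in> S" "\<And>k. k \<in> S \<Longrightarrow> weighted_inner (\<lambda>t \<theta>. r t \<theta> - s t \<theta>) k = 0"
    using pS curves_ker_Vect[OF r] unfolding projectable_def by blast
  obtain c1 c2 c3 where sc: "s = (\<lambda>t \<theta>. c1 * ?R l1 t \<theta> + c2 * ?R l2 t \<theta> + c3 * ?R l3 t \<theta>)"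
    using s(1) unfolding S_def T_def by fastforce
  define lam where "lam = (\<lambda>t \<theta>. (\<lambda>t \<theta>. (\<lambda>t \<theta>. 0 + (- c1) * l1 t \<theta>) t \<theta> + (- c2) * l2 t \<theta>) t \<theta> + (- c3) * l3 t \<theta>)"
  have zm: "(\<lambda>t \<theta>. 0) \<in> curves \<mm>" by (simp add: curves_def zero_mob)
  have m1: "(\<lambda>t \<theta>. 0 + (- c1) * l1 t \<theta>) \<in> curves \<mm>" by (rule curves_mob_lin[OF zm lm(1)])
  have m2: "(\<lambda>t \<theta>. (\<lambda>t \<theta>. 0 + (- c1) * l1 t \<theta>) t \<theta> + (- c2) * l2 t \<theta>) \<in> curves \<mm>"
    by (rule curves_mob_lin[OF m1 lm(2)])
  have lam: "lam \<in> curves \<mm>" unfolding lam_def by (rule curves_mob_lin[OF m2 lm(3)])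
  have Rlam: "?R lam t \<theta> = - s t \<theta>" if t: "t \<in> {0..1}" for t \<theta>
  proof -
    have "?R (\<lambda>t \<theta>. 0) t \<theta> = 0"
      using t time_deriv_eqI[of "\<lambda>t \<theta>. 0" \<theta> 0 t]
      by (simp add: coadjoint_residual_def ad_transpose_def)
    then show ?thesis
      unfolding lam_def sc
      using coadjoint_residual_lin[OF curves_mob_Vect[OF m2] curves_mob_Vect[OF lm(3)] t, of u "- c3" \<theta>]
        coadjoint_residual_lin[OF curves_mob_Vect[OF m1] curves_mob_Vect[OF lm(2)] t, of u "- c2" \<theta>]
        coadjoint_residual_lin[OF curves_mob_Vect[OF zm] curves_mob_Vect[OF lm(1)] t, of u "- c1" \<theta>]
      by simp
  qed
  define g where "g = (\<lambda>t \<theta>. r t \<theta> - s t \<theta>)"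
  have sV: "s \<in> curves Vect" using s(1) pS by (auto simp: projectable_def)
  have gV: "g \<in> curves Vect" unfolding g_def by (intro curves_diff curves_ker_Vect[OF r] sV)
  have sd: "s t \<in> \<dd>" if "t \<in> {0..1}" for t
    unfolding sc using that by (intro ker_add ker_scale curves_slice[OF h(1)] curves_slice[OF h(2)] curves_slice[OF h(3)])
  have gd: "g t \<in> \<dd>" if "t \<in> {0..1}" for t
    unfolding g_def by (intro ker_diff sd curves_slice[OF r] that)
  define y where "y = (\<lambda>t \<theta>. t * (1 - t) * g t \<theta>)"
  have idV: "(\<lambda>t \<theta>. t) \<in> curves Vect"
    using smooth_family_time by (simp add: curves_Vect_iff)
  have yV: "y \<in> curves Vect"
    unfolding y_def by (intro curves_mult curves_diff idV curves_const gV)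
  have y: "y \<in> curves \<dd>"
    using yV gd ker_scale by (auto simp: curves_def y_def)
  obtain a z where az: "smooth_family (\<lambda>t \<theta>. a t)" "smooth_family (\<lambda>t \<theta>. z t)" "a 0 = 0" "z 0 = 0"
    and tau: "tau u (\<lambda>t \<theta>. y t \<theta> + mob (a t) (z t) \<theta>) \<in> curves \<dd>"
    by (rule horizontal_completion[OF u y])
  define x where "x = (\<lambda>t \<theta>. y t \<theta> + mob (a t) (z t) \<theta>)"
  have xV: "x \<in> curves Vect" unfolding x_def by (intro curves_add yV smooth_family_mob az)
  have x0: "x 0 \<theta> = 0" for \<theta> by (simp add: x_def y_def az mob_def)
  have x1: "x 1 = mob (a 1) (z 1)" by (simp add: x_def y_def)
  have pair: "integral {0..1} (\<lambda>t. L2 (k t) (x t)) = weighted_inner k g"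
    if k: "k \<in> curves \<dd>" for k
    unfolding weighted_inner_def
  proof (rule integral_cong)
    fix t :: real assume t: "t \<in> {0..1}"
    have "L2 (k t) (x t) = L2 (k t) (y t) + L2 (k t) (mob (a t) (z t))"
      unfolding x_def by (intro L2_add_right curves_slice[OF yV t] mob_Vect ker_eta_Vect curves_slice[OF k t])
    also have "L2 (k t) (mob (a t) (z t)) = 0" by (rule L2_ker_mob[OF curves_slice[OF k t] mob_in_algebra])
    also have "L2 (k t) (y t) = t * (1 - t) * L2 (k t) (g t)"
      unfolding y_def by (subst (1 2) L2_commute) (rule L2_scale_left)
    finally show "L2 (k t) (x t) = t * (1 - t) * L2 (k t) (g t)" by simp
  qed
  have end_pair: "L2 (k 1) (mob (a 1) (z 1)) = 0" if k: "k \<in> curves \<mm>" "?R k \<in> curves \<dd>" "?R k \<in> S" for k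
    using multiplier_pairing[OF u k(1) xV tau[folded x_def] x0] pair[OF k(2)] s(2)[OF k(3), folded g_def]
    by (simp add: x1 weighted_inner_commute[of _ g])
  have "a 1 = 0 \<and> z 1 = 0"
    by (intro sep[rule_format] end_pair lm h hS)
  then have "x 1 \<theta> = 0" for \<theta> by (simp add: x1 mob_def)
  then have xh: "x \<in> horizontal_variations u"
    using xV x0 tau by (simp add: horizontal_variations_def variations_def x_def)
  have "weighted_inner r g = 0"
    using crit[OF xh] energy_variation[OF u xh] pair[OF r] by (simp add: r_def)
  moreover have "weighted_inner s g = 0"
    using s(2)[OF s(1)] by (simp add: g_def weighted_inner_commute)
  ultimately have "weighted_inner g g = 0"
    using weighted_inner_lin[OF curves_ker_Vect[OF r] sV gV, of 1] by (simp add: g_def)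
  then have "r t \<theta> - s t \<theta> = 0" if "t \<in> {0..1}" for t \<theta>
    using weighted_inner_definite[OF gV _ that] by (simp add: g_def)
  then have "geodesic_equation u lam"
    unfolding geodesic_equation_iff[OF uV curves_mob_Vect[OF lam]] by (simp add: Rlam r_def)
  then show ?thesis using lam by blast
qed

section \<open>The Fourier expansion\<close>

text \<open>Translation by half a period of the oscillating factor changes its sign. Hence the integral is
  bounded by the oscillation of \<open>g\<close> over that distance.\<close>

lemma riemann_lebesgue:
  fixes g :: "real \<Rightarrow> complex"
  assumes g: "continuous_on UNIV g" and per: "\<And>s. g (s + 2 * pi) = g s" and e: "e > 0"
  shows "\<exists>N::nat. \<forall>m::int. int N \<le> \<bar>m\<bar> \<longrightarrow> norm (integral {0..2 * pi} (\<lambda>s. g s * cis (of_int m * s))) \<le> e"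
proof -
  have "uniformly_continuous_on {-pi..3 * pi} g"
    by (intro compact_uniformly_continuous continuous_on_subset[OF g]) auto
  then obtain d where d: "d > 0"
    "\<And>s r. s \<in> {-pi..3 * pi} \<Longrightarrow> r \<in> {-pi..3 * pi} \<Longrightarrow> dist r s < d \<Longrightarrow> dist (g r) (g s) < e / pi"
    using e unfolding uniformly_continuous_on_def by (metis divide_pos_pos pi_gt_zero)
  obtain N :: nat where N: "pi / d < real N" using reals_Archimedean2 by blast
  have "norm (integral {0..2 * pi} (\<lambda>s. g s * cis (of_int m * s))) \<le> e"
    if m: "int (max N 1) \<le> \<bar>m\<bar>" for m :: int
  proof -
    let ?k = "of_int m :: real"
    have k: "real N \<le> \<bar>?k\<bar>" "1 \<le> \<bar>?k\<bar>" using m by linarith+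
    have "pi / d < \<bar>?k\<bar>" using N k by linarith
    then have p1: "\<bar>pi / ?k\<bar> < d" using d(1) k by (simp add: abs_divide field_simps)
    have p2: "\<bar>pi / ?k\<bar> \<le> pi" using k by (simp add: abs_divide divide_le_eq)
    let ?f = "\<lambda>s. g s * cis (?k * s)" and ?h = "\<lambda>s. g (s + pi / ?k) * cis (?k * s)"
    have c: "continuous_on S g" for S using g continuous_on_subset by blast
    have cf: "continuous_on S ?f" for S by (intro continuous_intros c)
    have ch: "continuous_on S ?h" for S
      by (intro continuous_intros continuous_on_compose2[OF g]) auto
    have "?f (s + 2 * pi) = ?f s" for s
    proof -
      have "cis (?k * (s + 2 * pi)) = cis (?k * s) * cis (2 * pi * ?k)"
        by (simp add: cis_mult algebra_simps)
      then show ?thesis using cis_multiple_2pi[of ?k] by (simp add: per)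
    qed
    from integral_circle_shift[OF this cf, of "pi / ?k"]
    have "integral {0..2 * pi} ?f = integral {0..2 * pi} (\<lambda>s. g (s + pi / ?k) * cis (?k * (s + pi / ?k)))"
      by simp
    also have "(\<lambda>s. g (s + pi / ?k) * cis (?k * (s + pi / ?k))) = (\<lambda>s. - ?h s)"
    proof
      fix s
      have "?k * (s + pi / ?k) = ?k * s + pi" using k by (simp add: field_simps)
      then have "cis (?k * (s + pi / ?k)) = cis (?k * s) * cis pi" by (simp only: cis_mult)
      then show "g (s + pi / ?k) * cis (?k * (s + pi / ?k)) = - ?h s" by simp
    qed
    finally have "2 * integral {0..2 * pi} ?f = integral {0..2 * pi} ?f - integral {0..2 * pi} ?h" by simp
    also have "\<dots> = integral {0..2 * pi} (\<lambda>s. ?f s - ?h s)"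
      by (intro Henstock_Kurzweil_Integration.integral_diff[symmetric] integrable_continuous_interval cf ch)
    finally have "norm (2 * integral {0..2 * pi} ?f) = norm (integral {0..2 * pi} (\<lambda>s. ?f s - ?h s))" by simp
    also have "\<dots> \<le> e / pi * (2 * pi - 0)"
    proof (rule integral_bound)
      show "continuous_on {0..2 * pi} (\<lambda>s. ?f s - ?h s)" by (intro continuous_on_diff cf ch)
      fix s :: real assume s: "s \<in> {0..2 * pi}"
      have "dist (g s) (g (s + pi / ?k)) < e / pi"
      proof (rule d(2))
        show "s + pi / ?k \<in> {-pi..3 * pi}" "s \<in> {-pi..3 * pi}"
          using s p2 pi_gt_zero unfolding atLeastAtMost_iff by linarith+
        show "dist s (s + pi / ?k) < d" using p1 by (simp add: dist_real_def)
      qed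
      moreover have "?f s - ?h s = (g s - g (s + pi / ?k)) * cis (?k * s)" by (simp add: algebra_simps)
      ultimately show "norm (?f s - ?h s) \<le> e / pi" by (simp add: norm_mult dist_norm)
    qed simp
    finally show ?thesis by (simp add: norm_mult)
  qed
  then show ?thesis by blast
qed

lemma Vect_periodic_int:
  assumes x: "x \<in> Vect" shows "x (\<theta> + of_int n * (2 * pi)) = x \<theta>"
proof (induction n rule: int_induct[of _ 0])
  case (step1 i)
  then show ?case using Vect_periodic[OF x, of "\<theta> + of_int i * (2 * pi)"] by (simp add: algebra_simps)
next
  case (step2 i)
  then show ?case using Vect_periodic[OF x, of "\<theta> + of_int (i - 1) * (2 * pi)"] by (simp add: algebra_simps)
qed simp

text \<open>The value where the denominator vanishes is the limit there, so that the quotient is continuous.\<close>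

definition circle_quotient :: "(real \<Rightarrow> real) \<Rightarrow> real \<Rightarrow> real \<Rightarrow> complex" where
  "circle_quotient x \<theta> s = (if cis s = 1 then of_real (deriv x \<theta>) / \<i>
     else of_real (x (\<theta> + s) - x \<theta>) / (cis s - 1))"

lemma cis_eq_1_period:
  assumes "cis s = 1" obtains n :: int where "s = of_int n * (2 * pi)"
proof -
  have "cos s = 1" using assms by (metis cis.sel(1) one_complex.sel(1))
  then show ?thesis using that by (auto simp: cos_one_2pi_int mult.assoc)
qed

lemma circle_quotient_mult:
  assumes "x \<in> Vect"
  shows "circle_quotient x \<theta> s * (cis s - 1) = of_real (x (\<theta> + s) - x \<theta>)"
proof (cases "cis s = 1")
  case True
  then obtain n :: int where "s = of_int n * (2 * pi)" by (rule cis_eq_1_period)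
  then show ?thesis using Vect_periodic_int[OF assms] True by (simp add: circle_quotient_def)
qed (simp add: circle_quotient_def)

lemma circle_quotient_periodic:
  assumes "x \<in> Vect" shows "circle_quotient x \<theta> (s + 2 * pi) = circle_quotient x \<theta> s"
proof -
  have "cis (s + 2 * pi) = cis s" by (simp add: complex_eq_iff)
  then show ?thesis
    using Vect_periodic[OF assms, of "\<theta> + s"] by (simp add: circle_quotient_def add.assoc)
qed

lemma circle_quotient_continuous:
  assumes x: "x \<in> Vect" shows "continuous_on UNIV (circle_quotient x \<theta>)"
proof (rule continuous_at_imp_continuous_on, rule ballI)
  fix s0 :: real
  let ?F = "\<lambda>s. complex_of_real (x (\<theta> + s) - x \<theta>)"
  show "isCont (circle_quotient x \<theta>) s0"
  proof (cases "cis s0 = 1")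
    case True
    then obtain n :: int where n: "s0 = of_int n * (2 * pi)" by (rule cis_eq_1_period)
    have x0: "x (\<theta> + s0) = x \<theta>" "deriv x (\<theta> + s0) = deriv x \<theta>"
      unfolding n by (intro Vect_periodic_int x Vect_intros)+
    have "((\<lambda>s. x (\<theta> + s)) has_real_derivative deriv x \<theta>) (at s0)"
      using Vect_has_deriv[OF x, of "\<theta> + s0"] x0 DERIV_shift[of x "deriv x \<theta>" s0 \<theta>] by (simp add: add.commute)
    then have "((\<lambda>s. (x (\<theta> + s) - x \<theta>) / (s - s0)) \<longlongrightarrow> deriv x \<theta>) (at s0)"
      by (simp add: has_field_derivative_iff x0)
    then have num: "((\<lambda>s. ?F s / of_real (s - s0)) \<longlongrightarrow> of_real (deriv x \<theta>)) (at s0)"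
      by (drule_tac tendsto_of_real[where 'a = complex]) (simp only: of_real_divide)
    have cs: "cos s0 = 1" "sin s0 = 0"
      using True by (simp_all add: complex_eq_iff)
    have "((\<lambda>s. (cos s - 1) / (s - s0)) \<longlongrightarrow> 0) (at s0)" "((\<lambda>s. sin s / (s - s0)) \<longlongrightarrow> 1) (at s0)"
      using DERIV_cos[of s0] DERIV_sin[of s0] by (simp_all add: has_field_derivative_iff cs)
    then have "((\<lambda>s. Complex ((cos s - 1) / (s - s0)) (sin s / (s - s0))) \<longlongrightarrow> Complex 0 1) (at s0)"
      by (rule tendsto_Complex)
    moreover have "Complex ((cos s - 1) / (s - s0)) (sin s / (s - s0)) = (cis s - 1) / of_real (s - s0)" for s
      unfolding complex_eq_iff Re_divide_of_real Im_divide_of_real by simp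
    moreover have "Complex 0 1 = \<i>" by (simp add: complex_eq_iff)
    ultimately have den: "((\<lambda>s. (cis s - 1) / of_real (s - s0)) \<longlongrightarrow> \<i>) (at s0)"
      by (simp only:)
    have "\<forall>\<^sub>F s in at s0. (cis s - 1) / of_real (s - s0) \<noteq> 0"
      by (rule tendsto_imp_eventually_ne[OF den]) simp
    then have "\<forall>\<^sub>F s in at s0. (?F s / of_real (s - s0)) / ((cis s - 1) / of_real (s - s0)) = circle_quotient x \<theta> s"
      by eventually_elim (auto simp: circle_quotient_def)
    with tendsto_divide[OF num den] have "((circle_quotient x \<theta>) \<longlongrightarrow> of_real (deriv x \<theta>) / \<i>) (at s0)"
      by (auto intro: Lim_transform_eventually)
    then show ?thesis using True by (simp add: isCont_def circle_quotient_def)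
  next
    case False
    have cis: "isCont cis s0"
      using has_vector_derivative_continuous[OF cis_has_derivative[of 1 s0 UNIV]] by simp
    then have "\<forall>\<^sub>F s in nhds s0. cis s \<noteq> 1"
      using False tendsto_imp_eventually_ne[of cis "cis s0" "nhds s0" 1]
      by (simp add: isCont_def tendsto_at_iff_tendsto_nhds)
    then have "\<forall>\<^sub>F s in nhds s0. circle_quotient x \<theta> s = ?F s / (cis s - 1)"
      by eventually_elim (simp add: circle_quotient_def)
    moreover have "isCont (\<lambda>s. ?F s / (cis s - 1)) s0"
    proof -
      have "isCont (\<lambda>s. x (\<theta> + s)) s0"
        by (rule isCont_o2[where f = "\<lambda>s. \<theta> + s"])
          (auto intro!: continuous_intros DERIV_isCont[OF Vect_has_deriv[OF x]])
      then show ?thesis using False by (intro continuous_intros cis) auto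
    qed
    ultimately show ?thesis by (simp add: isCont_cong)
  qed
qed

text \<open>Chernoff's argument: multiplying the quotient \<open>g\<close> by \<open>cis s - 1\<close> makes the Fourier coefficients of
  \<open>x (\<theta> + s) - x \<theta>\<close> differences of consecutive coefficients of \<open>g\<close>, so the partial sums telescope
  and the Riemann-Lebesgue lemma gives their limit. For \<open>x\<close> in \<open>\<dd>\<close> the modes of order zero and
  one are absent.\<close>

lemma fourier_series_ker:
  assumes xd: "x \<in> \<dd>"
  shows "(\<lambda>k. fourier_coeff (k + 2) x * cis (real (k + 2) * \<theta>) +
      cnj (fourier_coeff (k + 2) x) * cis (- (real (k + 2) * \<theta>))) sums complex_of_real (x \<theta>)"
proof -
  have x: "x \<in> Vect" using xd by (rule ker_eta_Vect)
  let ?g = "circle_quotient x \<theta>"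
  define G where "G m = integral {0..2 * pi} (\<lambda>s. ?g s * cis (of_int (- m) * s))" for m :: int
  define A where "A m = integral {0..2 * pi} (\<lambda>s. complex_of_real (x (\<theta> + s) - x \<theta>) * cis (of_int (- m) * s))"
    for m :: int
  have cg: "continuous_on S ?g" for S
    using circle_quotient_continuous[OF x] continuous_on_subset by blast
  have cx: "continuous_on S (\<lambda>s. x (\<theta> + s))" for S
    by (intro continuous_on_compose2[OF Vect_continuous[OF x, of UNIV]] continuous_intros) auto
  have A: "A m = G (m - 1) - G m" for m
  proof -
    have "A m = integral {0..2 * pi} (\<lambda>s. ?g s * cis (of_int (- (m - 1)) * s) - ?g s * cis (of_int (- m) * s))"
      unfolding A_def
    proof (rule integral_cong)
      fix s
      have "cis (of_int (- (m - 1)) * s) = cis s * cis (of_int (- m) * s)"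
        by (simp add: cis_mult algebra_simps)
      then show "complex_of_real (x (\<theta> + s) - x \<theta>) * cis (of_int (- m) * s) =
          ?g s * cis (of_int (- (m - 1)) * s) - ?g s * cis (of_int (- m) * s)"
        unfolding circle_quotient_mult[OF x, symmetric]
        by (simp only: mult.assoc left_diff_distrib right_diff_distrib mult_1)
    qed
    also have "\<dots> = G (m - 1) - G m"
      unfolding G_def
      by (intro Henstock_Kurzweil_Integration.integral_diff integrable_continuous_interval continuous_intros cg)
    finally show ?thesis .
  qed
  have Acnj: "A (- m) = cnj (A m)" for m
    unfolding A_def by (subst integral_cnj) (simp add: cis_cnj)
  have coeff: "fourier_coeff n x * cis (real n * \<theta>) =
      (A (int n) + of_real (x \<theta>) * integral {0..2 * pi} (\<lambda>s. cis (of_int (- int n) * s))) / of_real (2 * pi)" for n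
  proof -
    let ?f = "\<lambda>\<phi>. complex_of_real (x \<phi>) * cis (- real n * \<phi>)"
    have per: "?f (\<phi> + 2 * pi) = ?f \<phi>" for \<phi>
    proof -
      have "cis (- real n * (\<phi> + 2 * pi)) = cis (- real n * \<phi>) * cis (2 * pi * (- real n))"
        by (simp add: cis_mult algebra_simps)
      then show ?thesis using cis_multiple_2pi[of "- real n"] by (simp add: Vect_periodic[OF x])
    qed
    have cf: "continuous_on UNIV ?f" by (intro continuous_intros Vect_continuous x)
    have "integral {0..2 * pi} ?f * cis (real n * \<theta>) = integral {0..2 * pi} (\<lambda>s. ?f (s + \<theta>) * cis (real n * \<theta>))"
      using integral_circle_shift[OF per cf, of \<theta>] by simp
    also have "\<dots> = integral {0..2 * pi} (\<lambda>s. complex_of_real (x (\<theta> + s) - x \<theta>) * cis (of_int (- int n) * s)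
        + of_real (x \<theta>) * cis (of_int (- int n) * s))"
    proof (rule integral_cong)
      fix s
      have "cis (- real n * (s + \<theta>)) * cis (real n * \<theta>) = cis (of_int (- int n) * s)"
        by (simp add: cis_mult algebra_simps)
      then show "?f (s + \<theta>) * cis (real n * \<theta>) = complex_of_real (x (\<theta> + s) - x \<theta>) * cis (of_int (- int n) * s)
          + of_real (x \<theta>) * cis (of_int (- int n) * s)"
        by (simp add: mult.assoc add.commute[of s] algebra_simps del: cis_mult)
    qed
    also have "\<dots> = A (int n) + integral {0..2 * pi} (\<lambda>s. of_real (x \<theta>) * cis (of_int (- int n) * s))"
      unfolding A_def
      by (intro Henstock_Kurzweil_Integration.integral_add integrable_continuous_interval continuous_intros cx)
    finally show ?thesis by (simp add: fourier_coeff_def)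
  qed
  have coeff': "fourier_coeff n x * cis (real n * \<theta>) = A (int n) / of_real (2 * pi)" if "n \<noteq> 0" for n
    using coeff[of n] integral_cis_circle[of "- int n"] that by simp
  have eta: "eta0 x = 0" "eta1 x = 0" using xd by (auto simp: ker_eta_def)
  have A0: "A 0 = - of_real (2 * pi * x \<theta>)"
  proof -
    have "integral {0..2 * pi} (\<lambda>s. complex_of_real (x s)) = of_real (integral {0..2 * pi} x)"
      using integral_linear[OF Vect_integrable[OF x] bounded_linear_of_real] by (simp add: o_def)
    then have "fourier_coeff 0 x = 0" using eta(1) by (simp add: fourier_coeff_def eta0_def)
    with coeff[of 0] have "A 0 + of_real (x \<theta>) * of_real (2 * pi) = 0" by (simp add: scaleR_conv_of_real)
    then show ?thesis by (simp add: eq_neg_iff_add_eq_0 mult.commute)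
  qed
  have A1: "A 1 = 0" using coeff'[of 1] eta(2) by simp
  define E where "E n = G (- int n - 1) - G (int n)" for n :: nat
  have ES: "E (Suc n) - E n = A (int (Suc n)) + A (- int (Suc n))" for n
  proof -
    have "- int (Suc n) = - int n - 1" by simp
    then show ?thesis by (simp only: E_def A) simp
  qed
  have E1: "E 1 = - of_real (2 * pi * x \<theta>)"
  proof -
    have "E 0 = A 0" by (simp add: E_def A)
    moreover have "E 1 - E 0 = A 1 + cnj (A 1)" using ES[of 0] by (simp add: Acnj)
    ultimately show ?thesis using A0 A1 by (simp add: eq_neg_iff_add_eq_0)
  qed
  have G0: "\<exists>N. \<forall>m. int N \<le> \<bar>m\<bar> \<longrightarrow> norm (G m) \<le> e" if e: "e > 0" for e
  proof -
    obtain N where "\<forall>m. int N \<le> \<bar>m\<bar> \<longrightarrow> norm (integral {0..2 * pi} (\<lambda>s. ?g s * cis (of_int m * s))) \<le> e"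
      using riemann_lebesgue[OF circle_quotient_continuous[OF x] circle_quotient_periodic[OF x] e] by blast
    then have "\<forall>m. int N \<le> \<bar>m\<bar> \<longrightarrow> norm (G m) \<le> e"
      unfolding G_def by (metis abs_minus_cancel)
    then show ?thesis by blast
  qed
  have "E \<longlonglongrightarrow> 0"
  proof (rule LIMSEQ_I)
    fix r :: real assume "r > 0"
    then obtain N where N: "\<And>m. int N \<le> \<bar>m\<bar> \<Longrightarrow> norm (G m) \<le> r / 3" using G0[of "r / 3"] by auto
    have "norm (E n) < r" if n: "N \<le> n" for n
    proof -
      have "norm (G (- int n - 1)) \<le> r / 3" "norm (G (int n)) \<le> r / 3" using n by (intro N; simp)+
      then show ?thesis
        using norm_triangle_ineq4[of "G (- int n - 1)" "G (int n)"] \<open>r > 0\<close> unfolding E_def by linarith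
    qed
    then show "\<exists>n0. \<forall>n\<ge>n0. norm (E n - 0) < r" by auto
  qed
  from tendsto_divide[OF LIMSEQ_Suc[OF this] tendsto_const, of "of_real (2 * pi)"]
  have "(\<lambda>n. E (Suc n) / of_real (2 * pi)) \<longlonglongrightarrow> 0 / of_real (2 * pi)" by simp
  from telescope_sums[OF this]
  have "(\<lambda>n. E (Suc (Suc n)) / of_real (2 * pi) - E (Suc n) / of_real (2 * pi)) sums (0 / of_real (2 * pi) - E (Suc 0) / of_real (2 * pi))" .
  moreover have "E (Suc (Suc n)) / of_real (2 * pi) - E (Suc n) / of_real (2 * pi) =
      fourier_coeff (n + 2) x * cis (real (n + 2) * \<theta>) +
      cnj (fourier_coeff (n + 2) x) * cis (- (real (n + 2) * \<theta>))" for n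
  proof -
    have c: "fourier_coeff (n + 2) x * cis (real (n + 2) * \<theta>) = A (int (n + 2)) / of_real (2 * pi)"
      by (rule coeff') simp
    have "cnj (fourier_coeff (n + 2) x) * cis (- (real (n + 2) * \<theta>)) =
        cnj (fourier_coeff (n + 2) x * cis (real (n + 2) * \<theta>))"
      by (simp only: complex_cnj_mult cis_cnj)
    also have "\<dots> = A (- int (n + 2)) / of_real (2 * pi)"
      unfolding c Acnj by (simp del: of_nat_add of_real_mult)
    finally have "fourier_coeff (n + 2) x * cis (real (n + 2) * \<theta>) +
        cnj (fourier_coeff (n + 2) x) * cis (- (real (n + 2) * \<theta>)) =
        (A (int (n + 2)) + A (- int (n + 2))) / of_real (2 * pi)"
      unfolding c by (simp only: add_divide_distrib)
    then show ?thesis using ES[of "Suc n"] by (simp add: diff_divide_distrib[symmetric])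
  qed
  moreover have "0 / of_real (2 * pi) - E (Suc 0) / of_real (2 * pi) = complex_of_real (x \<theta>)"
    using E1 by simp
  ultimately show ?thesis by (simp only:)
qed

section \<open>Normal geodesics\<close>

text \<open>Preservation of orientation keeps the angular derivative away from zero, so the quotient that defines
  the Maurer-Cartan form is smooth in time as well.\<close>

lemma left_log_deriv_curve:
  assumes s: "smooth_diff_curve \<gamma>" and h: "horizontal \<gamma>"
  shows "left_log_deriv \<gamma> \<in> curves \<dd>"
proof -
  let ?G = "\<lambda>t \<theta>. \<gamma> t (cis \<theta>)"
  have G: "smooth_family ?G" using s by (simp add: smooth_diff_curve_def)
  have a: "smooth_family (\<lambda>t. angle_deriv (\<gamma> t))"
    unfolding angle_deriv_def[abs_def]
    using smooth_family_angle_partial[OF G angle_partial_vector_derivative[OF G]] .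
  have nz: "angle_deriv (\<gamma> t) \<theta> \<noteq> 0" if "t \<in> {0..1}" for t \<theta>
  proof -
    have "Im (cnj (\<gamma> t (cis \<theta>)) * angle_deriv (\<gamma> t) \<theta>) > 0"
      using s that unfolding smooth_diff_curve_def Diff_def by blast
    then show ?thesis by auto
  qed
  have "smooth_family (\<lambda>t \<theta>. Re (velocity \<gamma> t \<theta> * inverse (angle_deriv (\<gamma> t) \<theta>)))"
    unfolding velocity_def
    by (intro smooth_family_bounded_linear[OF _ bounded_linear_Re] smooth_family_mult
        smooth_family_inverse a nz smooth_family_time_deriv G)
  then have "smooth_family (left_log_deriv \<gamma>)"
    by (simp add: left_log_deriv_def[abs_def] maurer_cartan_def divide_inverse)
  moreover have "left_log_deriv \<gamma> t \<in> \<dd>" if "t \<in> {0..1}" for t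
    using h that by (auto simp: horizontal_def distribution_def left_log_deriv_def)
  ultimately show ?thesis by (simp add: curves_def)
qed

lemma normal_geodesic_iff:
  assumes "smooth_diff_curve \<gamma>" "horizontal \<gamma>"
  shows "normal_geodesic \<gamma> \<longleftrightarrow> (\<exists>lam \<in> curves \<mm>. geodesic_equation (left_log_deriv \<gamma>) lam)"
  using left_log_deriv_curve[OF assms] assms
  by (auto simp: normal_geodesic_def Let_def intro: critical_imp_geodesic_equation geodesic_equation_imp_critical)

text \<open>The residual of the momentum lies in \<open>\<dd>\<close>, so the geodesic equation has the same components in
  the Moebius algebra as the multiplier equation.\<close>

lemma multiplier_time_deriv:
  assumes u: "u \<in> curves \<dd>" and lam: "lam \<in> curves \<mm>" and eq: "geodesic_equation u lam" and t: "t \<in> {0..1}"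
    and coord: "lam t = mob a w"
  shows "eta0 (time_deriv lam t) = 0 \<and> eta1 (time_deriv lam t) = 3 * \<i> * cnj w * fourier_coeff 2 (u t)"
proof (rule eta_eqI)
  have uV: "u \<in> curves Vect" and lV: "lam \<in> curves Vect"
    using u lam by (auto intro: curves_ker_Vect curves_mob_Vect)
  show tV: "time_deriv lam t \<in> Vect" by (rule curves_slice[OF curves_time_deriv[OF lV] t])
  fix b z
  let ?M = "coadjoint_residual u (\<lambda>t. momentum (u t)) t"
  have "?M \<theta> + coadjoint_residual u lam t \<theta> = 0" for \<theta>
    using eq[unfolded geodesic_equation_iff[OF uV lV]] t by blast
  then have "time_deriv lam t = (\<lambda>\<theta>. ad_transpose (u t) (mob a w) \<theta> + ?M \<theta>)"
    by (simp add: fun_eq_iff coadjoint_residual_def[of u lam] coord algebra_simps)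
  then have "L2 (time_deriv lam t) (mob b z) = L2 (ad_transpose (u t) (mob a w)) (mob b z) + L2 ?M (mob b z)"
    using curves_slice[OF uV t] ker_eta_Vect[OF curves_slice[OF momentum_residual_ker[OF u] t]]
    by (simp add: L2_add_left ad_transpose_Vect)
  also have "L2 ?M (mob b z) = 0"
    by (rule L2_ker_mob[OF curves_slice[OF momentum_residual_ker[OF u] t] mob_in_algebra])
  finally show "L2 (time_deriv lam t) (mob b z) = 2 * Re (cnj z * (3 * \<i> * cnj w * fourier_coeff 2 (u t)))"
    by (simp only: L2_ad_transpose_mob[OF curves_slice[OF u t]] add_0_right)
qed

lemma geodesic_equation_expanded:
  assumes u: "u \<in> curves Vect" and lam: "lam \<in> curves Vect" and eq: "geodesic_equation u lam" and t: "t \<in> {0..1}"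
  shows "mob_op (hilbert (time_deriv u t)) \<theta> =
    u t \<theta> * (deriv (deriv (deriv (deriv (hilbert (u t))))) \<theta> + deriv (deriv (hilbert (u t))) \<theta> + deriv (lam t) \<theta>)
    + 2 * deriv (u t) \<theta> * (deriv (deriv (deriv (hilbert (u t)))) \<theta> + deriv (hilbert (u t)) \<theta> + lam t \<theta>)
    - time_deriv lam t \<theta>"
proof -
  let ?v = "hilbert (u t)"
  have V: "u t \<in> Vect" "lam t \<in> Vect" "time_deriv u t \<in> Vect" "?v \<in> Vect"
    using curves_slice[OF u t] curves_slice[OF lam t] curves_slice[OF curves_time_deriv[OF u] t]
    by (auto intro: hilbert_Vect)
  have d: "deriv (mob_op ?v) \<theta> = deriv (deriv (deriv (deriv ?v))) \<theta> + deriv (deriv ?v) \<theta>"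
    unfolding mob_op_def[abs_def] by (intro deriv_add_Vect Vect_intros V)
  have "momentum (time_deriv u t) \<theta> + time_deriv lam t \<theta> =
      ad_transpose (u t) (\<lambda>\<theta>. momentum (u t) \<theta> + lam t \<theta>) \<theta>"
    using eq t by (simp add: geodesic_equation_def)
  then show ?thesis
    using V by (simp add: momentum_eq ad_transpose_def deriv_add_Vect mob_op_Vect d)
      (simp add: mob_op_def[of ?v] algebra_simps)
qed

theorem mainTheorem2:
  fixes \<gamma> :: "real \<Rightarrow> complex \<Rightarrow> complex"
    and u v :: "real \<Rightarrow> real \<Rightarrow> real"
    and c :: "nat \<Rightarrow> real \<Rightarrow> complex"
  assumes smooth: "smooth_diff_curve \<gamma>"
    and horizontal: "horizontal \<gamma>"
    and u: "u = left_log_deriv \<gamma>"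
    and v: "v = (\<lambda>t. hilbert (u t))"
    and c: "c = (\<lambda>n t. fourier_coeff n (u t))"
  shows "(normal_geodesic \<gamma> \<longleftrightarrow> (\<exists>lam \<in> curves \<mm>. geodesic_equation u lam)) \<and>
    (\<forall>t\<in>{0..1}. \<forall>\<theta>.
      (\<lambda>k. c (k + 2) t * cis (real (k + 2) * \<theta>) + cnj (c (k + 2) t) * cis (- (real (k + 2) * \<theta>)))
        sums complex_of_real (u t \<theta>)) \<and>
    (\<forall>lam \<in> curves \<mm>. \<forall>(lam0 :: real \<Rightarrow> real) (w :: real \<Rightarrow> complex).
      geodesic_equation u lam \<and>
      (\<forall>t\<in>{0..1}. \<forall>\<theta>. complex_of_real (lam t \<theta>) =
          complex_of_real (lam0 t) + w t * cis \<theta> + cnj (w t) * cis (- \<theta>)) \<longrightarrow>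
      (\<forall>t\<in>{0..1}.
        (lam0 has_real_derivative 0) (at t within {0..1}) \<and>
        (w has_vector_derivative 3 * \<i> * cnj (w t) * c 2 t) (at t within {0..1}) \<and>
        (\<forall>\<theta>. complex_of_real ((deriv ^^ 3) (time_deriv v t) \<theta> + deriv (time_deriv v t) \<theta>) =
          complex_of_real
            (u t \<theta> * (deriv ^^ 4) (v t) \<theta> + u t \<theta> * (deriv ^^ 2) (v t) \<theta>
             + 2 * deriv (u t) \<theta> * (deriv ^^ 3) (v t) \<theta> + 2 * deriv (u t) \<theta> * deriv (v t) \<theta>
             + 2 * lam t \<theta> * deriv (u t) \<theta> + u t \<theta> * deriv (lam t) \<theta>)
          - 3 * \<i> * (cnj (w t) * c 2 t * cis \<theta> - w t * cnj (c 2 t) * cis (- \<theta>)))))"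
proof -
  have uc: "u \<in> curves \<dd>" unfolding u by (rule left_log_deriv_curve[OF smooth horizontal])
  have uV: "u \<in> curves Vect" using uc by (rule curves_ker_Vect)
  have "(lam0 has_real_derivative 0) (at t within {0..1}) \<and>
      (w has_vector_derivative 3 * \<i> * cnj (w t) * c 2 t) (at t within {0..1}) \<and>
      complex_of_real ((deriv ^^ 3) (time_deriv v t) \<theta> + deriv (time_deriv v t) \<theta>) =
        complex_of_real
          (u t \<theta> * (deriv ^^ 4) (v t) \<theta> + u t \<theta> * (deriv ^^ 2) (v t) \<theta>
           + 2 * deriv (u t) \<theta> * (deriv ^^ 3) (v t) \<theta> + 2 * deriv (u t) \<theta> * deriv (v t) \<theta>
           + 2 * lam t \<theta> * deriv (u t) \<theta> + u t \<theta> * deriv (lam t) \<theta>)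
        - 3 * \<i> * (cnj (w t) * c 2 t * cis \<theta> - w t * cnj (c 2 t) * cis (- \<theta>))"
    if lam: "lam \<in> curves \<mm>" and eq: "geodesic_equation u lam"
      and coord: "\<forall>t\<in>{0..1}. \<forall>\<theta>. complex_of_real (lam t \<theta>) =
          complex_of_real (lam0 t) + w t * cis \<theta> + cnj (w t) * cis (- \<theta>)"
      and t: "t \<in> {0..1}" for lam lam0 w t \<theta>
  proof -
    have lV: "lam \<in> curves Vect" using lam by (rule curves_mob_Vect)
    have lm: "lam s = mob (lam0 s) (w s)" if "s \<in> {0..1}" for s
    proof
      fix \<theta> show "lam s \<theta> = mob (lam0 s) (w s) \<theta>"
        using coord that mob_complex[of "lam0 s" "w s" \<theta>] by (metis of_real_eq_iff)
    qed
    let ?W = "3 * \<i> * cnj (w t) * c 2 t"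
    have eta: "eta0 (time_deriv lam t) = 0" "eta1 (time_deriv lam t) = ?W"
      using multiplier_time_deriv[OF uc lam eq t lm[OF t]] by (simp_all add: c)
    have "((\<lambda>s. eta0 (lam s)) has_vector_derivative 0) (at t within {0..1})"
      using eta0_has_time_deriv[OF lV t] eta by (simp add: has_real_derivative_iff_has_vector_derivative)
    then have lam0': "(lam0 has_vector_derivative 0) (at t within {0..1})"
      by (rule has_vector_derivative_transform[OF t, rotated]) (simp add: lm eta0_mob)
    have "((\<lambda>s. eta1 (lam s)) has_vector_derivative ?W) (at t within {0..1})"
      using fourier_has_time_deriv[OF lV t, of 1] unfolding eta .
    then have w': "(w has_vector_derivative ?W) (at t within {0..1})"
      by (rule has_vector_derivative_transform[OF t, rotated]) (simp only: lm eta1_mob)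
    have lam': "time_deriv lam t = mob 0 ?W"
      using time_deriv_mob_curve[OF lam t] eta unfolding mob_algebra_iff by (metis eta0_mob eta1_mob)
    have lamC: "complex_of_real (time_deriv lam t \<theta>) = 3 * \<i> * (cnj (w t) * c 2 t * cis \<theta> - w t * cnj (c 2 t) * cis (- \<theta>))"
      unfolding lam' mob_complex[symmetric] by (simp add: algebra_simps)
    have "time_deriv v t = hilbert (time_deriv u t)"
      unfolding v by (rule time_deriv_hilbert[OF uV t])
    then have "(deriv ^^ 3) (time_deriv v t) \<theta> + deriv (time_deriv v t) \<theta> =
        (u t \<theta> * (deriv ^^ 4) (v t) \<theta> + u t \<theta> * (deriv ^^ 2) (v t) \<theta>
           + 2 * deriv (u t) \<theta> * (deriv ^^ 3) (v t) \<theta> + 2 * deriv (u t) \<theta> * deriv (v t) \<theta>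
           + 2 * lam t \<theta> * deriv (u t) \<theta> + u t \<theta> * deriv (lam t) \<theta>) - time_deriv lam t \<theta>"
      using geodesic_equation_expanded[OF uV lV eq t, of \<theta>]
      by (simp add: v eval_nat_numeral mob_op_def algebra_simps)
    then have "complex_of_real ((deriv ^^ 3) (time_deriv v t) \<theta> + deriv (time_deriv v t) \<theta>) =
        complex_of_real
          (u t \<theta> * (deriv ^^ 4) (v t) \<theta> + u t \<theta> * (deriv ^^ 2) (v t) \<theta>
           + 2 * deriv (u t) \<theta> * (deriv ^^ 3) (v t) \<theta> + 2 * deriv (u t) \<theta> * deriv (v t) \<theta>
           + 2 * lam t \<theta> * deriv (u t) \<theta> + u t \<theta> * deriv (lam t) \<theta>)
        - 3 * \<i> * (cnj (w t) * c 2 t * cis \<theta> - w t * cnj (c 2 t) * cis (- \<theta>))"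
      by (simp only: of_real_diff lamC)
    then show ?thesis
      using lam0' w' by (simp only: has_real_derivative_iff_has_vector_derivative)
  qed
  moreover have "(\<lambda>k. c (k + 2) t * cis (real (k + 2) * \<theta>) + cnj (c (k + 2) t) * cis (- (real (k + 2) * \<theta>)))
        sums complex_of_real (u t \<theta>)" if "t \<in> {0..1}" for t \<theta>
    unfolding c by (rule fourier_series_ker[OF curves_slice[OF uc that]])
  ultimately show ?thesis
    using normal_geodesic_iff[OF smooth horizontal] unfolding u[symmetric] by blast
qed

end
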